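(* Let $(M,g,J,\Omega)$ be a strictly almost Kähler 4-manifold satisfying the third Gray condition $R_{XYZU} = R_{JXJYJZJU}$, and let $(g,I)$ be the opposite almost Hermitian structure associated to $(g,J)$, which is defined on the open set $U\subset M$ where $|\nabla J|\neq 0$. Then, on $U$, $(g,I)$ is a Kähler structure.
   Context: An almost Kähler structure on a manifold $M$ is a triple $(g,J,\Omega)$ where $\Omega$ is a symplectic form, $J$ an almost complex structure and $g$ a Riemannian metric with $\Omega(\cdot,\cdot)=g(J\cdot,\cdot)$; it is strictly almost Kähler if $J$ is not integrable. $R$ is the Riemannian curvature tensor of $g$ and $\nabla$ its Levi-Civita connection. On the open set $U$ of points where $\nabla J\neq0$ (equivalently, the Nijenhuis tensor of $J$ is non-zero), the Kähler nullity of $(g,J)$ is the distribution $D=\{X\in TM:\nabla_XJ=0\}$; in dimension four it is a $J$-invariant distribution of real rank 2 on $U$. Let $D^\perp$ be its $g$-orthogonal complement. The opposite almost complex structure $I$ on $U$ is the $g$-orthogonal almost complex structure equal to $J$ on $D$ and to $-J$ on $D^\perp$. $(g,I)$ is Kähler if $I$ is integrable and the 2-form $g(I\cdot,\cdot)$ is closed. *)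

theory Defs
  imports "HOL-Analysis.Analysis"
begin

section \<open>Smooth functions and smooth manifolds\<close>

text \<open>
  Intended for open \<open>S\<close>: derivatives are full Frechet derivatives at the points of \<open>S\<close>.
\<close>

primrec Ck_on :: "nat \<Rightarrow> 'e::euclidean_space set \<Rightarrow> ('e \<Rightarrow> 'f::real_normed_vector) \<Rightarrow> bool" where
  "Ck_on 0 S f \<longleftrightarrow> continuous_on S f"
| "Ck_on (Suc k) S f \<longleftrightarrow> (\<forall>x\<in>S. f differentiable (at x)) \<and>
     (\<forall>v. Ck_on k S (\<lambda>x. frechet_derivative f (at x) v))"

definition smooth_on :: "'e::euclidean_space set \<Rightarrow> ('e \<Rightarrow> 'f::real_normed_vector) \<Rightarrow> bool" where
  "smooth_on S f \<longleftrightarrow> (\<forall>k. Ck_on k S f)"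

text \<open>
  A chart is a pair of its domain and its coordinate map (whose values outside the domain
  are irrelevant). \<open>coords c S\<close> is the part of the open set \<open>S\<close> seen in the coordinates of \<open>c\<close>.
\<close>

type_synonym ('a, 'n) chart = "'a set \<times> ('a \<Rightarrow> real ^ 'n)"

definition coords :: "('a, 'n::finite) chart \<Rightarrow> 'a set \<Rightarrow> (real ^ 'n) set" where
  "coords c S = snd c ` (fst c \<inter> S)"

definition transition :: "('a, 'n::finite) chart \<Rightarrow> ('a, 'n) chart \<Rightarrow> real ^ 'n \<Rightarrow> real ^ 'n" where
  "transition c d = snd d \<circ> inv_into (fst c) (snd c)"

definition smooth_atlas :: "'a topology \<Rightarrow> ('a, 'n::finite) chart set \<Rightarrow> bool" where
  "smooth_atlas X A \<longleftrightarrow>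
     (\<Union>c\<in>A. fst c) = topspace X \<and>
     (\<forall>c\<in>A. openin X (fst c) \<and> open (snd c ` fst c) \<and>
        homeomorphic_map (subtopology X (fst c)) (top_of_set (snd c ` fst c)) (snd c)) \<and>
     (\<forall>c\<in>A. \<forall>d\<in>A. smooth_on (coords c (fst d)) (transition c d))"

definition smooth_manifold :: "'a topology \<Rightarrow> ('a, 'n::finite) chart set \<Rightarrow> bool" where
  "smooth_manifold X A \<longleftrightarrow> Hausdorff_space X \<and> second_countable X \<and> smooth_atlas X A"


section \<open>Tensor fields\<close>

text \<open>
  A tensor field assigns to each chart its local representative, a function of the coordinate
  point and of coordinate tangent vectors; the representatives are related by the differentials
  of the transition maps. Values at coordinate points outside the chart are irrelevant.
\<close>

type_synonym 'n local_bilin = "real ^ 'n \<Rightarrow> real ^ 'n \<Rightarrow> real ^ 'n \<Rightarrow> real"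
type_synonym 'n local_endo = "real ^ 'n \<Rightarrow> real ^ 'n \<Rightarrow> real ^ 'n"
type_synonym ('a, 'n) bilin_field = "('a, 'n) chart \<Rightarrow> 'n local_bilin"
type_synonym ('a, 'n) endo_field = "('a, 'n) chart \<Rightarrow> 'n local_endo"

definition bilin_field_on ::
  "('a, 'n::finite) chart set \<Rightarrow> 'a set \<Rightarrow> ('a, 'n) bilin_field \<Rightarrow> bool" where
  "bilin_field_on A S b \<longleftrightarrow>
     (\<forall>c\<in>A. (\<forall>x\<in>coords c S. bilinear (b c x)) \<and>
        (\<forall>u v. smooth_on (coords c S) (\<lambda>x. b c x u v))) \<and>
     (\<forall>c\<in>A. \<forall>d\<in>A. \<forall>x\<in>coords c (fst d \<inter> S). \<forall>u v.
        b c x u v = b d (transition c d x)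
          (frechet_derivative (transition c d) (at x) u)
          (frechet_derivative (transition c d) (at x) v))"

definition endo_field_on ::
  "('a, 'n::finite) chart set \<Rightarrow> 'a set \<Rightarrow> ('a, 'n) endo_field \<Rightarrow> bool" where
  "endo_field_on A S J \<longleftrightarrow>
     (\<forall>c\<in>A. (\<forall>x\<in>coords c S. linear (J c x)) \<and>
        (\<forall>v. smooth_on (coords c S) (\<lambda>x. J c x v))) \<and>
     (\<forall>c\<in>A. \<forall>d\<in>A. \<forall>x\<in>coords c (fst d \<inter> S). \<forall>v.
        frechet_derivative (transition c d) (at x) (J c x v) =
        J d (transition c d x) (frechet_derivative (transition c d) (at x) v))"

definition riemannian_metric_on ::
  "('a, 'n::finite) chart set \<Rightarrow> 'a set \<Rightarrow> ('a, 'n) bilin_field \<Rightarrow> bool" where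
  "riemannian_metric_on A S g \<longleftrightarrow> bilin_field_on A S g \<and>
     (\<forall>c\<in>A. \<forall>x\<in>coords c S. (\<forall>u v. g c x u v = g c x v u) \<and> (\<forall>v. v \<noteq> 0 \<longrightarrow> g c x v v > 0))"

definition almost_complex_on ::
  "('a, 'n::finite) chart set \<Rightarrow> 'a set \<Rightarrow> ('a, 'n) endo_field \<Rightarrow> bool" where
  "almost_complex_on A S J \<longleftrightarrow> endo_field_on A S J \<and>
     (\<forall>c\<in>A. \<forall>x\<in>coords c S. \<forall>v. J c x (J c x v) = - v)"

definition fundamental_form ::
  "('a, 'n::finite) bilin_field \<Rightarrow> ('a, 'n) endo_field \<Rightarrow> ('a, 'n) bilin_field" where
  "fundamental_form g J c x u v = g c x (J c x u) v"


section \<open>Local differential operators\<close>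

text \<open>
  Tensors obtained by differentiation are evaluated on the constant extensions of coordinate
  vectors. Such fields commute, so bracket terms drop out of the formulas for the exterior
  derivative and for the Levi-Civita connection.
\<close>

definition ext_deriv ::
  "'n::finite local_bilin \<Rightarrow> real ^ 'n \<Rightarrow> real ^ 'n \<Rightarrow> real ^ 'n \<Rightarrow> real ^ 'n \<Rightarrow> real" where
  "ext_deriv w x u1 u2 u3 =
     frechet_derivative (\<lambda>y. w y u2 u3) (at x) u1 +
     frechet_derivative (\<lambda>y. w y u3 u1) (at x) u2 +
     frechet_derivative (\<lambda>y. w y u1 u2) (at x) u3"

definition lie_bracket ::
  "(real ^ 'n::finite \<Rightarrow> real ^ 'n) \<Rightarrow> (real ^ 'n \<Rightarrow> real ^ 'n) \<Rightarrow> real ^ 'n \<Rightarrow> real ^ 'n" where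
  "lie_bracket V W x = frechet_derivative W (at x) (V x) - frechet_derivative V (at x) (W x)"

definition nijenhuis :: "'n::finite local_endo \<Rightarrow> real ^ 'n \<Rightarrow> real ^ 'n \<Rightarrow> real ^ 'n \<Rightarrow> real ^ 'n" where
  "nijenhuis J x u v =
     lie_bracket (\<lambda>y. J y u) (\<lambda>y. J y v) x
     - J x (lie_bracket (\<lambda>y. J y u) (\<lambda>_. v) x)
     - J x (lie_bracket (\<lambda>_. u) (\<lambda>y. J y v) x)
     - lie_bracket (\<lambda>_. u) (\<lambda>_. v) x"

text \<open>
  The Koszul formula for constant fields; it determines the Levi-Civita connection
  because the metric is nondegenerate.
\<close>

definition christoffel :: "'n::finite local_bilin \<Rightarrow> real ^ 'n \<Rightarrow> real ^ 'n \<Rightarrow> real ^ 'n \<Rightarrow> real ^ 'n" where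
  "christoffel g x u v = (THE z. \<forall>w. 2 * g x z w =
     frechet_derivative (\<lambda>y. g y v w) (at x) u +
     frechet_derivative (\<lambda>y. g y u w) (at x) v -
     frechet_derivative (\<lambda>y. g y u v) (at x) w)"

lemma christoffel_koszul:
  fixes g :: "'n::finite local_bilin"
  assumes S: "open S" "x \<in> S" and b: "\<And>y. y \<in> S \<Longrightarrow> bilinear (g y)"
    and d: "\<And>u v. (\<lambda>y. g y u v) differentiable (at x)"
    and p: "\<And>v. v \<noteq> 0 \<Longrightarrow> g x v v > 0" and s: "\<And>y u v. y \<in> S \<Longrightarrow> g y u v = g y v u"
  shows "2 * g x (christoffel g x u v) w =
     frechet_derivative (\<lambda>y. g y v w) (at x) u +
     frechet_derivative (\<lambda>y. g y u w) (at x) v -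
     frechet_derivative (\<lambda>y. g y u v) (at x) w"
proof -
  define R where "R w = frechet_derivative (\<lambda>y. g y v w) (at x) u +
     frechet_derivative (\<lambda>y. g y u w) (at x) v -
     frechet_derivative (\<lambda>y. g y u v) (at x) w" for w
  have D: "((\<lambda>y. g y a b) has_derivative frechet_derivative (\<lambda>y. g y a b) (at x)) (at x)" for a b
    using d frechet_derivative_works by blast
  have add: "frechet_derivative (\<lambda>y. g y a (b+c)) (at x) = (\<lambda>h. frechet_derivative (\<lambda>y. g y a b) (at x) h + frechet_derivative (\<lambda>y. g y a c) (at x) h)" for a b c
  proof (rule frechet_derivative_at[symmetric])
    have "((\<lambda>y. g y a b + g y a c) has_derivative (\<lambda>h. frechet_derivative (\<lambda>y. g y a b) (at x) h + frechet_derivative (\<lambda>y. g y a c) (at x) h)) (at x)"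
      by (rule has_derivative_add[OF D D])
    then show "((\<lambda>y. g y a (b + c)) has_derivative (\<lambda>h. frechet_derivative (\<lambda>y. g y a b) (at x) h + frechet_derivative (\<lambda>y. g y a c) (at x) h)) (at x)"
      by (rule has_derivative_transform_within_open[OF _ S]) (simp add: b bilinear_radd)
  qed
  have sc: "frechet_derivative (\<lambda>y. g y a (r *\<^sub>R c)) (at x) = (\<lambda>h. r * frechet_derivative (\<lambda>y. g y a c) (at x) h)" for a r c
  proof (rule frechet_derivative_at[symmetric])
    have "((\<lambda>y. r * g y a c) has_derivative (\<lambda>h. r * frechet_derivative (\<lambda>y. g y a c) (at x) h)) (at x)"
      by (rule has_derivative_mult_right[OF D])
    then show "((\<lambda>y. g y a (r *\<^sub>R c)) has_derivative (\<lambda>h. r * frechet_derivative (\<lambda>y. g y a c) (at x) h)) (at x)"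
      by (rule has_derivative_transform_within_open[OF _ S]) (simp add: b bilinear_rmul)
  qed
  have "linear (frechet_derivative (\<lambda>y. g y u v) (at x))" using d linear_frechet_derivative by blast
  then have linR: "linear R"
    by (intro linearI) (auto simp: R_def add sc linear_add linear_scale algebra_simps)
  have bx: "bilinear (g x)" using b S by auto
  define T where "T z = (\<chi> i. 2 * g x z (axis i 1))" for z
  have linT: "linear T"
    by (intro linearI) (auto simp: T_def vec_eq_iff bilinear_ladd[OF bx] bilinear_lmul[OF bx] algebra_simps)
  have ex: "2 * g x z w = (\<Sum>i\<in>UNIV. w $ i * T z $ i)" for z w
  proof -
    have l: "linear (g x z)" using bx by (simp add: bilinear_def)
    have "g x z w = g x z (\<Sum>i\<in>UNIV. w $ i *\<^sub>R axis i 1)" 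
      using basis_expansion[of w] by (simp add: scalar_mult_eq_scaleR)
    also have "\<dots> = (\<Sum>i\<in>UNIV. w $ i * g x z (axis i 1))" by (simp add: linear_sum[OF l] linear_scale[OF l])
    finally show ?thesis by (simp add: T_def sum_distrib_left algebra_simps)
  qed
  have injT: "inj T"
    unfolding linear_injective_0[OF linT]
  proof (intro allI impI, rule ccontr)
    fix z assume "T z = 0" "z \<noteq> 0" then show False using ex[of z z] p[of z] by simp
  qed
  then obtain z where z: "T z = (\<chi> i. R (axis i 1))" 
    using linear_injective_imp_surjective[OF linT injT] by (metis surjD)
  have Rw: "R w = (\<Sum>i\<in>UNIV. w $ i * R (axis i 1))" for w
  proof -
    have "R w = R (\<Sum>i\<in>UNIV. w $ i *\<^sub>R axis i 1)" 
      using basis_expansion[of w] by (simp add: scalar_mult_eq_scaleR)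
    then show ?thesis by (simp add: linear_sum[OF linR] linear_scale[OF linR])
  qed
  have "\<exists>!z. \<forall>w. 2 * g x z w = R w"
  proof (rule ex1I[of _ z])
    show "\<forall>w. 2 * g x z w = R w"
    proof
      fix w
      have "2 * g x z w = (\<Sum>i\<in>UNIV. w $ i * R (axis i 1))" unfolding ex z by simp
      then show "2 * g x z w = R w" by (simp only: Rw[of w, symmetric])
    qed
    fix z' assume a: "\<forall>w. 2 * g x z' w = R w"
    then have "T z' = (\<chi> i. R (axis i 1))" unfolding T_def by (simp add: vec_eq_iff)
    then have "T z' = T z" by (simp only: z)
    then show "z' = z" using injT by (simp add: inj_eq)
  qed
  from theI'[OF this] show ?thesis unfolding christoffel_def R_def by blast
qed

definition nabla ::
  "'n::finite local_bilin \<Rightarrow> (real ^ 'n \<Rightarrow> real ^ 'n) \<Rightarrow> (real ^ 'n \<Rightarrow> real ^ 'n) \<Rightarrow> real ^ 'n \<Rightarrow> real ^ 'n" where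
  "nabla g V W x = frechet_derivative W (at x) (V x) + christoffel g x (V x) (W x)"

text \<open>\<open>nabla_endo g J x v w\<close> is the value at \<open>x\<close> of the covariant derivative of \<open>J\<close> in direction \<open>v\<close>, applied to \<open>w\<close>.\<close>

definition nabla_endo ::
  "'n::finite local_bilin \<Rightarrow> 'n local_endo \<Rightarrow> real ^ 'n \<Rightarrow> real ^ 'n \<Rightarrow> real ^ 'n \<Rightarrow> real ^ 'n" where
  "nabla_endo g J x v w = nabla g (\<lambda>_. v) (\<lambda>y. J y w) x - J x (nabla g (\<lambda>_. v) (\<lambda>_. w) x)"

definition curvature ::
  "'n::finite local_bilin \<Rightarrow> (real ^ 'n \<Rightarrow> real ^ 'n) \<Rightarrow> (real ^ 'n \<Rightarrow> real ^ 'n) \<Rightarrow>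
   (real ^ 'n \<Rightarrow> real ^ 'n) \<Rightarrow> real ^ 'n \<Rightarrow> real ^ 'n" where
  "curvature g V W Z x =
     nabla g V (nabla g W Z) x - nabla g W (nabla g V Z) x - nabla g (lie_bracket V W) Z x"

definition riemann ::
  "'n::finite local_bilin \<Rightarrow> real ^ 'n \<Rightarrow> real ^ 'n \<Rightarrow> real ^ 'n \<Rightarrow> real ^ 'n \<Rightarrow> real ^ 'n \<Rightarrow> real" where
  "riemann g x u v w z = g x (curvature g (\<lambda>_. u) (\<lambda>_. v) (\<lambda>_. w) x) z"


section \<open>Almost Kaehler and Kaehler structures\<close>

definition closed_form_on :: "('a, 'n::finite) chart set \<Rightarrow> 'a set \<Rightarrow> ('a, 'n) bilin_field \<Rightarrow> bool" where
  "closed_form_on A S w \<longleftrightarrow> (\<forall>c\<in>A. \<forall>x\<in>coords c S. \<forall>u1 u2 u3. ext_deriv (w c) x u1 u2 u3 = 0)"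

definition symplectic_form_on :: "('a, 'n::finite) chart set \<Rightarrow> 'a set \<Rightarrow> ('a, 'n) bilin_field \<Rightarrow> bool" where
  "symplectic_form_on A S w \<longleftrightarrow> bilin_field_on A S w \<and>
     (\<forall>c\<in>A. \<forall>x\<in>coords c S. (\<forall>v. w c x v v = 0) \<and> (\<forall>u. u \<noteq> 0 \<longrightarrow> (\<exists>v. w c x u v \<noteq> 0))) \<and>
     closed_form_on A S w"

text \<open>Integrability is the vanishing of the Nijenhuis tensor.\<close>

definition integrable_acs_on :: "('a, 'n::finite) chart set \<Rightarrow> 'a set \<Rightarrow> ('a, 'n) endo_field \<Rightarrow> bool" where
  "integrable_acs_on A S J \<longleftrightarrow> (\<forall>c\<in>A. \<forall>x\<in>coords c S. \<forall>u v. nijenhuis (J c) x u v = 0)"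

definition almost_kaehler ::
  "'a topology \<Rightarrow> ('a, 'n::finite) chart set \<Rightarrow>
   ('a, 'n) bilin_field \<Rightarrow> ('a, 'n) endo_field \<Rightarrow> ('a, 'n) bilin_field \<Rightarrow> bool" where
  "almost_kaehler X A g J \<Omega> \<longleftrightarrow>
     smooth_manifold X A \<and>
     riemannian_metric_on A (topspace X) g \<and>
     almost_complex_on A (topspace X) J \<and>
     symplectic_form_on A (topspace X) \<Omega> \<and>
     (\<forall>c\<in>A. \<forall>x\<in>coords c (topspace X). \<forall>u v. \<Omega> c x u v = g c x (J c x u) v)"

definition strictly_almost_kaehler ::
  "'a topology \<Rightarrow> ('a, 'n::finite) chart set \<Rightarrow>
   ('a, 'n) bilin_field \<Rightarrow> ('a, 'n) endo_field \<Rightarrow> ('a, 'n) bilin_field \<Rightarrow> bool" where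
  "strictly_almost_kaehler X A g J \<Omega> \<longleftrightarrow>
     almost_kaehler X A g J \<Omega> \<and> \<not> integrable_acs_on A (topspace X) J"

definition kaehler_on ::
  "'a topology \<Rightarrow> ('a, 'n::finite) chart set \<Rightarrow> 'a set \<Rightarrow>
   ('a, 'n) bilin_field \<Rightarrow> ('a, 'n) endo_field \<Rightarrow> bool" where
  "kaehler_on X A S g J \<longleftrightarrow>
     openin X S \<and>
     riemannian_metric_on A S g \<and>
     almost_complex_on A S J \<and>
     (\<forall>c\<in>A. \<forall>x\<in>coords c S. \<forall>u v. g c x (J c x u) (J c x v) = g c x u v) \<and>
     integrable_acs_on A S J \<and>
     closed_form_on A S (fundamental_form g J)"

definition third_gray_condition ::
  "'a topology \<Rightarrow> ('a, 'n::finite) chart set \<Rightarrow>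
   ('a, 'n) bilin_field \<Rightarrow> ('a, 'n) endo_field \<Rightarrow> bool" where
  "third_gray_condition X A g J \<longleftrightarrow>
     (\<forall>c\<in>A. \<forall>x\<in>coords c (topspace X). \<forall>u v w z.
        riemann (g c) x u v w z = riemann (g c) x (J c x u) (J c x v) (J c x w) (J c x z))"


section \<open>Kaehler nullity and the opposite almost complex structure\<close>

definition non_kaehler_locus ::
  "('a, 'n::finite) chart set \<Rightarrow> ('a, 'n) bilin_field \<Rightarrow> ('a, 'n) endo_field \<Rightarrow> 'a set" where
  "non_kaehler_locus A g J =
     {p. \<exists>c\<in>A. p \<in> fst c \<and> (\<exists>v w. nabla_endo (g c) (J c) (snd c p) v w \<noteq> 0)}"

definition kaehler_nullity ::
  "'n::finite local_bilin \<Rightarrow> 'n local_endo \<Rightarrow> real ^ 'n \<Rightarrow> (real ^ 'n) set" where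
  "kaehler_nullity g J x = {v. \<forall>w. nabla_endo g J x v w = 0}"

definition g_complement :: "'n::finite local_bilin \<Rightarrow> real ^ 'n \<Rightarrow> (real ^ 'n) set \<Rightarrow> (real ^ 'n) set" where
  "g_complement g x D = {w. \<forall>v\<in>D. g x v w = 0}"

definition opposite :: "('a, 'n::finite) bilin_field \<Rightarrow> ('a, 'n) endo_field \<Rightarrow> ('a, 'n) endo_field" where
  "opposite g J c x = (THE B. linear B \<and>
     (\<forall>v. B (B v) = - v) \<and>
     (\<forall>u v. g c x (B u) (B v) = g c x u v) \<and>
     (\<forall>v \<in> kaehler_nullity (g c) (J c) x. B v = J c x v) \<and>
     (\<forall>v \<in> g_complement (g c) x (kaehler_nullity (g c) (J c) x). B v = - J c x v))"

end

theory Submission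
  imports Defs
begin

text \<open>
  Near a point with \<open>\<nabla>J \<noteq> 0\<close> choose an orthonormal frame with \<open>e2 = J e1\<close>, \<open>e4 = J e3\<close> and \<open>e3\<close>, \<open>e4\<close>
  spanning the Kaehler nullity. For the dual \<open>(1,0)\<close>-forms \<open>\<alpha>1 = e1 + \<i> e2\<close> and \<open>\<alpha>2 = e3 + \<i> e4\<close>, writing \<open>~\<close>
  for conjugation, the structure equations are
    \<open>d\<alpha>1 = \<i> A \<and> \<alpha>1 + \<mu> \<and> \<alpha>2 + c ~\<alpha>1 \<and> ~\<alpha>2\<close> and \<open>d\<alpha>2 = \<i> B \<and> \<alpha>2 - ~\<mu> \<and> \<alpha>1\<close>,
  where \<open>c ~\<alpha>1\<close> (with \<open>c \<noteq> 0\<close>) represents \<open>\<nabla>J\<close>, and \<open>\<mu>\<close> represents the covariant derivative of the opposite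
  structure. So \<open>(g, I)\<close> is Kaehler as soon as \<open>\<mu> = 0\<close>.

  The third Gray condition says that the curvature forms of \<open>A\<close>, \<open>B\<close>, \<open>\<mu>\<close> have type \<open>(1,1)\<close> and that of
  \<open>c ~\<alpha>1\<close> has no \<open>(1,1)\<close> part. The latter gives that \<open>\<mu>\<close> has type \<open>(1,0)\<close>. As \<open>J\<close> is nowhere integrable, a
  \<open>(1,0)\<close>-form whose differential has no \<open>(0,2)\<close> part is a multiple of \<open>\<alpha>2\<close>; hence \<open>\<mu> = m \<alpha>2\<close>, and
  \<open>dc / c - \<i> (2 A + B) = s ~\<alpha>2\<close>. If \<open>m \<noteq> 0\<close> somewhere, put \<open>\<gamma> = dm / m - \<i> (A - 2 B)\<close>. The identities
  \<open>d (d\<alpha>1) = d (d\<alpha>2) = d (dA) = 0\<close> then determine \<open>dA\<close> and show that \<open>\<gamma> + s ~\<alpha>2 - ~s \<alpha>2\<close> is a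
  multiple of \<open>~\<alpha>1\<close>. Its differential \<open>- 5 \<i> dA\<close> has type \<open>(1,1)\<close>, so it vanishes by the same
  principle, and \<open>dA = 0\<close>. But \<open>dA (e3, e4) = 2 |c|\<^sup>2\<close>, a contradiction.
\<close>

section \<open>Calculus of smooth functions\<close>

text \<open>The combinations of A and B are charges. Turning \<alpha>1 and \<alpha>2 by phases p and
  q changes A and B by dp and dq, and turns c by 2 p + q, \<mu> by p - q and m by p - 2 q. So dc / c
  - \<i> (2 A + B) and dm / m - \<i> (A - 2 B) do not depend on the phases, and as dc / c and dm / m
  are closed, their differentials involve only dA and dB. The two curvatures are not equally
  accessible: d (d\<alpha>1) = 0 and reality determine dA except on (e1, e2), whereas d (d\<alpha>2)
  = 0 only ties the mixed part of dB to \<gamma>. The final form is chosen so that B cancels: (A - 2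
  B) + 2 (2 A + B) = 5 A. The nullity is not known in advance to be a smooth plane field, so the
  frame is built from its complement: e1 is the normalised metric dual of one scalar component u ->
  g ((\<nabla>_u J) w, z) that is non-zero at the point. All components of \<nabla>J are
  combinations of two real 1-forms, and closedness of \<Omega> joins these into one (0,1)-form, so a
  single component already determines the nullity.\<close>

abbreviation dir_deriv ::
  "('e::real_normed_vector \<Rightarrow> 'f::real_normed_vector) \<Rightarrow> 'e \<Rightarrow> 'e \<Rightarrow> 'f" ("\<partial>")
  where "\<partial> f x \<equiv> frechet_derivative f (at x)"

lemma dir_deriv_eqI: "(f has_derivative f') (at x) \<Longrightarrow> \<partial> f x = f'"
  by (rule frechet_derivative_at[symmetric])

lemma has_derivative_dir_deriv: "f differentiable (at x) \<Longrightarrow> (f has_derivative \<partial> f x) (at x)"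
  by (simp add: frechet_derivative_works)

text \<open>No differentiability is involved: the two \<open>has_derivative\<close> predicates
  coincide, hence so do the choices that \<open>frechet_derivative\<close> makes from them.\<close>

lemma dir_deriv_cong:
  assumes "open S" "x \<in> S" "\<And>y. y \<in> S \<Longrightarrow> f y = g y"
  shows "\<partial> f x = \<partial> g x"
proof -
  have "(f has_derivative h) (at x) \<longleftrightarrow> (g has_derivative h) (at x)" for h
    using has_derivative_transform_within_open[of f h x UNIV S g]
      has_derivative_transform_within_open[of g h x UNIV S f] assms by auto
  then show ?thesis unfolding frechet_derivative_def by simp
qed

lemma differentiable_cong_open:
  assumes "open S" "x \<in> S" "\<And>y. y \<in> S \<Longrightarrow> f y = g y" "f differentiable (at x)"
  shows "g differentiable (at x)"
  using assms has_derivative_transform_within_open[of f _ x UNIV S g] unfolding differentiable_def by blast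

section \<open>Closure properties of C^k and smooth functions\<close>

lemma Ck_on_subset: "Ck_on k S f \<Longrightarrow> T \<subseteq> S \<Longrightarrow> Ck_on k T f"
  by (induction k arbitrary: f) (auto intro: continuous_on_subset)

lemma Ck_on_cong:
  assumes "open S" "\<And>x. x \<in> S \<Longrightarrow> f x = g x" "Ck_on k S f"
  shows "Ck_on k S g"
  using assms(2,3)
proof (induction k arbitrary: f g)
  case 0
  then show ?case using continuous_on_cong by (metis Ck_on.simps(1))
next
  case (Suc k)
  have "\<partial> f x = \<partial> g x" if "x \<in> S" for x
    using dir_deriv_cong[OF assms(1) that] Suc.prems(1) by blast
  then have "Ck_on k S (\<lambda>x. \<partial> g x v)" for v
    using Suc.IH[of "\<lambda>x. \<partial> f x v" "\<lambda>x. \<partial> g x v"] Suc.prems(2) by simp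
  moreover have "\<forall>x\<in>S. g differentiable (at x)"
    using differentiable_cong_open[OF assms(1) _ Suc.prems(1)] Suc.prems(2) by auto
  ultimately show ?case by simp
qed

lemma Ck_on_SucD: "Ck_on (Suc k) S f \<Longrightarrow> Ck_on k S f"
proof (induction k arbitrary: f)
  case 0
  then show ?case
    by (auto intro!: continuous_at_imp_continuous_on differentiable_imp_continuous_within)
next
  case (Suc k)
  then show ?case by (metis Ck_on.simps(2))
qed

lemma Ck_on_local:
  assumes "\<And>x. x \<in> S \<Longrightarrow> \<exists>T. open T \<and> x \<in> T \<and> Ck_on k T f"
  shows "Ck_on k S f"
  using assms
proof (induction k arbitrary: f)
  case 0
  have "continuous (at x) f" if "x \<in> S" for x
    using 0[OF that] by (auto simp: continuous_on_eq_continuous_at)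
  then show ?case by (simp add: continuous_at_imp_continuous_on)
next
  case (Suc k)
  have "Ck_on k S (\<lambda>x. \<partial> f x v)" for v
    by (rule Suc.IH) (use Suc.prems in fastforce)
  then show ?case using Suc.prems by auto
qed

lemma Ck_on_const: "Ck_on k S (\<lambda>_. c)"
  by (induction k arbitrary: c) auto

lemma Ck_on_bounded_linear:
  assumes "bounded_linear h" "open S" "Ck_on k S f"
  shows "Ck_on k S (\<lambda>x. h (f x))"
  using assms(3)
proof (induction k arbitrary: f)
  case 0
  then show ?case using bounded_linear.continuous_on[OF assms(1)] by auto
next
  case (Suc k)
  have hd: "((\<lambda>x. h (f x)) has_derivative (\<lambda>v. h (\<partial> f x v))) (at x)" if "x \<in> S" for x
    using Suc.prems that
    by (auto intro!: bounded_linear.has_derivative[OF assms(1)] has_derivative_dir_deriv)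
  have "Ck_on k S (\<lambda>x. h (\<partial> f x v))" for v using Suc by simp
  then have "Ck_on k S (\<lambda>x. \<partial> (\<lambda>x. h (f x)) x v)" for v
    by (rule Ck_on_cong[OF assms(2), rotated]) (simp add: dir_deriv_eqI[OF hd])
  then show ?case using hd by (auto simp: differentiable_def)
qed

lemma Ck_on_add:
  assumes "open S" "Ck_on k S f" "Ck_on k S g"
  shows "Ck_on k S (\<lambda>x. f x + g x)"
  using assms(2,3)
proof (induction k arbitrary: f g)
  case 0
  then show ?case by (auto intro: continuous_on_add)
next
  case (Suc k)
  have hd: "((\<lambda>x. f x + g x) has_derivative (\<lambda>v. \<partial> f x v + \<partial> g x v)) (at x)" if "x \<in> S" for x
    using Suc.prems that by (auto intro!: has_derivative_add has_derivative_dir_deriv)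
  have "Ck_on k S (\<lambda>x. \<partial> f x v + \<partial> g x v)" for v using Suc by simp
  then have "Ck_on k S (\<lambda>x. \<partial> (\<lambda>x. f x + g x) x v)" for v
    by (rule Ck_on_cong[OF assms(1), rotated]) (simp add: dir_deriv_eqI[OF hd])
  then show ?case using hd by (auto simp: differentiable_def)
qed

lemma Ck_on_bounded_bilinear:
  assumes h: "bounded_bilinear h" and S: "open S" and "Ck_on k S f" "Ck_on k S g"
  shows "Ck_on k S (\<lambda>x. h (f x) (g x))"
  using assms(3,4)
proof (induction k arbitrary: f g)
  case 0
  then show ?case using bounded_bilinear.continuous_on[OF h] by auto
next
  case (Suc k)
  have hd: "((\<lambda>x. h (f x) (g x)) has_derivative (\<lambda>v. h (f x) (\<partial> g x v) + h (\<partial> f x v) (g x))) (at x)"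
    if "x \<in> S" for x
    using Suc.prems that by (auto intro!: bounded_bilinear.FDERIV[OF h] has_derivative_dir_deriv)
  have "Ck_on k S (\<lambda>x. h (f x) (\<partial> g x v) + h (\<partial> f x v) (g x))" for v
    using Suc.prems Suc.prems[THEN Ck_on_SucD] by (intro Ck_on_add S Suc.IH) auto
  then have "Ck_on k S (\<lambda>x. \<partial> (\<lambda>x. h (f x) (g x)) x v)" for v
    by (rule Ck_on_cong[OF S, rotated]) (simp add: dir_deriv_eqI[OF hd])
  then show ?case using hd by (auto simp: differentiable_def)
qed

text \<open>The exponent varies in the induction because differentiating lowers it by one. Exponent
  -1 serves for reciprocals, -1/2 for normalising vector fields.\<close>

lemma Ck_on_powr:
  fixes f :: "'e::euclidean_space \<Rightarrow> real"
  assumes S: "open S" and pos: "\<And>x. x \<in> S \<Longrightarrow> f x > 0" and "Ck_on k S f"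
  shows "Ck_on k S (\<lambda>x. f x powr p)"
  using assms(3)
proof (induction k arbitrary: p)
  case 0
  then show ?case using pos by (force intro!: continuous_on_powr continuous_on_const)
next
  case (Suc k)
  have hd: "((\<lambda>x. f x powr p) has_derivative (\<lambda>v. p * f x powr (p - 1) * \<partial> f x v)) (at x)"
    if "x \<in> S" for x
  proof -
    have "((\<lambda>x. f x powr p) has_derivative
        (\<lambda>v. f x powr p * (0 * ln (f x) + \<partial> f x v * p / f x))) (at x)"
      using Suc.prems that pos by (intro has_derivative_powr has_derivative_dir_deriv) auto
    moreover have "f x powr p = f x powr (p - 1) * f x"
      using pos[OF that] by (simp add: powr_mult_base powr_diff)
    ultimately show ?thesis using pos[OF that] by (simp add: mult_ac)
  qed
  have "Ck_on k S (\<lambda>x. f x powr (p - 1))"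
    using Suc.IH Ck_on_SucD Suc.prems by blast
  then have "Ck_on k S (\<lambda>x. p * f x powr (p - 1) * \<partial> f x v)" for v
    using Suc.prems
    by (intro Ck_on_bounded_bilinear[OF bounded_bilinear_mult S] Ck_on_const) auto
  then have "Ck_on k S (\<lambda>x. \<partial> (\<lambda>x. f x powr p) x v)" for v
    by (rule Ck_on_cong[OF S, rotated, where f = "\<lambda>x. p * f x powr (p - 1) * \<partial> f x v"])
      (simp add: dir_deriv_eqI[OF hd])
  then show ?case using hd by (auto simp: differentiable_def)
qed

lemma smooth_on_differentiable: "smooth_on S f \<Longrightarrow> x \<in> S \<Longrightarrow> f differentiable (at x)"
  unfolding smooth_on_def by (metis Ck_on.simps(2))

lemma smooth_on_has_derivative: "smooth_on S f \<Longrightarrow> x \<in> S \<Longrightarrow> (f has_derivative \<partial> f x) (at x)"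
  by (simp add: has_derivative_dir_deriv smooth_on_differentiable)

lemma smooth_on_continuous: "smooth_on S f \<Longrightarrow> continuous_on S f"
  unfolding smooth_on_def by (metis Ck_on.simps(1))

lemma smooth_on_dir_deriv: "smooth_on S f \<Longrightarrow> smooth_on S (\<lambda>x. \<partial> f x v)"
  unfolding smooth_on_def by (metis Ck_on.simps(2))

lemma smooth_on_subset: "smooth_on S f \<Longrightarrow> T \<subseteq> S \<Longrightarrow> smooth_on T f"
  unfolding smooth_on_def using Ck_on_subset by blast

lemma smooth_on_cong: "open S \<Longrightarrow> (\<And>x. x \<in> S \<Longrightarrow> f x = g x) \<Longrightarrow> smooth_on S f \<Longrightarrow> smooth_on S g"
  unfolding smooth_on_def using Ck_on_cong by blast

lemma smooth_on_local:
  assumes "\<And>x. x \<in> S \<Longrightarrow> \<exists>T. open T \<and> x \<in> T \<and> smooth_on T f"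
  shows "smooth_on S f"
  using assms Ck_on_local unfolding smooth_on_def by meson

lemma smooth_on_const: "smooth_on S (\<lambda>_. c)"
  by (simp add: smooth_on_def Ck_on_const)

lemma smooth_on_bounded_linear:
  "bounded_linear h \<Longrightarrow> open S \<Longrightarrow> smooth_on S f \<Longrightarrow> smooth_on S (\<lambda>x. h (f x))"
  by (simp add: smooth_on_def Ck_on_bounded_linear)

lemma smooth_on_add: "open S \<Longrightarrow> smooth_on S f \<Longrightarrow> smooth_on S g \<Longrightarrow> smooth_on S (\<lambda>x. f x + g x)"
  by (simp add: smooth_on_def Ck_on_add)

lemma smooth_on_minus: "open S \<Longrightarrow> smooth_on S f \<Longrightarrow> smooth_on S (\<lambda>x. - f x)"
  using smooth_on_bounded_linear[of uminus] bounded_linear_minus[OF bounded_linear_ident] by auto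

lemma smooth_on_diff: "open S \<Longrightarrow> smooth_on S f \<Longrightarrow> smooth_on S g \<Longrightarrow> smooth_on S (\<lambda>x. f x - g x)"
  using smooth_on_add[of S f "\<lambda>x. - g x"] smooth_on_minus by auto

lemma smooth_on_bounded_bilinear:
  "bounded_bilinear h \<Longrightarrow> open S \<Longrightarrow> smooth_on S f \<Longrightarrow> smooth_on S g \<Longrightarrow> smooth_on S (\<lambda>x. h (f x) (g x))"
  by (simp add: smooth_on_def Ck_on_bounded_bilinear)

lemmas smooth_on_mult = smooth_on_bounded_bilinear[OF bounded_bilinear_mult]
lemmas smooth_on_scaleR = smooth_on_bounded_bilinear[OF bounded_bilinear_scaleR]

lemma smooth_on_powr:
  fixes f :: "'e::euclidean_space \<Rightarrow> real"
  shows "open S \<Longrightarrow> (\<And>x. x \<in> S \<Longrightarrow> f x > 0) \<Longrightarrow> smooth_on S f \<Longrightarrow> smooth_on S (\<lambda>x. f x powr p)"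
  by (simp add: smooth_on_def Ck_on_powr)

lemma smooth_on_sum:
  assumes "open S" "\<And>i. i \<in> I \<Longrightarrow> smooth_on S (f i)"
  shows "smooth_on S (\<lambda>x. \<Sum>i\<in>I. f i x)"
  using assms(2) by (induction I rule: infinite_finite_induct) (auto intro: smooth_on_const smooth_on_add assms(1))

lemma smooth_on_prod:
  fixes f :: "'i \<Rightarrow> 'e::euclidean_space \<Rightarrow> real"
  assumes "open S" "\<And>i. i \<in> I \<Longrightarrow> smooth_on S (f i)"
  shows "smooth_on S (\<lambda>x. \<Prod>i\<in>I. f i x)"
  using assms(2) by (induction I rule: infinite_finite_induct) (auto intro: smooth_on_const smooth_on_mult assms(1))

lemma smooth_on_inverse:
  fixes f :: "'e::euclidean_space \<Rightarrow> real"
  assumes S: "open S" and nz: "\<And>x. x \<in> S \<Longrightarrow> f x \<noteq> 0" and f: "smooth_on S f"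
  shows "smooth_on S (\<lambda>x. inverse (f x))"
proof (rule smooth_on_cong[OF S])
  \<comment> \<open>\<open>f\<close> may be negative while \<open>powr\<close> wants a positive
    base, so the reciprocal is taken of the square.\<close>
  show "smooth_on S (\<lambda>x. f x * (f x * f x) powr (-1))"
    by (intro smooth_on_mult smooth_on_powr S f) (use nz not_real_square_gt_zero in blast)
  show "f x * (f x * f x) powr (-1) = inverse (f x)" if "x \<in> S" for x
    using nz[OF that] by (simp add: powr_minus)
qed

lemma smooth_on_of_real: "open S \<Longrightarrow> smooth_on S f \<Longrightarrow> smooth_on S (\<lambda>x. of_real (f x) :: complex)"
  by (rule smooth_on_bounded_linear[OF bounded_linear_of_real])
lemma smooth_on_cnj: "open S \<Longrightarrow> smooth_on S f \<Longrightarrow> smooth_on S (\<lambda>x. cnj (f x))"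
  by (rule smooth_on_bounded_linear[OF bounded_linear_cnj])
lemma smooth_on_Re: "open S \<Longrightarrow> smooth_on S f \<Longrightarrow> smooth_on S (\<lambda>x. Re (f x))"
  by (rule smooth_on_bounded_linear[OF bounded_linear_Re])
lemma smooth_on_Im: "open S \<Longrightarrow> smooth_on S f \<Longrightarrow> smooth_on S (\<lambda>x. Im (f x))"
  by (rule smooth_on_bounded_linear[OF bounded_linear_Im])

lemma smooth_on_inverse_complex:
  fixes f :: "'e::euclidean_space \<Rightarrow> complex"
  assumes S: "open S" and nz: "\<And>x. x \<in> S \<Longrightarrow> f x \<noteq> 0" and f: "smooth_on S f"
  shows "smooth_on S (\<lambda>x. inverse (f x))"
proof (rule smooth_on_cong[OF S])
  show "smooth_on S (\<lambda>x. cnj (f x) * of_real (inverse (Re (f x) * Re (f x) + Im (f x) * Im (f x))))"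
    by (intro smooth_on_mult smooth_on_cnj smooth_on_of_real smooth_on_inverse smooth_on_add
        smooth_on_Re smooth_on_Im S f)
      (use nz in \<open>simp add: complex_eq_iff sum_squares_eq_zero_iff\<close>)
  show "cnj (f x) * of_real (inverse (Re (f x) * Re (f x) + Im (f x) * Im (f x))) = inverse (f x)"
    if "x \<in> S" for x
  proof -
    have "Re (f x) * Re (f x) + Im (f x) * Im (f x) \<noteq> 0"
      using nz[OF that] by (simp add: complex_eq_iff sum_squares_eq_zero_iff)
    then show ?thesis by (simp add: complex_eq_iff power2_eq_square divide_inverse)
  qed
qed

section \<open>Rules for directional derivatives and symmetry of second derivatives\<close>

lemma dir_deriv_add:
  assumes "f differentiable (at x)" "g differentiable (at x)"
  shows "\<partial> (\<lambda>y. f y + g y) x v = \<partial> f x v + \<partial> g x v"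
  by (simp add: dir_deriv_eqI[OF has_derivative_add[OF assms[THEN has_derivative_dir_deriv]]])

lemma dir_deriv_diff:
  assumes "f differentiable (at x)" "g differentiable (at x)"
  shows "\<partial> (\<lambda>y. f y - g y) x v = \<partial> f x v - \<partial> g x v"
  by (simp add: dir_deriv_eqI[OF has_derivative_diff[OF assms[THEN has_derivative_dir_deriv]]])

lemma dir_deriv_bounded_bilinear:
  assumes "bounded_bilinear h" "f differentiable (at x)" "g differentiable (at x)"
  shows "\<partial> (\<lambda>y. h (f y) (g y)) x v = h (f x) (\<partial> g x v) + h (\<partial> f x v) (g x)"
  by (simp add: dir_deriv_eqI[OF bounded_bilinear.FDERIV[OF assms(1) assms(2,3)[THEN has_derivative_dir_deriv]]])

lemmas dir_deriv_mult = dir_deriv_bounded_bilinear[OF bounded_bilinear_mult]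

lemma dir_deriv_bounded_linear:
  assumes "bounded_linear h" "f differentiable (at x)"
  shows "\<partial> (\<lambda>y. h (f y)) x v = h (\<partial> f x v)"
  by (simp add: dir_deriv_eqI[OF bounded_linear.has_derivative[OF assms(1) assms(2)[THEN has_derivative_dir_deriv]]])

lemmas dir_deriv_cnj = dir_deriv_bounded_linear[OF bounded_linear_cnj]
lemmas dir_deriv_of_real = dir_deriv_bounded_linear[OF bounded_linear_of_real]

lemma linear_dir_deriv: "f differentiable (at x) \<Longrightarrow> linear (\<partial> f x)"
  by (rule linear_frechet_derivative)

lemma dir_deriv_chain:
  assumes "f differentiable (at x)" "g differentiable (at (f x))"
  shows "\<partial> (\<lambda>y. g (f y)) x v = \<partial> g (f x) (\<partial> f x v)"
  using dir_deriv_eqI[OF has_derivative_compose[OF assms[THEN has_derivative_dir_deriv]]] by simp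

text \<open>Both mixed derivatives are limits of the second difference quotient.\<close>

lemma second_difference:
  fixes f :: "'e::euclidean_space \<Rightarrow> real"
  assumes f: "smooth_on (ball x r) f" and t: "0 < t" "t * (norm u + norm v) < r"
  shows "\<exists>y. norm (y - x) \<le> t * (norm u + norm v) \<and>
    f (x + t *\<^sub>R u + t *\<^sub>R v) - f (x + t *\<^sub>R u) - f (x + t *\<^sub>R v) + f x = t * t * \<partial> (\<lambda>y. \<partial> f y u) y v"
proof -
  have nrm: "norm (a *\<^sub>R u + b *\<^sub>R v) \<le> t * (norm u + norm v)" if "0 \<le> a" "a \<le> t" "0 \<le> b" "b \<le> t" for a b
  proof -
    have "norm (a *\<^sub>R u + b *\<^sub>R v) \<le> a * norm u + b * norm v"
      using norm_triangle_ineq[of "a *\<^sub>R u" "b *\<^sub>R v"] that by simp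
    also have "\<dots> \<le> t * norm u + t * norm v" using that by (intro add_mono mult_right_mono) auto
    finally show ?thesis by (simp add: distrib_left)
  qed
  have inb: "x + a *\<^sub>R u + b *\<^sub>R v \<in> ball x r" if "0 \<le> a" "a \<le> t" "0 \<le> b" "b \<le> t" for a b
  proof -
    have "dist x (x + a *\<^sub>R u + b *\<^sub>R v) = norm (a *\<^sub>R u + b *\<^sub>R v)"
      by (metis add.assoc add_diff_cancel_left' dist_commute dist_norm)
    then show ?thesis using nrm[OF that] t by simp
  qed
  \<comment> \<open>The mean value theorem is applied to the increment along \<open>v\<close> as a
    function of the position along \<open>u\<close>, and then once more along
    \<open>v\<close>.\<close>
  define p where "p s = f (x + s *\<^sub>R u + t *\<^sub>R v) - f (x + s *\<^sub>R u + 0 *\<^sub>R v)" for s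
  have line: "((\<lambda>s. h (w + s *\<^sub>R d)) has_real_derivative \<partial> h (w + s *\<^sub>R d) d) (at s)"
    if "smooth_on (ball x r) h" "w + s *\<^sub>R d \<in> ball x r" for h :: "'e \<Rightarrow> real" and w d s
  proof -
    have "((\<lambda>s. w + s *\<^sub>R d) has_derivative (\<lambda>z. z *\<^sub>R d)) (at s)"
      by (auto intro!: derivative_eq_intros)
    from has_derivative_compose[OF this smooth_on_has_derivative[OF that]]
    have "((\<lambda>s. h (w + s *\<^sub>R d)) has_derivative (\<lambda>z. \<partial> h (w + s *\<^sub>R d) (z *\<^sub>R d))) (at s)" .
    moreover have "\<partial> h (w + s *\<^sub>R d) (z *\<^sub>R d) = \<partial> h (w + s *\<^sub>R d) d * z" for z
      using linear_dir_deriv[OF smooth_on_differentiable[OF that]] by (simp add: linear_scale)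
    ultimately show ?thesis by (simp add: has_field_derivative_def)
  qed
  have "\<exists>s. 0 < s \<and> s < t \<and> p t - p 0 = (t - 0) * (\<partial> f (x + s *\<^sub>R u + t *\<^sub>R v) u - \<partial> f (x + s *\<^sub>R u + 0 *\<^sub>R v) u)"
  proof (rule MVT2[OF t(1)])
    fix s assume s: "0 \<le> s" "s \<le> t"
    have "((\<lambda>s. f ((x + t *\<^sub>R v) + s *\<^sub>R u) - f ((x + 0 *\<^sub>R v) + s *\<^sub>R u)) has_real_derivative
        \<partial> f ((x + t *\<^sub>R v) + s *\<^sub>R u) u - \<partial> f ((x + 0 *\<^sub>R v) + s *\<^sub>R u) u) (at s)"
      using inb[OF s, of t] inb[OF s, of 0] t
      by (intro DERIV_diff line[OF f]) (simp_all add: add.assoc add.commute add.left_commute)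
    then show "(p has_real_derivative \<partial> f (x + s *\<^sub>R u + t *\<^sub>R v) u - \<partial> f (x + s *\<^sub>R u + 0 *\<^sub>R v) u) (at s)"
      unfolding p_def by (simp add: add.assoc add.commute add.left_commute)
  qed
  then obtain s where s: "0 < s" "s < t"
    "p t - p 0 = t * (\<partial> f (x + s *\<^sub>R u + t *\<^sub>R v) u - \<partial> f (x + s *\<^sub>R u + 0 *\<^sub>R v) u)" by auto
  have "\<exists>z. 0 < z \<and> z < t \<and> \<partial> f (x + s *\<^sub>R u + t *\<^sub>R v) u - \<partial> f (x + s *\<^sub>R u + 0 *\<^sub>R v) u
      = (t - 0) * \<partial> (\<lambda>y. \<partial> f y u) (x + s *\<^sub>R u + z *\<^sub>R v) v"
    using s t inb[of s] by (intro MVT2 line smooth_on_dir_deriv[OF f]) auto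
  then obtain z where z: "0 < z" "z < t"
    "\<partial> f (x + s *\<^sub>R u + t *\<^sub>R v) u - \<partial> f (x + s *\<^sub>R u + 0 *\<^sub>R v) u
      = t * \<partial> (\<lambda>y. \<partial> f y u) (x + s *\<^sub>R u + z *\<^sub>R v) v" by auto
  show ?thesis
  proof (intro exI[of _ "x + s *\<^sub>R u + z *\<^sub>R v"] conjI)
    show "norm (x + s *\<^sub>R u + z *\<^sub>R v - x) \<le> t * (norm u + norm v)"
      using nrm[of s z] s z by (simp add: algebra_simps)
    show "f (x + t *\<^sub>R u + t *\<^sub>R v) - f (x + t *\<^sub>R u) - f (x + t *\<^sub>R v) + f x
        = t * t * \<partial> (\<lambda>y. \<partial> f y u) (x + s *\<^sub>R u + z *\<^sub>R v) v"
      using s(3) z(3) by (simp add: p_def)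
  qed
qed

lemma dir_deriv_commute_real:
  fixes f :: "'e::euclidean_space \<Rightarrow> real"
  assumes S: "open S" "x \<in> S" and f: "smooth_on S f"
  shows "\<partial> (\<lambda>y. \<partial> f y u) x v = \<partial> (\<lambda>y. \<partial> f y v) x u"
proof (rule ccontr)
  let ?a = "\<lambda>y. \<partial> (\<lambda>y. \<partial> f y u) y v" and ?b = "\<lambda>y. \<partial> (\<lambda>y. \<partial> f y v) y u"
  assume ne: "?a x \<noteq> ?b x"
  \<comment> \<open>Half the gap. Near \<open>x\<close> both mixed derivatives stay within
    \<open>e\<close> of their values at \<open>x\<close>, yet the second difference quotient makes
    them agree at two nearby points.\<close>
  define e where "e = \<bar>?a x - ?b x\<bar> / 2"
  have e: "e > 0" using ne by (simp add: e_def)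
  have "continuous_on S ?a" "continuous_on S ?b"
    using f by (auto intro!: smooth_on_continuous smooth_on_dir_deriv)
  then have c: "continuous (at x) ?a" "continuous (at x) ?b"
    using S by (auto simp: continuous_on_eq_continuous_at)
  obtain d1 where d1: "d1 > 0" "\<And>y. dist y x < d1 \<Longrightarrow> dist (?a y) (?a x) < e"
    using c(1)[unfolded continuous_at_eps_delta, rule_format, OF e] by auto
  obtain d2 where d2: "d2 > 0" "\<And>y. dist y x < d2 \<Longrightarrow> dist (?b y) (?b x) < e"
    using c(2)[unfolded continuous_at_eps_delta, rule_format, OF e] by auto
  note d = d1 d2
  obtain r where r: "r > 0" "ball x r \<subseteq> S" using S openE by blast
  define m where "m = min r (min d1 d2)"
  define t where "t = m / (2 * (norm u + norm v + 1))"
  have m: "m > 0" using d r by (simp add: m_def)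
  have t: "t > 0" using m by (simp add: t_def add_nonneg_pos)
  have "t * (norm u + norm v) < 2 * t * (norm u + norm v + 1)"
  proof -
    have "0 \<le> t * (norm u + norm v)" using t by simp
    then show ?thesis using t unfolding distrib_left by linarith
  qed
  also have "\<dots> = m"
  proof -
    have "norm u + norm v + 1 > 0" by (simp add: add_nonneg_pos)
    then show ?thesis unfolding t_def by (simp add: divide_simps)
  qed
  finally have tm: "t * (norm u + norm v) < m" .
  have fb: "smooth_on (ball x r) f" using f r smooth_on_subset by blast
  obtain y where y: "norm (y - x) \<le> t * (norm u + norm v)"
    "f (x + t *\<^sub>R u + t *\<^sub>R v) - f (x + t *\<^sub>R u) - f (x + t *\<^sub>R v) + f x = t * t * ?a y"
    using second_difference[OF fb t, of u v] tm by (auto simp: m_def)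
  obtain z where z: "norm (z - x) \<le> t * (norm v + norm u)"
    "f (x + t *\<^sub>R v + t *\<^sub>R u) - f (x + t *\<^sub>R v) - f (x + t *\<^sub>R u) + f x = t * t * ?b z"
    using second_difference[OF fb t, of v u] tm by (auto simp: m_def add.commute)
  have "t * t * ?a y = t * t * ?b z" using y z by (simp add: algebra_simps)
  then have "?a y = ?b z" using t by simp
  moreover have "dist (?a y) (?a x) < e" "dist (?b z) (?b x) < e"
    using d(2)[of y] d(4)[of z] y z tm by (auto simp: m_def dist_norm add.commute)
  moreover have "\<not> (\<bar>p - a\<bar> < \<bar>a - b\<bar> / 2 \<and> \<bar>p - b\<bar> < \<bar>a - b\<bar> / 2)" for p a b :: real
  proof -
    have "\<bar>a - b\<bar> \<le> \<bar>p - b\<bar> + \<bar>p - a\<bar>" using abs_triangle_ineq4[of "p - b" "p - a"] by simp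
    then show ?thesis by argo
  qed
  ultimately show False unfolding e_def dist_real_def by metis
qed

lemma dir_deriv_commute:
  fixes f :: "'e::euclidean_space \<Rightarrow> 'f::euclidean_space"
  assumes S: "open S" "x \<in> S" and f: "smooth_on S f"
  shows "\<partial> (\<lambda>y. \<partial> f y u) x v = \<partial> (\<lambda>y. \<partial> f y v) x u"
proof (rule euclidean_eqI)
  fix b :: 'f
  have bl: "bounded_linear (\<lambda>z. z \<bullet> b)" by (rule bounded_linear_inner_left)
  have *: "\<partial> (\<lambda>y. \<partial> (\<lambda>y. f y \<bullet> b) y u) x v = \<partial> (\<lambda>y. \<partial> f y u) x v \<bullet> b" for u v
  proof -
    have "\<partial> (\<lambda>y. \<partial> (\<lambda>y. f y \<bullet> b) y u) x = \<partial> (\<lambda>y. \<partial> f y u \<bullet> b) x"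
      using f by (intro dir_deriv_cong[OF S] dir_deriv_bounded_linear[OF bl] smooth_on_differentiable)
    moreover have "(\<lambda>y. \<partial> f y u) differentiable (at x)"
      using f S by (intro smooth_on_differentiable smooth_on_dir_deriv)
    ultimately show ?thesis by (simp add: dir_deriv_bounded_linear[OF bl])
  qed
  show "\<partial> (\<lambda>y. \<partial> f y u) x v \<bullet> b = \<partial> (\<lambda>y. \<partial> f y v) x u \<bullet> b"
    using dir_deriv_commute_real[OF S smooth_on_bounded_linear[OF bl S(1) f], of u v] by (simp add: *)
qed

section \<open>Complex differential forms\<close>

definition form1 :: "'e::euclidean_space set \<Rightarrow> ('e \<Rightarrow> 'e \<Rightarrow> complex) \<Rightarrow> bool" where
  "form1 S w \<longleftrightarrow> (\<forall>x\<in>S. linear (w x)) \<and> (\<forall>v. smooth_on S (\<lambda>x. w x v))"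

definition d1 :: "('e::euclidean_space \<Rightarrow> 'e \<Rightarrow> complex) \<Rightarrow> 'e \<Rightarrow> 'e \<Rightarrow> 'e \<Rightarrow> complex" where
  "d1 w x u v = \<partial> (\<lambda>y. w y v) x u - \<partial> (\<lambda>y. w y u) x v"

definition d2 :: "('e::euclidean_space \<Rightarrow> 'e \<Rightarrow> 'e \<Rightarrow> complex) \<Rightarrow> 'e \<Rightarrow> 'e \<Rightarrow> 'e \<Rightarrow> 'e \<Rightarrow> complex" where
  "d2 t x u v w = \<partial> (\<lambda>y. t y v w) x u + \<partial> (\<lambda>y. t y w u) x v + \<partial> (\<lambda>y. t y u v) x w"

definition wedge :: "('e \<Rightarrow> complex) \<Rightarrow> ('e \<Rightarrow> complex) \<Rightarrow> 'e \<Rightarrow> 'e \<Rightarrow> complex" where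
  "wedge a b u v = a u * b v - a v * b u"

definition wedge21 :: "('e \<Rightarrow> 'e \<Rightarrow> complex) \<Rightarrow> ('e \<Rightarrow> complex) \<Rightarrow> 'e \<Rightarrow> 'e \<Rightarrow> 'e \<Rightarrow> complex" where
  "wedge21 t b u v w = t u v * b w + t v w * b u + t w u * b v"

lemma form1_linear: "form1 S w \<Longrightarrow> x \<in> S \<Longrightarrow> linear (w x)"
  and form1_smooth: "form1 S w \<Longrightarrow> smooth_on S (\<lambda>x. w x v)"
  by (simp_all add: form1_def)

lemma form1_differentiable: "form1 S w \<Longrightarrow> x \<in> S \<Longrightarrow> (\<lambda>y. w y v) differentiable (at x)"
  by (rule smooth_on_differentiable[OF form1_smooth])

lemma form1_subset: "form1 S w \<Longrightarrow> T \<subseteq> S \<Longrightarrow> form1 T w"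
  unfolding form1_def using smooth_on_subset by blast

lemma form1_scale: "open S \<Longrightarrow> smooth_on S f \<Longrightarrow> form1 S w \<Longrightarrow> form1 S (\<lambda>x u. f x * w x u)"
  unfolding form1_def
  by (auto intro!: smooth_on_mult linearI simp: linear_add linear_scale algebra_simps)

lemma form1_add: "open S \<Longrightarrow> form1 S v \<Longrightarrow> form1 S w \<Longrightarrow> form1 S (\<lambda>x u. v x u + w x u)"
  unfolding form1_def by (auto intro!: smooth_on_add linear_compose_add)

lemma form1_diff: "open S \<Longrightarrow> form1 S v \<Longrightarrow> form1 S w \<Longrightarrow> form1 S (\<lambda>x u. v x u - w x u)"
  unfolding form1_def by (auto intro!: smooth_on_diff linear_compose_sub)

lemma form1_cnj: "open S \<Longrightarrow> form1 S w \<Longrightarrow> form1 S (\<lambda>x u. cnj (w x u))"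
  unfolding form1_def by (auto intro!: smooth_on_cnj linearI simp: linear_add linear_scale scaleR_conv_of_real)

lemma form1_cmult: "open S \<Longrightarrow> form1 S w \<Longrightarrow> form1 S (\<lambda>x u. k * w x u)"
  by (rule form1_scale[OF _ smooth_on_const])

lemma form1_dir_deriv: "open S \<Longrightarrow> smooth_on S f \<Longrightarrow> form1 S (\<partial> f)"
  unfolding form1_def by (auto intro: linear_dir_deriv smooth_on_differentiable smooth_on_dir_deriv)

lemma linear_basis_expansion:
  assumes "linear (l :: 'e::euclidean_space \<Rightarrow> 'f::real_vector)"
  shows "l u = (\<Sum>b\<in>Basis. (u \<bullet> b) *\<^sub>R l b)"
proof -
  have "l u = l (\<Sum>b\<in>Basis. (u \<bullet> b) *\<^sub>R b)" by (simp add: euclidean_representation)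
  also have "\<dots> = (\<Sum>b\<in>Basis. (u \<bullet> b) *\<^sub>R l b)" by (simp add: linear_sum[OF assms] linear_scale[OF assms])
  finally show ?thesis .
qed

lemma smooth_on_linear_apply:
  fixes F :: "'e::euclidean_space \<Rightarrow> 'h::euclidean_space \<Rightarrow> 'f::real_normed_vector"
  assumes S: "open S" and "\<And>x. x \<in> S \<Longrightarrow> linear (F x)" "\<And>v. smooth_on S (\<lambda>x. F x v)" "smooth_on S X"
  shows "smooth_on S (\<lambda>x. F x (X x))"
proof (rule smooth_on_cong[OF S])
  show "smooth_on S (\<lambda>x. \<Sum>b\<in>Basis. (X x \<bullet> b) *\<^sub>R F x b)"
    by (intro smooth_on_sum S smooth_on_scaleR smooth_on_bounded_linear[OF bounded_linear_inner_left] assms)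
  show "(\<Sum>b\<in>Basis. (X x \<bullet> b) *\<^sub>R F x b) = F x (X x)" if "x \<in> S" for x
    using linear_basis_expansion[OF assms(2)[OF that], of "X x"] by simp
qed

text \<open>This is the product rule for a field of linear maps applied to a vector field.
  \<open>F\<close> is differentiable only on fixed vectors, so \<open>X\<close> is expanded in a
  basis, which leaves finitely many scalar products.\<close>

lemma dir_deriv_linear_apply:
  fixes F :: "'e::euclidean_space \<Rightarrow> 'h::euclidean_space \<Rightarrow> 'f::real_normed_vector"
  assumes S: "open S" "x \<in> S" and F: "\<And>x. x \<in> S \<Longrightarrow> linear (F x)"
    "\<And>v. (\<lambda>x. F x v) differentiable (at x)" and X: "X differentiable (at x)"
  shows "(\<lambda>y. F y (X y)) differentiable (at x)"
    and "\<partial> (\<lambda>y. F y (X y)) x u = \<partial> (\<lambda>y. F y (X x)) x u + F x (\<partial> X x u)"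
proof -
  have "((\<lambda>y. \<Sum>b\<in>Basis. (X y \<bullet> b) *\<^sub>R F y b) has_derivative
      (\<lambda>u. \<Sum>b\<in>Basis. (X x \<bullet> b) *\<^sub>R \<partial> (\<lambda>y. F y b) x u + (\<partial> X x u \<bullet> b) *\<^sub>R F x b)) (at x)"
    using F X by (intro has_derivative_sum has_derivative_scaleR has_derivative_inner_left has_derivative_dir_deriv)
  then have hd: "((\<lambda>y. F y (X y)) has_derivative
      (\<lambda>u. \<Sum>b\<in>Basis. (X x \<bullet> b) *\<^sub>R \<partial> (\<lambda>y. F y b) x u + (\<partial> X x u \<bullet> b) *\<^sub>R F x b)) (at x)"
    by (rule has_derivative_transform_within_open[OF _ S]) (simp add: linear_basis_expansion[OF F(1), symmetric])
  then show "(\<lambda>y. F y (X y)) differentiable (at x)" by (auto simp: differentiable_def)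
  have "((\<lambda>y. \<Sum>b\<in>Basis. (X x \<bullet> b) *\<^sub>R F y b) has_derivative
      (\<lambda>u. \<Sum>b\<in>Basis. (X x \<bullet> b) *\<^sub>R \<partial> (\<lambda>y. F y b) x u)) (at x)"
    using F by (intro has_derivative_sum has_derivative_scaleR_right has_derivative_dir_deriv)
  then have "((\<lambda>y. F y (X x)) has_derivative (\<lambda>u. \<Sum>b\<in>Basis. (X x \<bullet> b) *\<^sub>R \<partial> (\<lambda>y. F y b) x u)) (at x)"
    by (rule has_derivative_transform_within_open[OF _ S]) (simp add: linear_basis_expansion[OF F(1), symmetric])
  then show "\<partial> (\<lambda>y. F y (X y)) x u = \<partial> (\<lambda>y. F y (X x)) x u + F x (\<partial> X x u)"
    unfolding dir_deriv_eqI[OF hd] using linear_basis_expansion[OF F(1)[OF S(2)], of "\<partial> X x u"]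
    by (simp add: dir_deriv_eqI sum.distrib)
qed

lemma form1_apply: "open S \<Longrightarrow> form1 S w \<Longrightarrow> smooth_on S X \<Longrightarrow> smooth_on S (\<lambda>x. w x (X x))"
  by (rule smooth_on_linear_apply) (auto simp: form1_def)

lemma d1_cong: "open S \<Longrightarrow> x \<in> S \<Longrightarrow> (\<And>y u. y \<in> S \<Longrightarrow> v y u = w y u) \<Longrightarrow> d1 v x = d1 w x"
  unfolding d1_def using dir_deriv_cong[of S x "\<lambda>y. v y u" "\<lambda>y. w y u" for u] by presburger

lemma d2_cong: "open S \<Longrightarrow> x \<in> S \<Longrightarrow> (\<And>y u v. y \<in> S \<Longrightarrow> s y u v = t y u v) \<Longrightarrow> d2 s x = d2 t x"
  unfolding d2_def using dir_deriv_cong[of S x "\<lambda>y. s y u v" "\<lambda>y. t y u v" for u v] by presburger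

context
  fixes S :: "'e::euclidean_space set" and x :: 'e
  assumes S: "open S" "x \<in> S"
begin

lemma d1_scale:
  assumes "smooth_on S f" "form1 S w"
  shows "d1 (\<lambda>y u. f y * w y u) x u v = wedge (\<partial> f x) (w x) u v + f x * d1 w x u v"
  using S assms
  by (simp add: d1_def wedge_def dir_deriv_mult smooth_on_differentiable form1_differentiable algebra_simps)

lemma d1_add: "form1 S v \<Longrightarrow> form1 S w \<Longrightarrow> d1 (\<lambda>y u. v y u + w y u) x a b = d1 v x a b + d1 w x a b"
  using S by (simp add: d1_def dir_deriv_add form1_differentiable)

lemma d1_diff: "form1 S v \<Longrightarrow> form1 S w \<Longrightarrow> d1 (\<lambda>y u. v y u - w y u) x a b = d1 v x a b - d1 w x a b"
  using S by (simp add: d1_def dir_deriv_diff form1_differentiable)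

lemma d1_cmult: "form1 S w \<Longrightarrow> d1 (\<lambda>y u. k * w y u) x a b = k * d1 w x a b"
  using d1_scale[of "\<lambda>_. k" w] by (simp add: smooth_on_const wedge_def)

lemma d1_cnj: "form1 S w \<Longrightarrow> d1 (\<lambda>y u. cnj (w y u)) x a b = cnj (d1 w x a b)"
  using S by (simp add: d1_def dir_deriv_cnj form1_differentiable)

lemma d1_dir_deriv: "smooth_on S f \<Longrightarrow> d1 (\<partial> f) x u v = 0"
  using dir_deriv_commute[OF S] by (simp add: d1_def)

text \<open>Differentiating the factor 1 / f only adds a multiple of df \<and> df, so closedness
  follows without choosing a branch of the logarithm.\<close>

lemma d1_log_deriv:
  assumes f: "smooth_on S f" "\<And>y. y \<in> S \<Longrightarrow> f y \<noteq> 0"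
  shows "d1 (\<lambda>y u. inverse (f y) * \<partial> f y u) x u v = 0"
proof -
  have "((\<lambda>y. inverse (f y)) has_derivative (\<lambda>h. - (inverse (f x) * \<partial> f x h * inverse (f x)))) (at x)"
    using f S by (intro Deriv.has_derivative_inverse smooth_on_has_derivative) auto
  then have "\<partial> (\<lambda>y. inverse (f y)) x h = - (inverse (f x) * \<partial> f x h * inverse (f x))" for h
    by (simp add: dir_deriv_eqI)
  then show ?thesis
    using S f by (simp add: d1_scale smooth_on_inverse_complex form1_dir_deriv d1_dir_deriv wedge_def)
qed

lemma d2_add:
  assumes "\<And>u v. (\<lambda>y. s y u v) differentiable (at x)" "\<And>u v. (\<lambda>y. t y u v) differentiable (at x)"
  shows "d2 (\<lambda>y u v. s y u v + t y u v) x u v w = d2 s x u v w + d2 t x u v w"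
  by (simp add: d2_def dir_deriv_add assms)

lemma differentiable_wedge: "form1 S a \<Longrightarrow> form1 S b \<Longrightarrow> (\<lambda>y. wedge (a y) (b y) u v) differentiable (at x)"
  unfolding wedge_def using S by (intro differentiable_diff differentiable_mult form1_differentiable)

lemma d2_wedge:
  assumes "form1 S a" "form1 S b"
  shows "d2 (\<lambda>y. wedge (a y) (b y)) x u v w = wedge21 (d1 a x) (b x) u v w - wedge21 (d1 b x) (a x) u v w"
  using S assms
  by (simp add: d2_def wedge_def wedge21_def d1_def dir_deriv_diff dir_deriv_mult form1_differentiable
      differentiable_mult algebra_simps)

lemma d2_d1:
  assumes "form1 S a"
  shows "d2 (d1 a) x u v w = 0"
proof -
  have "(\<lambda>y. \<partial> (\<lambda>y. a y u) y v) differentiable (at x)" for u v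
    by (rule smooth_on_differentiable[OF smooth_on_dir_deriv[OF form1_smooth[OF assms]] S(2)])
  then show ?thesis
    using dir_deriv_commute[OF S form1_smooth[OF assms]] by (simp add: d2_def d1_def dir_deriv_diff)
qed

lemma linear_d1:
  assumes w: "form1 S w"
  shows "linear (d1 w x u)"
proof -
  have d: "(\<lambda>y. w y v) differentiable (at x)" for v using S w form1_differentiable by blast
  have "\<partial> (\<lambda>y. w y (a + b)) x = (\<lambda>u. \<partial> (\<lambda>y. w y a) x u + \<partial> (\<lambda>y. w y b) x u)" for a b
    using dir_deriv_cong[OF S, of "\<lambda>y. w y (a + b)" "\<lambda>y. w y a + w y b"] w
    by (auto simp: form1_linear linear_add dir_deriv_add[OF d d])
  moreover have "\<partial> (\<lambda>y. w y (r *\<^sub>R a)) x = (\<lambda>u. r *\<^sub>R \<partial> (\<lambda>y. w y a) x u)" for a r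
    using dir_deriv_cong[OF S, of "\<lambda>y. w y (r *\<^sub>R a)" "\<lambda>y. r *\<^sub>R w y a"] w
    by (auto simp: form1_linear linear_scale dir_deriv_bounded_linear[OF bounded_linear_scaleR_right d])
  ultimately show ?thesis
    using linear_dir_deriv[OF d] unfolding d1_def
    by (intro linearI) (simp_all add: linear_add linear_scale scaleR_diff_right)
qed

end

lemma d1_swap: "d1 w x v u = - d1 w x u v"
  by (simp add: d1_def)

section \<open>The structure equations under the third Gray condition\<close>

text \<open>
  For a frame \<open>(a, b, c, d)\<close> with \<open>J a = b\<close> and \<open>J c = d\<close>, a 2-form is \<open>J\<close>-invariant, i.e. of type \<open>(1,1)\<close>, if
  \<open>J_inv\<close> holds, has no \<open>(1,1)\<close> part if \<open>J_anti\<close> holds, and \<open>part02\<close> is its value on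
  \<open>(a + \<i> b, c + \<i> d)\<close>, the only component of type \<open>(0,2)\<close>.
\<close>

definition J_inv :: "'e \<Rightarrow> 'e \<Rightarrow> 'e \<Rightarrow> 'e \<Rightarrow> ('e \<Rightarrow> 'e \<Rightarrow> complex) \<Rightarrow> bool" where
  "J_inv a b c d t \<longleftrightarrow> t a c = t b d \<and> t a d = - t b c"

definition J_anti :: "'e \<Rightarrow> 'e \<Rightarrow> 'e \<Rightarrow> 'e \<Rightarrow> ('e \<Rightarrow> 'e \<Rightarrow> complex) \<Rightarrow> bool" where
  "J_anti a b c d t \<longleftrightarrow> t a b = 0 \<and> t c d = 0 \<and> t a c = - t b d \<and> t a d = t b c"

definition part02 :: "'e \<Rightarrow> 'e \<Rightarrow> 'e \<Rightarrow> 'e \<Rightarrow> ('e \<Rightarrow> 'e \<Rightarrow> complex) \<Rightarrow> complex" where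
  "part02 a b c d t = t a c - t b d + \<i> * (t b c + t a d)"

lemma J_inv_part02: "J_inv a b c d t \<Longrightarrow> part02 a b c d t = 0"
  by (simp add: J_inv_def part02_def)

text \<open>This is all that the argument retains of the geometry: a unitary frame with its coframe,
  the first structure equations, and the types of the curvature forms. With \<nu> = c ~\<alpha>1 the
  last summand in \<open>gray_A\<close> and \<open>gray_B\<close> is \<nu> \<and> ~\<nu>, a
  quadratic term of the second structure equations.\<close>

locale gray_frame =
  fixes V :: "(real ^ 4) set" and e1 e2 e3 e4 :: "real ^ 4 \<Rightarrow> real ^ 4"
    and \<alpha>1 \<alpha>2 A B \<mu> :: "real ^ 4 \<Rightarrow> real ^ 4 \<Rightarrow> complex" and c :: "real ^ 4 \<Rightarrow> complex"
  assumes V: "open V"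
    and smooth_e: "smooth_on V e1" "smooth_on V e2" "smooth_on V e3" "smooth_on V e4"
    and forms: "form1 V \<alpha>1" "form1 V \<alpha>2" "form1 V A" "form1 V B" "form1 V \<mu>"
    and c: "smooth_on V c" "\<And>x. x \<in> V \<Longrightarrow> c x \<noteq> 0"
    and real: "\<And>x u. cnj (A x u) = A x u" "\<And>x u. cnj (B x u) = B x u"
    and dual: "\<And>x. x \<in> V \<Longrightarrow> \<alpha>1 x (e1 x) = 1" "\<And>x. x \<in> V \<Longrightarrow> \<alpha>1 x (e2 x) = \<i>"
      "\<And>x. x \<in> V \<Longrightarrow> \<alpha>1 x (e3 x) = 0" "\<And>x. x \<in> V \<Longrightarrow> \<alpha>1 x (e4 x) = 0"
      "\<And>x. x \<in> V \<Longrightarrow> \<alpha>2 x (e1 x) = 0" "\<And>x. x \<in> V \<Longrightarrow> \<alpha>2 x (e2 x) = 0"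
      "\<And>x. x \<in> V \<Longrightarrow> \<alpha>2 x (e3 x) = 1" "\<And>x. x \<in> V \<Longrightarrow> \<alpha>2 x (e4 x) = \<i>"
    and expand: "\<And>x u. x \<in> V \<Longrightarrow> u = Re (\<alpha>1 x u) *\<^sub>R e1 x + Im (\<alpha>1 x u) *\<^sub>R e2 x
      + Re (\<alpha>2 x u) *\<^sub>R e3 x + Im (\<alpha>2 x u) *\<^sub>R e4 x"
    and d\<alpha>1: "\<And>x u v. x \<in> V \<Longrightarrow> d1 \<alpha>1 x u v = \<i> * wedge (A x) (\<alpha>1 x) u v + wedge (\<mu> x) (\<alpha>2 x) u v
      + c x * wedge (\<lambda>u. cnj (\<alpha>1 x u)) (\<lambda>u. cnj (\<alpha>2 x u)) u v"
    and d\<alpha>2: "\<And>x u v. x \<in> V \<Longrightarrow> d1 \<alpha>2 x u v = \<i> * wedge (B x) (\<alpha>2 x) u v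
      - wedge (\<lambda>u. cnj (\<mu> x u)) (\<alpha>1 x) u v"
    and gray_\<nu>: "\<And>x. x \<in> V \<Longrightarrow> J_anti (e1 x) (e2 x) (e3 x) (e4 x)
      (\<lambda>u v. d1 (\<lambda>y u. c y * cnj (\<alpha>1 y u)) x u v
        - \<i> * wedge (\<lambda>u. A x u + B x u) (\<lambda>u. c x * cnj (\<alpha>1 x u)) u v)"
    and gray_A: "\<And>x. x \<in> V \<Longrightarrow> J_inv (e1 x) (e2 x) (e3 x) (e4 x)
      (\<lambda>u v. \<i> * d1 A x u v + wedge (\<mu> x) (\<lambda>u. cnj (\<mu> x u)) u v
        + c x * cnj (c x) * wedge (\<lambda>u. cnj (\<alpha>1 x u)) (\<alpha>1 x) u v)"
    and gray_B: "\<And>x. x \<in> V \<Longrightarrow> J_inv (e1 x) (e2 x) (e3 x) (e4 x)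
      (\<lambda>u v. \<i> * d1 B x u v - wedge (\<mu> x) (\<lambda>u. cnj (\<mu> x u)) u v
        + c x * cnj (c x) * wedge (\<lambda>u. cnj (\<alpha>1 x u)) (\<alpha>1 x) u v)"
    and gray_\<mu>: "\<And>x. x \<in> V \<Longrightarrow> J_inv (e1 x) (e2 x) (e3 x) (e4 x)
      (\<lambda>u v. d1 \<mu> x u v - \<i> * wedge (\<lambda>u. A x u - B x u) (\<mu> x) u v)"
begin

lemma cnj_\<alpha>: "form1 V (\<lambda>x u. cnj (\<alpha>1 x u))" "form1 V (\<lambda>x u. cnj (\<alpha>2 x u))"
  by (intro form1_cnj V forms)+

lemma d1_real:
  assumes "x \<in> V"
  shows "cnj (d1 A x u v) = d1 A x u v" "cnj (d1 B x u v) = d1 B x u v"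
  by (rule d1_cnj[OF V assms forms(3), unfolded real, symmetric] d1_cnj[OF V assms forms(4), unfolded real, symmetric])+

lemma linear_expand:
  fixes h :: "real ^ 4 \<Rightarrow> complex"
  assumes "x \<in> V" "linear h"
  shows "h u = Re (\<alpha>1 x u) * h (e1 x) + Im (\<alpha>1 x u) * h (e2 x)
    + Re (\<alpha>2 x u) * h (e3 x) + Im (\<alpha>2 x u) * h (e4 x)"
proof -
  have "h u = Re (\<alpha>1 x u) *\<^sub>R h (e1 x) + Im (\<alpha>1 x u) *\<^sub>R h (e2 x)
      + Re (\<alpha>2 x u) *\<^sub>R h (e3 x) + Im (\<alpha>2 x u) *\<^sub>R h (e4 x)"
    by (rule trans[OF arg_cong[OF expand[OF assms(1)]]])
      (simp only: linear_add[OF assms(2)] linear_scale[OF assms(2)])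
  then show ?thesis by (simp add: scaleR_conv_of_real)
qed

text \<open>The last two hypotheses say that \<open>h\<close> is complex linear with respect to J,
  i.e. of type (1,0), and \<alpha>1, \<alpha>2 span the forms of that type.\<close>

lemma linear_expand_10:
  fixes h :: "real ^ 4 \<Rightarrow> complex"
  assumes "x \<in> V" "linear h" "h (e2 x) = \<i> * h (e1 x)" "h (e4 x) = \<i> * h (e3 x)"
  shows "h u = h (e1 x) * \<alpha>1 x u + h (e3 x) * \<alpha>2 x u"
proof -
  have "Re z * p + Im z * (\<i> * p) = p * z" for z p :: complex
    by (simp add: complex_eq_iff algebra_simps)
  from this[of "\<alpha>1 x u" "h (e1 x)"] this[of "\<alpha>2 x u" "h (e3 x)"] show ?thesis
    unfolding linear_expand[OF assms(1,2), of u] assms(3,4) by (simp add: add.assoc)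
qed

text \<open>Since the \<open>(0,2)\<close> part of the differential of a \<open>(1,0)\<close>-form is a multiple of the Nijenhuis
  tensor, it can only vanish for forms proportional to \<open>\<alpha>2\<close>.\<close>

lemma form_10:
  assumes h: "form1 V h"
    and t: "\<And>x. x \<in> V \<Longrightarrow> h x (e2 x) = \<i> * h x (e1 x)" "\<And>x. x \<in> V \<Longrightarrow> h x (e4 x) = \<i> * h x (e3 x)"
    and x: "x \<in> V" and J: "part02 (e1 x) (e2 x) (e3 x) (e4 x) (d1 h x) = 0"
  shows "h x (e1 x) = 0"
proof -
  let ?p = "\<lambda>y. h y (e1 y)" and ?q = "\<lambda>y. h y (e3 y)"
  have s: "smooth_on V ?p" "smooth_on V ?q" by (intro form1_apply V h smooth_e)+
  have f: "form1 V (\<lambda>y u. ?p y * \<alpha>1 y u)" "form1 V (\<lambda>y u. ?q y * \<alpha>2 y u)"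
    by (intro form1_scale V s forms)+
  have "d1 h x = d1 (\<lambda>y u. ?p y * \<alpha>1 y u + ?q y * \<alpha>2 y u) x"
    by (rule d1_cong[OF V x]) (intro linear_expand_10 form1_linear[OF h] t)
  then have dh: "d1 h x u v = wedge (\<partial> ?p x) (\<alpha>1 x) u v + ?p x * d1 \<alpha>1 x u v
      + (wedge (\<partial> ?q x) (\<alpha>2 x) u v + ?q x * d1 \<alpha>2 x u v)" for u v
    by (simp add: d1_add[OF V x f] d1_scale[OF V x s(1) forms(1)] d1_scale[OF V x s(2) forms(2)])
  \<comment> \<open>Every product with a factor \<alpha>1 or \<alpha>2 vanishes on the (0,1) vectors
    e1 + \<i> e2 and e3 + \<i> e4. Only c ~\<alpha>1 \<and> ~\<alpha>2 survives, with value 2 * 2 *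
    c.\<close>
  have "part02 (e1 x) (e2 x) (e3 x) (e4 x) (d1 h x) = 4 * c x * ?p x"
    by (simp add: part02_def dh d\<alpha>1[OF x] d\<alpha>2[OF x] wedge_def dual[OF x] algebra_simps)
  then show ?thesis using J c(2)[OF x] by simp
qed

section \<open>Types of the connection forms\<close>

definition b where "b x u = \<partial> c x u - \<i> * (2 * A x u + B x u) * c x"

text \<open>The curvature of \<nu> expands to b \<and> ~\<alpha>1 + c ~\<mu> \<and> ~\<alpha>2 +
  |c|^2 \<alpha>1 \<and> \<alpha>2. Its (1,1) part consists of the (1,0) parts of b and c ~\<mu>,
  wedged with the independent forms ~\<alpha>1 and ~\<alpha>2, so both of these (1,0) parts
  vanish.\<close>

lemma type_of_b_\<mu>:
  assumes x: "x \<in> V"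
  shows "b x (e2 x) = - \<i> * b x (e1 x)" "b x (e4 x) = - \<i> * b x (e3 x)"
    "\<mu> x (e2 x) = \<i> * \<mu> x (e1 x)" "\<mu> x (e4 x) = \<i> * \<mu> x (e3 x)"
proof -
  define n where "n u = cnj (\<mu> x u)" for u
  define F where "F u v = d1 (\<lambda>y u. c y * cnj (\<alpha>1 y u)) x u v
        - \<i> * wedge (\<lambda>u. A x u + B x u) (\<lambda>u. c x * cnj (\<alpha>1 x u)) u v" for u v
  have F: "F u v = wedge (b x) (\<lambda>u. cnj (\<alpha>1 x u)) u v + c x * wedge n (\<lambda>u. cnj (\<alpha>2 x u)) u v
      + c x * cnj (c x) * wedge (\<alpha>1 x) (\<alpha>2 x) u v" for u v
    by (simp add: F_def d1_scale[OF V x c(1) cnj_\<alpha>(1)] d1_cnj[OF V x forms(1)] d\<alpha>1[OF x] wedge_def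
        real b_def n_def algebra_simps)
  have "J_anti (e1 x) (e2 x) (e3 x) (e4 x) F" using gray_\<nu>[OF x] unfolding F_def .
  then have G: "F (e1 x) (e2 x) = 0" "F (e3 x) (e4 x) = 0" "F (e1 x) (e3 x) + F (e2 x) (e4 x) = 0"
    "F (e1 x) (e4 x) - F (e2 x) (e3 x) = 0" by (simp_all add: J_anti_def)
  have n4: "n (e4 x) = - \<i> * n (e3 x)"
    by (rule mult_left_cancel[THEN iffD1, OF c(2)[OF x]])
      (use G(2) in \<open>simp add: F wedge_def dual[OF x] algebra_simps\<close>)
  \<comment> \<open>The right side is F on the (1,0) vector e1 - \<i> e2 and the (0,1) vector e3 +
    \<i> e4, a pair on which only the term with ~\<mu> is non-zero.\<close>
  have "2 * c x * (n (e1 x) - \<i> * n (e2 x)) = F (e1 x) (e3 x) + F (e2 x) (e4 x)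
      + \<i> * (F (e1 x) (e4 x) - F (e2 x) (e3 x))"
    by (simp add: F wedge_def dual[OF x] algebra_simps)
  then have n1: "n (e1 x) = \<i> * n (e2 x)" using c(2)[OF x] G by simp
  show "b x (e2 x) = - \<i> * b x (e1 x)"
    using G(1) by (simp add: F wedge_def dual[OF x] algebra_simps)
  have b4: "- b x (e4 x) = \<i> * b x (e3 x)"
    using G(4) by (simp add: F wedge_def dual[OF x] n1 algebra_simps)
  show "b x (e4 x) = - \<i> * b x (e3 x)"
    using b4 by algebra
  show "\<mu> x (e2 x) = \<i> * \<mu> x (e1 x)"
    using arg_cong[OF n1, of cnj] by (simp add: n_def)
  show "\<mu> x (e4 x) = \<i> * \<mu> x (e3 x)"
    using arg_cong[OF n4, of cnj] by (simp add: n_def)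
qed

definition m where "m x = \<mu> x (e3 x)"

lemma smooth_m: "smooth_on V m"
  unfolding m_def by (intro form1_apply V forms smooth_e)

text \<open>As \<mu> has type (1,0), the product with A - B has no (0,2) part. The (1,1) type of the
  curvature thus removes the (0,2) part of d\<mu> itself, and \<open>form_10\<close>
  applies.\<close>

lemma \<mu>_eq:
  assumes x: "x \<in> V"
  shows "\<mu> x u = m x * \<alpha>2 x u"
proof -
  have "part02 (e1 x) (e2 x) (e3 x) (e4 x) (d1 \<mu> x) = part02 (e1 x) (e2 x) (e3 x) (e4 x)
      (\<lambda>u v. d1 \<mu> x u v - \<i> * wedge (\<lambda>u. A x u - B x u) (\<mu> x) u v)"
    by (simp add: part02_def wedge_def type_of_b_\<mu>[OF x] algebra_simps)
  then have "part02 (e1 x) (e2 x) (e3 x) (e4 x) (d1 \<mu> x) = 0"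
    using J_inv_part02[OF gray_\<mu>[OF x]] by simp
  then have "\<mu> x (e1 x) = 0"
    by (intro form_10[OF forms(5) _ _ x] type_of_b_\<mu>) auto
  then show ?thesis
    using linear_expand_10[OF x form1_linear[OF forms(5) x] type_of_b_\<mu>(3,4)[OF x], of u] by (simp add: m_def)
qed

text \<open>The quadratic terms \<mu> \<and> ~\<mu> = |m|^2 \<alpha>2 \<and> ~\<alpha>2 and
  ~\<alpha>1 \<and> \<alpha>1 are themselves of type (1,1).\<close>

lemma J_inv_d1:
  assumes "x \<in> V"
  shows "J_inv (e1 x) (e2 x) (e3 x) (e4 x) (d1 A x)" "J_inv (e1 x) (e2 x) (e3 x) (e4 x) (d1 B x)"
  using gray_A[OF assms] gray_B[OF assms]
  by (simp_all add: J_inv_def wedge_def \<mu>_eq[OF assms] dual[OF assms]) (simp_all add: complex_eq_iff)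

text \<open>The covariant logarithmic derivative of \<open>c\<close>, equal to b / c; the weight 2 A
  + B is the one that makes c ~\<alpha>1 \<and> ~\<alpha>2 rotate like \<alpha>1.\<close>

definition \<beta> where "\<beta> x u = inverse (c x) * \<partial> c x u - \<i> * (2 * A x u + B x u)"
definition s where "s x = \<beta> x (e3 x)"

lemma form1_\<beta>: "form1 V \<beta>"
  unfolding \<beta>_def
  by (intro form1_diff form1_scale form1_add smooth_on_const form1_dir_deriv smooth_on_inverse_complex V c forms)

lemma smooth_s: "smooth_on V s"
  unfolding s_def by (intro form1_apply V form1_\<beta> smooth_e)

lemma dc: "x \<in> V \<Longrightarrow> \<partial> c x u = c x * (\<beta> x u + \<i> * (2 * A x u + B x u))"
  using c(2)[of x] by (simp add: \<beta>_def)

lemma d1_\<beta>: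
  assumes x: "x \<in> V"
  shows "d1 \<beta> x u v = - \<i> * (2 * d1 A x u v + d1 B x u v)"
proof -
  have f: "form1 V (\<lambda>y u. inverse (c y) * \<partial> c y u)"
    by (intro form1_scale form1_dir_deriv smooth_on_inverse_complex V c)
  have f': "form1 V (\<lambda>y u. 2 * A y u)" by (rule form1_cmult[OF V forms(3)])
  have f'': "form1 V (\<lambda>y u. 2 * A y u + B y u)" by (rule form1_add[OF V f' forms(4)])
  show ?thesis
    unfolding \<beta>_def
    by (simp add: d1_diff[OF V x f form1_cmult[OF V f'']] d1_log_deriv[OF V x c] d1_cmult[OF V x f'']
        d1_add[OF V x f' forms(4)] d1_cmult[OF V x forms(3)])
qed

text \<open>The conjugate of \<beta> is a (1,0)-form whose differential \<i> (2 dA + dB) has type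
  (1,1), so \<open>form_10\<close> leaves only a multiple of \<alpha>2.\<close>

lemma \<beta>_eq:
  assumes x: "x \<in> V"
  shows "\<beta> x u = s x * cnj (\<alpha>2 x u)"
proof -
  define h where "h y u = cnj (\<beta> y u)" for y u
  have h: "form1 V h" unfolding h_def by (intro form1_cnj V form1_\<beta>)
  have bb: "\<beta> y u = inverse (c y) * b y u" if "y \<in> V" for y u
    using c(2)[OF that] by (simp add: \<beta>_def b_def field_simps)
  have t: "h y (e2 y) = \<i> * h y (e1 y)" "h y (e4 y) = \<i> * h y (e3 y)" if "y \<in> V" for y
    by (simp_all add: h_def bb[OF that] type_of_b_\<mu>[OF that])
  have dh: "d1 h x u v = \<i> * (2 * d1 A x u v + d1 B x u v)" for u v
    unfolding h_def by (simp add: d1_cnj[OF V x form1_\<beta>] d1_\<beta>[OF x] d1_real[OF x])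
  have "J_inv (e1 x) (e2 x) (e3 x) (e4 x) (d1 h x)"
    using J_inv_d1[OF x] by (simp add: J_inv_def dh algebra_simps)
  then have "h x (e1 x) = 0" by (intro form_10[OF h _ _ x] t J_inv_part02)
  then have "h x u = h x (e3 x) * \<alpha>2 x u"
    using linear_expand_10[OF x form1_linear[OF h x] t[OF x], of u] by simp
  from arg_cong[OF this, of cnj] show ?thesis by (simp add: h_def s_def)
qed

end

section \<open>Contradiction on an open set where \<mu> does not vanish\<close>

locale gray_frame_m = gray_frame +
  assumes m: "\<And>x. x \<in> V \<Longrightarrow> m x \<noteq> 0"
begin

text \<open>The covariant logarithmic derivative of \<open>m\<close>: \<mu> has weight A - B and
  \<alpha>2 has weight B, so their ratio has weight A - 2 B.\<close>

definition \<gamma> where "\<gamma> x u = inverse (m x) * \<partial> m x u - \<i> * (A x u - 2 * B x u)"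

lemma form1_\<gamma>: "form1 V \<gamma>"
  unfolding \<gamma>_def
  by (intro form1_diff form1_scale form1_add smooth_on_const form1_dir_deriv smooth_on_inverse_complex
      V m smooth_m forms)

lemma dm: "x \<in> V \<Longrightarrow> \<partial> m x u = m x * (\<gamma> x u + \<i> * (A x u - 2 * B x u))"
  using m[of x] by (simp add: \<gamma>_def)

lemma d1_\<gamma>:
  assumes x: "x \<in> V"
  shows "d1 \<gamma> x u v = - \<i> * (d1 A x u v - 2 * d1 B x u v)"
proof -
  have f: "form1 V (\<lambda>y u. inverse (m y) * \<partial> m y u)"
    by (intro form1_scale form1_dir_deriv smooth_on_inverse_complex V m smooth_m)
  have f': "form1 V (\<lambda>y u. 2 * B y u)" by (rule form1_cmult[OF V forms(4)])
  have f'': "form1 V (\<lambda>y u. A y u - 2 * B y u)" by (rule form1_diff[OF V forms(3) f'])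
  show ?thesis
    unfolding \<gamma>_def
    by (simp add: d1_diff[OF V x f form1_cmult[OF V f'']] d1_log_deriv[OF V x smooth_m m] d1_cmult[OF V x f'']
        d1_diff[OF V x forms(3) f'] d1_cmult[OF V x forms(4)])
qed

lemma form1_ops:
  "form1 V (\<lambda>y u. \<i> * A y u)" "form1 V (\<lambda>y u. \<i> * B y u)" "form1 V (\<lambda>y u. c y * cnj (\<alpha>1 y u))"
  "form1 V (\<lambda>y u. - cnj (m y) * cnj (\<alpha>2 y u))"
  by (intro form1_cmult form1_scale V forms cnj_\<alpha> c smooth_on_minus smooth_on_cnj smooth_m)+

text \<open>With \<mu> = m \<alpha>2 the curvature of \<mu> becomes m \<gamma> \<and> \<alpha>2 +
  |m|^2 \<alpha>1 \<and> ~\<alpha>2. It has no (2,0) part, so \<gamma> has no component along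
  \<alpha>1.\<close>

lemma \<gamma>12:
  assumes x: "x \<in> V"
  shows "\<gamma> x (e2 x) = - \<i> * \<gamma> x (e1 x)"
proof -
  have "d1 \<mu> x u v = wedge (\<partial> m x) (\<alpha>2 x) u v + m x * d1 \<alpha>2 x u v" for u v
    using d1_cong[OF V x, of \<mu> "\<lambda>y u. m y * \<alpha>2 y u"] \<mu>_eq d1_scale[OF V x smooth_m forms(2)] by simp
  note d\<mu> = this
  have "m x * (\<gamma> x (e1 x) - \<i> * \<gamma> x (e2 x)) = 0"
    using gray_\<mu>[OF x]
    by (simp add: d\<mu> J_inv_def d\<alpha>2[OF x] \<mu>_eq[OF x] dm[OF x] wedge_def dual[OF x] algebra_simps)
  then have "\<gamma> x (e1 x) = \<i> * \<gamma> x (e2 x)" using m[OF x] by simp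
  then show ?thesis by simp
qed

text \<open>Because \<mu> \<and> \<alpha>2 = 0 and \<beta> is a multiple of ~\<alpha>2, d
  (d\<alpha>1) = 0 reduces to (\<i> dA + |c|^2 \<alpha>2 \<and> ~\<alpha>2) \<and> \<alpha>1 = 0.
  The value on (e1, e2) is invisible here.\<close>

lemma bianchi_\<alpha>1:
  assumes x: "x \<in> V"
  shows "d1 A x (e3 x) (e4 x) = 2 * (c x * cnj (c x))"
    "d1 A x (e1 x) (e3 x) = 0" "d1 A x (e1 x) (e4 x) = 0" "d1 A x (e2 x) (e3 x) = 0" "d1 A x (e2 x) (e4 x) = 0"
proof -
  have "d2 (d1 \<alpha>1) x = d2 (\<lambda>y u v. wedge (\<lambda>u. \<i> * A y u) (\<alpha>1 y) u v
      + wedge (\<lambda>u. c y * cnj (\<alpha>1 y u)) (\<lambda>u. cnj (\<alpha>2 y u)) u v) x"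
    by (rule d2_cong[OF V x]) (simp add: d\<alpha>1 \<mu>_eq wedge_def algebra_simps)
  then have E: "wedge21 (d1 (\<lambda>y u. \<i> * A y u) x) (\<alpha>1 x) u v w
      - wedge21 (d1 \<alpha>1 x) (\<lambda>u. \<i> * A x u) u v w
      + (wedge21 (d1 (\<lambda>y u. c y * cnj (\<alpha>1 y u)) x) (\<lambda>u. cnj (\<alpha>2 x u)) u v w
      - wedge21 (d1 (\<lambda>y u. cnj (\<alpha>2 y u)) x) (\<lambda>u. c x * cnj (\<alpha>1 x u)) u v w) = 0" for u v w
    using d2_d1[OF V x forms(1)]
    by (simp add: d2_add[OF V x] differentiable_wedge[OF V x] form1_ops forms cnj_\<alpha> d2_wedge[OF V x])
  note E = E[unfolded d1_scale[OF V x c(1) cnj_\<alpha>(1)] d1_cnj[OF V x forms(1)] d1_cnj[OF V x forms(2)]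
      d1_cmult[OF V x forms(3)]]
  note ev = wedge21_def wedge_def d\<alpha>1[OF x] d\<alpha>2[OF x] \<mu>_eq[OF x] dc[OF x] \<beta>_eq[OF x] dual[OF x] real
  show "d1 A x (e3 x) (e4 x) = 2 * (c x * cnj (c x))"
    using E[of "e3 x" "e4 x" "e1 x"] by (simp add: ev algebra_simps)
  have h: "q = \<i> * p" if "p + \<i> * q = 0" for p q :: complex
    using that by (simp add: complex_eq_iff)
  \<comment> \<open>One complex equation relates two real numbers, so by \<open>r\<close> both are
    zero.\<close>
  have a: "d1 A x (e2 x) (e3 x) = \<i> * d1 A x (e1 x) (e3 x)"
    using E[of "e1 x" "e2 x" "e3 x"] d1_swap[of A x "e3 x" "e1 x"] by (intro h) (simp add: ev algebra_simps)
  have b: "d1 A x (e2 x) (e4 x) = \<i> * d1 A x (e1 x) (e4 x)"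
    using E[of "e1 x" "e2 x" "e4 x"] d1_swap[of A x "e4 x" "e1 x"] by (intro h) (simp add: ev algebra_simps)
  have r: "p = 0" if "cnj p = p" "cnj q = q" "q = \<i> * p" for p q
    using that by (simp add: complex_eq_iff)
  show "d1 A x (e1 x) (e3 x) = 0" "d1 A x (e1 x) (e4 x) = 0"
    using r[OF _ _ a] r[OF _ _ b] d1_real[OF x] by auto
  then show "d1 A x (e2 x) (e3 x) = 0" "d1 A x (e2 x) (e4 x) = 0" using a b by auto
qed

text \<open>Here d (d\<alpha>2) = 0 reduces to \<i> dB \<and> \<alpha>2 + |m|^2 \<alpha>2 \<and>
  ~\<alpha>1 \<and> \<alpha>1 - ~m ~\<gamma> \<and> ~\<alpha>2 \<and> \<alpha>1 = 0. On (e1, e2, e3)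
  the last term drops out by \<open>\<gamma>12\<close>; the second claim is the conjugate of the
  value on (e3, e4, e1).\<close>

lemma bianchi_\<alpha>2:
  assumes x: "x \<in> V"
  shows "d1 B x (e1 x) (e2 x) = - 2 * (m x * cnj (m x))"
    "\<i> * d1 B x (e1 x) (e3 x) + d1 B x (e1 x) (e4 x) = m x * (\<gamma> x (e3 x) + \<i> * \<gamma> x (e4 x))"
proof -
  have "d2 (d1 \<alpha>2) x = d2 (\<lambda>y u v. wedge (\<lambda>u. \<i> * B y u) (\<alpha>2 y) u v
      + wedge (\<lambda>u. - cnj (m y) * cnj (\<alpha>2 y u)) (\<alpha>1 y) u v) x"
    by (rule d2_cong[OF V x]) (simp add: d\<alpha>2 \<mu>_eq wedge_def algebra_simps)
  then have E: "wedge21 (d1 (\<lambda>y u. \<i> * B y u) x) (\<alpha>2 x) u v w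
      - wedge21 (d1 \<alpha>2 x) (\<lambda>u. \<i> * B x u) u v w
      + (wedge21 (d1 (\<lambda>y u. - cnj (m y) * cnj (\<alpha>2 y u)) x) (\<alpha>1 x) u v w
      - wedge21 (d1 \<alpha>1 x) (\<lambda>u. - cnj (m x) * cnj (\<alpha>2 x u)) u v w) = 0" for u v w
    using d2_d1[OF V x forms(2)]
    by (simp only: d2_add[OF V x] differentiable_wedge[OF V x] form1_ops forms cnj_\<alpha> d2_wedge[OF V x])
  have dm': "\<partial> (\<lambda>y. - cnj (m y)) x u = - cnj (m x) * (cnj (\<gamma> x u) - \<i> * (A x u - 2 * B x u))" for u
    using dir_deriv_bounded_linear[OF bounded_linear_minus[OF bounded_linear_cnj], of m x u] smooth_m x
    by (simp add: smooth_on_differentiable dm real)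
  note E = E[unfolded d1_scale[OF V x smooth_on_minus[OF V smooth_on_cnj[OF V smooth_m]] cnj_\<alpha>(2)]
      d1_cnj[OF V x forms(2)] d1_cmult[OF V x forms(4)]]
  note ev = wedge21_def wedge_def d\<alpha>1[OF x] d\<alpha>2[OF x] \<mu>_eq[OF x] dm' dual[OF x] real
  have h: "q = \<i> * p" if "p + \<i> * q = 0" for p q :: complex
    using that by (simp add: complex_eq_iff)
  have "\<i> * (d1 B x (e1 x) (e2 x) + 2 * (m x * cnj (m x))) = 0"
    using E[of "e1 x" "e2 x" "e3 x"] by (simp add: ev \<gamma>12[OF x] algebra_simps)
  then show "d1 B x (e1 x) (e2 x) = - 2 * (m x * cnj (m x))"
    by (simp add: eq_neg_iff_add_eq_0)
  have "d1 B x (e1 x) (e3 x) + \<i> * d1 B x (e1 x) (e4 x)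
      = cnj (m x) * (\<i> * cnj (\<gamma> x (e3 x)) + cnj (\<gamma> x (e4 x)))"
    using E[of "e3 x" "e4 x" "e1 x"] d1_swap[of B x "e4 x" "e1 x"] by (simp add: ev algebra_simps)
  from arg_cong[OF this, of "\<lambda>z. \<i> * cnj z"]
  show "\<i> * d1 B x (e1 x) (e3 x) + d1 B x (e1 x) (e4 x) = m x * (\<gamma> x (e3 x) + \<i> * \<gamma> x (e4 x))"
    by (simp add: d1_real[OF x] algebra_simps)
qed

text \<open>d\<beta> is computed twice, as -\<i> (2 dA + dB) and as d (s ~\<alpha>2). The second
  claim says that the ~\<alpha>2 component of \<gamma> is -s.\<close>

lemma bianchi_c:
  assumes x: "x \<in> V"
  shows "d1 A x (e1 x) (e2 x) = m x * cnj (m x)"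
    "\<gamma> x (e3 x) + \<i> * \<gamma> x (e4 x) = - 2 * s x"
proof -
  have d\<beta>: "d1 \<beta> x u v = wedge (\<partial> s x) (\<lambda>u. cnj (\<alpha>2 x u)) u v + s x * cnj (d1 \<alpha>2 x u v)" for u v
    using d1_cong[OF V x, of \<beta> "\<lambda>y u. s y * cnj (\<alpha>2 y u)"] \<beta>_eq
      d1_scale[OF V x smooth_s cnj_\<alpha>(2)] d1_cnj[OF V x forms(2)] by simp
  have "d1 \<beta> x (e1 x) (e2 x) = 0"
    by (simp add: d\<beta> d\<alpha>2[OF x] wedge_def dual[OF x] \<mu>_eq[OF x])
  then show "d1 A x (e1 x) (e2 x) = m x * cnj (m x)"
    by (simp add: d1_\<beta>[OF x] bianchi_\<alpha>2(1)[OF x])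
  \<comment> \<open>The (1,0) vector e3 - \<i> e4 annihilates ~\<alpha>2, which eliminates the
    unknown ds.\<close>
  have "d1 \<beta> x (e1 x) (e3 x) - \<i> * d1 \<beta> x (e1 x) (e4 x) = 2 * s x * m x"
    by (simp add: d\<beta> d\<alpha>2[OF x] wedge_def dual[OF x] \<mu>_eq[OF x] real algebra_simps)
  moreover have "d1 \<beta> x (e1 x) (e3 x) - \<i> * d1 \<beta> x (e1 x) (e4 x)
      = - (\<i> * d1 B x (e1 x) (e3 x) + d1 B x (e1 x) (e4 x))"
    by (simp add: d1_\<beta>[OF x] bianchi_\<alpha>1[OF x] algebra_simps)
  ultimately have "m x * (\<gamma> x (e3 x) + \<i> * \<gamma> x (e4 x)) = m x * (- 2 * s x)"
    unfolding bianchi_\<alpha>2(2)[OF x] by algebra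
  then show "\<gamma> x (e3 x) + \<i> * \<gamma> x (e4 x) = - 2 * s x"
    by (rule mult_left_cancel[THEN iffD1, OF m[OF x]])
qed

text \<open>Linearity is available in the last argument only; skewness carries it over to the other
  one, so six values on the frame decide.\<close>

lemma bilinear_d1_expand:
  assumes "x \<in> V" "form1 V w" "\<And>u. linear (t u)" "\<And>u v. t v u = - t u v"
    and "t (e1 x) (e2 x) = d1 w x (e1 x) (e2 x)" "t (e1 x) (e3 x) = d1 w x (e1 x) (e3 x)"
    "t (e1 x) (e4 x) = d1 w x (e1 x) (e4 x)" "t (e2 x) (e3 x) = d1 w x (e2 x) (e3 x)"
    "t (e2 x) (e4 x) = d1 w x (e2 x) (e4 x)" "t (e3 x) (e4 x) = d1 w x (e3 x) (e4 x)"
  shows "d1 w x u v = t u v"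
proof -
  have z: "t p p = 0" "d1 w x p p = 0" for p using assms(4)[of p p] by (simp_all add: d1_def)
  have b: "d1 w x p (f x) = t p (f x)"
    if "\<And>k. k \<in> {e1 x, e2 x, e3 x, e4 x} \<Longrightarrow> d1 w x k (f x) = t k (f x)" for p f
  proof -
    have "d1 w x (f x) k = t (f x) k" if "k \<in> {e1 x, e2 x, e3 x, e4 x}" for k
      using \<open>\<And>k. k \<in> {e1 x, e2 x, e3 x, e4 x} \<Longrightarrow> d1 w x k (f x) = t k (f x)\<close>[OF that]
        assms(4)[of k "f x"] d1_swap[of w x "f x" k] by simp
    then have "d1 w x (f x) p = t (f x) p"
      using linear_expand[OF assms(1) assms(3), of "f x" p]
        linear_expand[OF assms(1) linear_d1[OF V assms(1,2)], of "f x" p] by simp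
    then show ?thesis using assms(4)[of "f x" p] d1_swap[of w x p "f x"] by simp
  qed
  have s: "t q p = d1 w x q p" if "t p q = d1 w x p q" for p q
    using that assms(4)[of q p] d1_swap[of w x q p] by metis
  have "d1 w x p (e1 x) = t p (e1 x)" "d1 w x p (e2 x) = t p (e2 x)"
    "d1 w x p (e3 x) = t p (e3 x)" "d1 w x p (e4 x) = t p (e4 x)" for p
    by (rule b; auto simp: z assms(5-) assms(5-)[THEN s])+
  then show ?thesis
    using linear_expand[OF assms(1) assms(3), of u v]
      linear_expand[OF assms(1) linear_d1[OF V assms(1,2)], of u v] by simp
qed

text \<open>Each \<alpha> \<and> ~\<alpha> equals -2 \<i> on its own plane, so these coefficients
  restore the values |m|^2 on (e1, e2) and 2 |c|^2 on (e3, e4).\<close>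

lemma d1_A:
  assumes x: "x \<in> V"
  shows "d1 A x u v = wedge (\<lambda>u. \<i> / 2 * (m x * cnj (m x)) * \<alpha>1 x u) (\<lambda>u. cnj (\<alpha>1 x u)) u v
    + wedge (\<lambda>u. \<i> * (c x * cnj (c x)) * \<alpha>2 x u) (\<lambda>u. cnj (\<alpha>2 x u)) u v"
proof (rule bilinear_d1_expand[OF x forms(3)])
  show "linear (\<lambda>v. wedge (\<lambda>u. \<i> / 2 * (m x * cnj (m x)) * \<alpha>1 x u) (\<lambda>u. cnj (\<alpha>1 x u)) u v
    + wedge (\<lambda>u. \<i> * (c x * cnj (c x)) * \<alpha>2 x u) (\<lambda>u. cnj (\<alpha>2 x u)) u v)" for u
    using form1_linear[OF forms(1) x] form1_linear[OF forms(2) x]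
    by (intro linearI) (simp_all add: wedge_def linear_add linear_scale scaleR_conv_of_real[where 'a = complex] algebra_simps add_divide_distrib)
qed (simp_all add: wedge_def dual[OF x] bianchi_\<alpha>1[OF x] bianchi_c[OF x] algebra_simps)

text \<open>As \<mu> is a multiple of \<alpha>2, both \<alpha>1 \<and> ~\<alpha>1 and \<alpha>2
  \<and> ~\<alpha>2 are closed, so d (dA) = 0 only differentiates the coefficients. On (e1, e2, e3)
  and (e1, e2, e4) it says that |m|^2 is constant along e3 and e4, and d|m|^2 = |m|^2 (\<gamma> +
  ~\<gamma>).\<close>

lemma bianchi_A:
  assumes x: "x \<in> V"
  shows "\<gamma> x (e3 x) + cnj (\<gamma> x (e3 x)) = 0" "\<gamma> x (e4 x) + cnj (\<gamma> x (e4 x)) = 0"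
proof -
  define k where "k = \<i> / 2"
  have k: "k \<noteq> 0" by (simp add: k_def)
  let ?f = "\<lambda>y. k * (m y * cnj (m y))" and ?g = "\<lambda>y. \<i> * (c y * cnj (c y))"
  have sm: "smooth_on V ?f" "smooth_on V ?g"
    by (intro smooth_on_mult smooth_on_const smooth_on_cnj V c smooth_m)+
  have f: "form1 V (\<lambda>y u. ?f y * \<alpha>1 y u)" "form1 V (\<lambda>y u. ?g y * \<alpha>2 y u)"
    by (intro form1_scale V sm forms)+
  have "d2 (d1 A) x = d2 (\<lambda>y u v. wedge (\<lambda>u. ?f y * \<alpha>1 y u) (\<lambda>u. cnj (\<alpha>1 y u)) u v
    + wedge (\<lambda>u. ?g y * \<alpha>2 y u) (\<lambda>u. cnj (\<alpha>2 y u)) u v) x"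
    unfolding k_def by (rule d2_cong[OF V x]) (rule d1_A)
  then have E: "wedge21 (d1 (\<lambda>y u. ?f y * \<alpha>1 y u) x) (\<lambda>u. cnj (\<alpha>1 x u)) u v w
      - wedge21 (d1 (\<lambda>y u. cnj (\<alpha>1 y u)) x) (\<lambda>u. ?f x * \<alpha>1 x u) u v w
      + (wedge21 (d1 (\<lambda>y u. ?g y * \<alpha>2 y u) x) (\<lambda>u. cnj (\<alpha>2 x u)) u v w
      - wedge21 (d1 (\<lambda>y u. cnj (\<alpha>2 y u)) x) (\<lambda>u. ?g x * \<alpha>2 x u) u v w) = 0" for u v w
    using d2_d1[OF V x forms(3)]
    by (simp only: d2_add[OF V x] differentiable_wedge[OF V x] f cnj_\<alpha> d2_wedge[OF V x])
  have df: "\<partial> ?f x u = ?f x * (\<gamma> x u + cnj (\<gamma> x u))" for u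
  proof -
    have md: "m differentiable (at x)" "(\<lambda>y. cnj (m y)) differentiable (at x)"
      using smooth_m smooth_on_cnj[OF V smooth_m] x by (auto intro: smooth_on_differentiable)
    have "\<partial> ?f x u = k * \<partial> (\<lambda>y. m y * cnj (m y)) x u"
      by (rule dir_deriv_bounded_linear[OF bounded_linear_mult_right]) (intro differentiable_mult md)
    then show ?thesis
      by (simp add: dir_deriv_mult md dir_deriv_cnj dm[OF x] real algebra_simps)
  qed
  note E = E[unfolded d1_scale[OF V x sm(1) forms(1)] d1_scale[OF V x sm(2) forms(2)] df
      d1_cnj[OF V x forms(1)] d1_cnj[OF V x forms(2)]]
  note ev = wedge21_def wedge_def d\<alpha>1[OF x] d\<alpha>2[OF x] \<mu>_eq[OF x] dual[OF x] real
  have "\<i> * (k * (m x * cnj (m x) * (\<gamma> x (e3 x) + cnj (\<gamma> x (e3 x))))) = 0"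
    using E[of "e1 x" "e2 x" "e3 x"] by (simp add: ev algebra_simps) algebra
  then show "\<gamma> x (e3 x) + cnj (\<gamma> x (e3 x)) = 0" using m[OF x] k by simp
  have "\<i> * (k * (m x * cnj (m x) * (\<gamma> x (e4 x) + cnj (\<gamma> x (e4 x))))) = 0"
    using E[of "e1 x" "e2 x" "e4 x"] by (simp add: ev algebra_simps) algebra
  then show "\<gamma> x (e4 x) + cnj (\<gamma> x (e4 x)) = 0" using m[OF x] k by simp
qed

lemma empty: "x \<notin> V"
proof
  assume x: "x \<in> V"
  \<comment> \<open>The conjugate of \<gamma> + s ~\<alpha>2 - ~s \<alpha>2, taken because
    \<open>form_10\<close> is about (1,0)-forms.\<close>
  define h where "h y u = cnj (\<gamma> y u + \<beta> y u) - \<beta> y u" for y u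
  have f: "form1 V (\<lambda>y u. \<gamma> y u + \<beta> y u)" by (intro form1_add V form1_\<gamma> form1_\<beta>)
  have h: "form1 V h" unfolding h_def by (intro form1_diff form1_cnj V f form1_\<beta>)
  have dh: "d1 h y u v = 5 * \<i> * d1 A y u v" if y: "y \<in> V" for y u v
    unfolding h_def d1_diff[OF V y form1_cnj[OF V f] form1_\<beta>] d1_cnj[OF V y f]
      d1_add[OF V y form1_\<gamma> form1_\<beta>]
    by (simp add: d1_\<gamma>[OF y] d1_\<beta>[OF y] d1_real[OF y] algebra_simps)
  \<comment> \<open>\<gamma> is imaginary on e3 and e4, so the complex equation \<gamma>(e3) + \<i>
    \<gamma>(e4) = -2 s determines both values from the imaginary and real parts of s.\<close>
  have h34: "h y (e3 y) = 0" "h y (e4 y) = 0" if y: "y \<in> V" for y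
    using bianchi_A[OF y] bianchi_c(2)[OF y]
    by (simp_all add: h_def \<beta>_eq[OF y] dual[OF y] complex_eq_iff)
  have h12: "h y (e2 y) = \<i> * h y (e1 y)" if y: "y \<in> V" for y
    by (simp add: h_def \<beta>_eq[OF y] dual[OF y] \<gamma>12[OF y])
  have "h y (e1 y) = 0" if y: "y \<in> V" for y
  proof (rule form_10[OF h h12 _ y])
    show "part02 (e1 y) (e2 y) (e3 y) (e4 y) (d1 h y) = 0"
      by (simp add: part02_def dh[OF y] bianchi_\<alpha>1[OF y])
  qed (simp_all add: h34)
  then have "h y u = 0" if "y \<in> V" for y u
    using linear_expand_10[OF that form1_linear[OF h that] h12[OF that], of u] h34[OF that] that by simp
  then have "d1 h x = d1 (\<lambda>y u. 0) x" by (rule d1_cong[OF V x])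
  then have "d1 A x (e3 x) (e4 x) = 0" using dh[OF x, of "e3 x" "e4 x"] by (simp add: d1_def)
  then show False using bianchi_\<alpha>1(1)[OF x] c(2)[OF x] by simp
qed

end

text \<open>All the assumptions on the frame are local, so they restrict to the open set where m is
  non-zero, and \<open>empty\<close> rules out any point there.\<close>

lemma (in gray_frame) \<mu>_eq_0:
  assumes x: "x \<in> V"
  shows "\<mu> x u = 0"
proof (rule ccontr)
  assume "\<mu> x u \<noteq> 0"
  then have mx: "m x \<noteq> 0" using \<mu>_eq[OF x] by auto
  define W where "W = {y \<in> V. m y \<noteq> 0}"
  have "open W"
  proof -
    have "W = V \<inter> m -` (- {0})" by (auto simp: W_def)
    then show ?thesis using continuous_open_preimage[OF smooth_on_continuous[OF smooth_m] V, of "- {0}"] by auto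
  qed
  have WV: "W \<subseteq> V" by (auto simp: W_def)
  note V' = subsetD[OF WV]
  interpret W: gray_frame W e1 e2 e3 e4 \<alpha>1 \<alpha>2 A B \<mu> c
    by unfold_locales
      (rule \<open>open W\<close> smooth_e[THEN smooth_on_subset, OF WV] forms[THEN form1_subset, OF WV]
        c(1)[THEN smooth_on_subset, OF WV] c(2)[OF V'] real dual[OF V'] expand[OF V'] d\<alpha>1[OF V']
        d\<alpha>2[OF V'] gray_\<nu>[OF V'] gray_A[OF V'] gray_B[OF V'] gray_\<mu>[OF V'] | assumption)+
  have "W.m y = m y" for y by (simp add: W.m_def m_def)
  then interpret W: gray_frame_m W e1 e2 e3 e4 \<alpha>1 \<alpha>2 A B \<mu> c
    by unfold_locales (simp add: W_def)
  show False using W.empty x mx by (auto simp: W_def)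
qed

section \<open>Closedness and integrability of the opposite structure\<close>

context gray_frame
begin

text \<open>With \<mu> = 0 each of \<alpha>1 \<and> ~\<alpha>1 and \<alpha>2 \<and> ~\<alpha>2 is
  closed: the A and B terms cancel against their conjugates, and the c term meets a repeated
  ~\<alpha>1.\<close>

lemma opposite_form_closed:
  fixes w :: "4 local_bilin"
  assumes x: "x \<in> V"
    and w: "\<And>y u v. y \<in> V \<Longrightarrow> w y u v = Im (\<alpha>1 y u * cnj (\<alpha>1 y v)) - Im (\<alpha>2 y u * cnj (\<alpha>2 y v))"
  shows "ext_deriv w x u1 u2 u3 = 0"
proof -
  \<comment> \<open>Since z - cnj z = 2 \<i> Im z, the factor -\<i> / 2 turns \<alpha>1 \<and>
    ~\<alpha>1 into the imaginary part in \<open>w\<close>.\<close>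
  define k where "k = - \<i> / 2"
  have f: "form1 V (\<lambda>y u. k * \<alpha>1 y u)" "form1 V (\<lambda>y u. - k * \<alpha>2 y u)"
    by (intro form1_cmult V forms)+
  have w_eq: "complex_of_real (w y u v) = wedge (\<lambda>u. k * \<alpha>1 y u) (\<lambda>u. cnj (\<alpha>1 y u)) u v
      + wedge (\<lambda>u. - k * \<alpha>2 y u) (\<lambda>u. cnj (\<alpha>2 y u)) u v" if "y \<in> V" for y u v
    by (simp add: w[OF that] wedge_def k_def complex_eq_iff field_simps)
  have diff: "(\<lambda>y. w y u v) differentiable (at x)" for u v
  proof -
    have "smooth_on V (\<lambda>y. w y u v)"
      by (rule smooth_on_cong[OF V w[symmetric]], assumption)
        (intro smooth_on_diff smooth_on_Im smooth_on_mult smooth_on_cnj form1_smooth forms V)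
    then show ?thesis using x by (rule smooth_on_differentiable)
  qed
  have "complex_of_real (ext_deriv w x u1 u2 u3) = d2 (\<lambda>y u v. complex_of_real (w y u v)) x u1 u2 u3"
    by (simp add: ext_deriv_def d2_def dir_deriv_of_real diff)
  also have "\<dots> = d2 (\<lambda>y u v. wedge (\<lambda>u. k * \<alpha>1 y u) (\<lambda>u. cnj (\<alpha>1 y u)) u v
      + wedge (\<lambda>u. - k * \<alpha>2 y u) (\<lambda>u. cnj (\<alpha>2 y u)) u v) x u1 u2 u3"
    by (simp only: d2_cong[OF V x w_eq])
  also have "\<dots> = 0"
    unfolding d2_add[OF V x differentiable_wedge[OF V x f(1) cnj_\<alpha>(1)] differentiable_wedge[OF V x f(2) cnj_\<alpha>(2)]]
      d2_wedge[OF V x f(1) cnj_\<alpha>(1)] d2_wedge[OF V x f(2) cnj_\<alpha>(2)]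
      d1_cnj[OF V x forms(1)] d1_cnj[OF V x forms(2)] d1_cmult[OF V x forms(1)] d1_cmult[OF V x forms(2)]
    by (simp add: wedge21_def wedge_def d\<alpha>1[OF x] d\<alpha>2[OF x] \<mu>_eq_0[OF x] real algebra_simps)
  finally show ?thesis by simp
qed

end

text \<open>The right side is da (u + \<i> I u, v + \<i> I v), so the Nijenhuis tensor measures the
  (0,2) parts of the differentials of (1,0)-forms for I.\<close>

lemma form1_nijenhuis:
  fixes I :: "'n::finite local_endo"
  assumes V: "open V" "x \<in> V" and a: "form1 V a"
    and I: "\<And>y. y \<in> V \<Longrightarrow> linear (I y)" "\<And>v. smooth_on V (\<lambda>y. I y v)"
    and aI: "\<And>y u. y \<in> V \<Longrightarrow> a y (I y u) = \<i> * a y u"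
  shows "a x (nijenhuis I x u v) = d1 a x u v - d1 a x (I x u) (I x v)
    + \<i> * (d1 a x (I x u) v + d1 a x u (I x v))"
proof -
  have la: "linear (a x)" and lI: "linear (I x)" using form1_linear[OF a V(2)] I(1) V by auto
  have dI: "(\<lambda>y. I y v) differentiable (at x)" for v using I(2) V by (auto intro: smooth_on_differentiable)
  \<comment> \<open>Differentiating a (I v) = \<i> a (v) trades derivatives of I for derivatives of
    \<open>a\<close>.\<close>
  have key: "a x (\<partial> (\<lambda>y. I y v) x h) = \<i> * \<partial> (\<lambda>y. a y v) x h - \<partial> (\<lambda>y. a y (I x v)) x h" for v h
  proof -
    have "\<partial> (\<lambda>y. a y (I y v)) x h = \<partial> (\<lambda>y. a y (I x v)) x h + a x (\<partial> (\<lambda>y. I y v) x h)"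
      by (rule dir_deriv_linear_apply(2)[OF V form1_linear[OF a] form1_differentiable[OF a V(2)] dI])
    moreover have "\<partial> (\<lambda>y. a y (I y v)) x = \<partial> (\<lambda>y. \<i> * a y v) x"
      by (rule dir_deriv_cong[OF V aI])
    moreover have "\<partial> (\<lambda>y. \<i> * a y v) x h = \<i> * \<partial> (\<lambda>y. a y v) x h"
      by (rule dir_deriv_bounded_linear[OF bounded_linear_mult_right form1_differentiable[OF a V(2)]])
    ultimately show ?thesis by simp
  qed
  have N: "nijenhuis I x u v = \<partial> (\<lambda>y. I y v) x (I x u) - \<partial> (\<lambda>y. I y u) x (I x v)
      + I x (\<partial> (\<lambda>y. I y u) x v) - I x (\<partial> (\<lambda>y. I y v) x u)"
    by (simp add: nijenhuis_def lie_bracket_def linear_neg[OF lI])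
  show ?thesis
    unfolding N by (simp add: linear_add[OF la] linear_diff[OF la] aI[OF V(2)] key d1_def algebra_simps)
qed

text \<open>The (1,0)-forms of I are spanned by ~\<alpha>1 and \<alpha>2. Once \<mu> = 0, the term
  of d~\<alpha>1 with coefficient ~c, whose conjugate obstructs J, is ~c \<alpha>1 \<and> \<alpha>2,
  which has type (1,1) for I.\<close>

lemma (in gray_frame) opposite_integrable:
  assumes x: "x \<in> V"
    and I: "\<And>y. y \<in> V \<Longrightarrow> linear (I y)" "\<And>v. smooth_on V (\<lambda>y. I y v)"
    and aI: "\<And>y u. y \<in> V \<Longrightarrow> \<alpha>1 y (I y u) = - \<i> * \<alpha>1 y u" "\<And>y u. y \<in> V \<Longrightarrow> \<alpha>2 y (I y u) = \<i> * \<alpha>2 y u"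
  shows "nijenhuis I x u v = 0"
proof -
  have "cnj (\<alpha>1 x (nijenhuis I x u v)) = 0"
    using form1_nijenhuis[OF V x cnj_\<alpha>(1) I, of u v] aI(1)
    by (simp add: d1_cnj[OF V x forms(1)] d\<alpha>1[OF x] \<mu>_eq_0[OF x] real wedge_def aI[OF x] algebra_simps)
  then have "\<alpha>1 x (nijenhuis I x u v) = 0" by simp
  moreover have "\<alpha>2 x (nijenhuis I x u v) = 0"
    using form1_nijenhuis[OF V x forms(2) I, of u v] aI(2)
    by (simp add: d\<alpha>2[OF x] \<mu>_eq_0[OF x] wedge_def aI[OF x] algebra_simps)
  ultimately show ?thesis using expand[OF x, of "nijenhuis I x u v"] by simp
qed

section \<open>The Levi-Civita connection in a chart\<close>

lemma linear_dir_deriv_parameter: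
  fixes F :: "'e::euclidean_space \<Rightarrow> 'h::real_vector \<Rightarrow> 'f::real_normed_vector"
  assumes S: "open S" "x \<in> S" and F: "\<And>y. y \<in> S \<Longrightarrow> linear (F y)" "\<And>v. (\<lambda>y. F y v) differentiable (at x)"
  shows "linear (\<lambda>v. \<partial> (\<lambda>y. F y v) x u)"
proof (rule linearI)
  show "\<partial> (\<lambda>y. F y (a + b)) x u = \<partial> (\<lambda>y. F y a) x u + \<partial> (\<lambda>y. F y b) x u" for a b
    using dir_deriv_cong[OF S, of "\<lambda>y. F y (a + b)" "\<lambda>y. F y a + F y b"] F
    by (simp add: linear_add dir_deriv_add)
  show "\<partial> (\<lambda>y. F y (r *\<^sub>R a)) x u = r *\<^sub>R \<partial> (\<lambda>y. F y a) x u" for r a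
    using dir_deriv_cong[OF S, of "\<lambda>y. F y (r *\<^sub>R a)" "\<lambda>y. r *\<^sub>R F y a"] F
    by (simp add: linear_scale dir_deriv_bounded_linear[OF bounded_linear_scaleR_right])
qed

lemma smooth_on_vec:
  fixes f :: "'n::finite \<Rightarrow> 'e::euclidean_space \<Rightarrow> real"
  assumes "open S" "\<And>i. smooth_on S (f i)"
  shows "smooth_on S (\<lambda>x. \<chi> i. f i x)"
proof (rule smooth_on_cong[OF assms(1)])
  show "smooth_on S (\<lambda>x. \<Sum>i\<in>UNIV. f i x *\<^sub>R (axis i 1 :: real ^ 'n))"
    by (intro smooth_on_sum smooth_on_scaleR smooth_on_const assms)
  show "(\<Sum>i\<in>UNIV. f i x *\<^sub>R (axis i 1 :: real ^ 'n)) = (\<chi> i. f i x)" for x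
    using basis_expansion[of "\<chi> i. f i x"] by (simp add: scalar_mult_eq_scaleR)
qed

lemma smooth_on_det:
  fixes M :: "'e::euclidean_space \<Rightarrow> real ^ 'n::finite ^ 'n"
  assumes "open S" "\<And>i j. smooth_on S (\<lambda>x. M x $ i $ j)"
  shows "smooth_on S (\<lambda>x. det (M x))"
  unfolding det_def
  by (intro smooth_on_sum smooth_on_mult smooth_on_prod smooth_on_const assms)

locale metric_chart =
  fixes S :: "(real ^ 'n::finite) set" and g :: "'n local_bilin"
  assumes S: "open S"
    and bilinear_g: "\<And>x. x \<in> S \<Longrightarrow> bilinear (g x)"
    and smooth_g: "\<And>u v. smooth_on S (\<lambda>x. g x u v)"
    and sym_g: "\<And>x u v. x \<in> S \<Longrightarrow> g x u v = g x v u"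
    and pos_g: "\<And>x v. x \<in> S \<Longrightarrow> v \<noteq> 0 \<Longrightarrow> g x v v > 0"
begin

lemma linear_g: "x \<in> S \<Longrightarrow> linear (g x u)" "x \<in> S \<Longrightarrow> linear (\<lambda>u. g x u v)"
  using bilinear_g by (auto simp: bilinear_def)

lemma g_simps:
  assumes "x \<in> S"
  shows "g x (a + b) v = g x a v + g x b v" "g x u (a + b) = g x u a + g x u b"
    "g x (a - b) v = g x a v - g x b v" "g x u (a - b) = g x u a - g x u b"
    "g x (- a) v = - g x a v" "g x u (- a) = - g x u a"
    "g x (r *\<^sub>R a) v = r * g x a v" "g x u (r *\<^sub>R a) = r * g x u a"
    "g x 0 v = 0" "g x u 0 = 0"
  using linear_g(1)[OF assms, of u, THEN linear_add] linear_g(2)[OF assms, of v, THEN linear_add]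
    linear_g(1)[OF assms, of u, THEN linear_diff] linear_g(2)[OF assms, of v, THEN linear_diff]
    linear_g(1)[OF assms, of u, THEN linear_neg] linear_g(2)[OF assms, of v, THEN linear_neg]
    linear_g(1)[OF assms, of u, THEN linear_scale] linear_g(2)[OF assms, of v, THEN linear_scale]
    linear_g(1)[OF assms, of u, THEN linear_0] linear_g(2)[OF assms, of v, THEN linear_0]
  by auto

lemma differentiable_g: "x \<in> S \<Longrightarrow> (\<lambda>y. g y u v) differentiable (at x)"
  by (rule smooth_on_differentiable[OF smooth_g])

lemma g_eqI:
  assumes "x \<in> S" "\<And>w. g x a w = g x b w"
  shows "a = b"
  using assms(2)[of "a - b"] pos_g[OF assms(1), of "a - b"] by (auto simp: g_simps[OF assms(1)])

lemma smooth_g_apply: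
  assumes "open V" "V \<subseteq> S" "smooth_on V W" "smooth_on V Z"
  shows "smooth_on V (\<lambda>x. g x (W x) (Z x))"
proof -
  have "smooth_on V (\<lambda>x. g x u (Z x))" for u
    by (rule smooth_on_linear_apply[OF assms(1) linear_g(1) smooth_on_subset[OF smooth_g assms(2)] assms(4)])
      (use assms(2) in auto)
  then show ?thesis
    using assms(2) linear_g(2)
    by (intro smooth_on_linear_apply[OF assms(1) _ _ assms(3), where F = "\<lambda>x u. g x u (Z x)"]) auto
qed

text \<open>Smoothness of the raised field comes from Cramer's rule.\<close>

lemma raise_index:
  assumes L: "\<And>x. x \<in> S \<Longrightarrow> linear (L x)" "\<And>w. smooth_on S (\<lambda>x. L x w)"
  obtains \<xi> where "smooth_on S \<xi>" "\<And>x w. x \<in> S \<Longrightarrow> g x (\<xi> x) w = L x w"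
proof -
  define G where "G x = (\<chi> i j. g x (axis j 1) (axis i 1))" for x
  define b where "b x = (\<chi> i. L x (axis i 1))" for x
  define M where "M k x = (\<chi> i j. if j = k then b x $ i else G x $ i $ j)" for k x
  define \<xi> where "\<xi> x = (\<chi> k. inverse (det (G x)) * det (M k x))" for x
  have ex: "z = (\<Sum>i\<in>UNIV. z $ i *\<^sub>R axis i 1)" for z :: "real ^ 'n"
    using basis_expansion[of z] by (simp add: scalar_mult_eq_scaleR)
  have Gz: "(G x *v z) $ i = g x z (axis i 1)" if "x \<in> S" for x z i
    by (subst (2) ex)
      (simp add: G_def matrix_vector_mult_def linear_sum[OF linear_g(2)[OF that]] linear_scale[OF linear_g(2)[OF that]] mult.commute)
  have eq: "g x z w = L x w" if "x \<in> S" "G x *v z = b x" for x z w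
  proof -
    have "g x z (axis i 1) = L x (axis i 1)" for i
      using Gz[OF that(1), of z i] that(2) by (simp add: b_def)
    then show ?thesis
      by (subst (1 2) ex)
        (simp add: linear_sum[OF linear_g(1)[OF that(1)]] linear_scale[OF linear_g(1)[OF that(1)]]
          linear_sum[OF L(1)[OF that(1)]] linear_scale[OF L(1)[OF that(1)]])
  qed
  have det: "det (G x) \<noteq> 0" if "x \<in> S" for x
  proof -
    have "z = 0" if z: "G x *v z = 0" for z
    proof (rule g_eqI[OF \<open>x \<in> S\<close>])
      have "g x z (axis i 1) = 0" for i using Gz[OF \<open>x \<in> S\<close>, of z i] z by simp
      then show "g x z w = g x 0 w" for w
        by (subst ex[of w])
          (simp add: linear_sum[OF linear_g(1)[OF \<open>x \<in> S\<close>]] linear_scale[OF linear_g(1)[OF \<open>x \<in> S\<close>]] g_simps[OF \<open>x \<in> S\<close>])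
    qed
    then have "\<exists>B. B ** G x = mat 1" by (auto simp: matrix_left_invertible_ker)
    then show ?thesis by (simp add: invertible_left_inverse invertible_det_nz[symmetric])
  qed
  have "G x *v \<xi> x = b x" if "x \<in> S" for x
    using cramer[OF det[OF that], of "\<xi> x" "b x"] by (simp add: \<xi>_def M_def divide_inverse mult.commute)
  then have "g x (\<xi> x) w = L x w" if "x \<in> S" for x w using that eq by blast
  moreover have "smooth_on S \<xi>"
  proof -
    have G: "smooth_on S (\<lambda>x. G x $ i $ j)" for i j by (simp add: G_def smooth_g)
    have "smooth_on S (\<lambda>x. M k x $ i $ j)" for k i j
      by (cases "j = k") (use G L(2) in \<open>simp_all add: M_def b_def\<close>)
    then show ?thesis
      unfolding \<xi>_def by (intro smooth_on_vec smooth_on_mult smooth_on_inverse smooth_on_det S G det)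
  qed
  ultimately show ?thesis using that by blast
qed

abbreviation "\<Gamma> \<equiv> christoffel g"

lemma koszul:
  assumes "x \<in> S"
  shows "2 * g x (\<Gamma> x u v) w =
     \<partial> (\<lambda>y. g y v w) x u + \<partial> (\<lambda>y. g y u w) x v - \<partial> (\<lambda>y. g y u v) x w"
  by (rule christoffel_koszul[OF S assms bilinear_g differentiable_g[OF assms] pos_g[OF assms] sym_g])

lemma dg_sym: "x \<in> S \<Longrightarrow> \<partial> (\<lambda>y. g y u v) x = \<partial> (\<lambda>y. g y v u) x"
  by (rule dir_deriv_cong[OF S]) (auto intro: sym_g)

lemma christoffel_sym: "x \<in> S \<Longrightarrow> \<Gamma> x u v = \<Gamma> x v u"
proof (rule g_eqI)
  show "g x (\<Gamma> x u v) w = g x (\<Gamma> x v u) w" if "x \<in> S" for w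
    using koszul[OF that, of u v w] koszul[OF that, of v u w] dg_sym[OF that, of u v] by simp
qed

lemma linear_christoffel:
  assumes x: "x \<in> S"
  shows "linear (\<Gamma> x u)" "linear (\<lambda>u. \<Gamma> x u v)"
proof -
  have l1: "linear (\<lambda>v. \<partial> (\<lambda>y. g y v w) x h)" for w h
    by (rule linear_dir_deriv_parameter[OF S x linear_g(2) differentiable_g[OF x]])
  have l2: "linear (\<lambda>v. \<partial> (\<lambda>y. g y u v) x h)" for u h
    by (rule linear_dir_deriv_parameter[OF S x linear_g(1) differentiable_g[OF x]])
  have l3: "linear (\<partial> (\<lambda>y. g y u w) x)" for u w by (rule linear_dir_deriv[OF differentiable_g[OF x]])
  show l: "linear (\<Gamma> x u)" for u
  proof (rule linearI)
    show "\<Gamma> x u (a + b) = \<Gamma> x u a + \<Gamma> x u b" for a b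
    proof (rule g_eqI[OF x])
      fix w
      have "2 * g x (\<Gamma> x u (a + b)) w = 2 * g x (\<Gamma> x u a) w + 2 * g x (\<Gamma> x u b) w"
        unfolding koszul[OF x] by (simp add: linear_add[OF l1] linear_add[OF l2] linear_add[OF l3])
      then show "g x (\<Gamma> x u (a + b)) w = g x (\<Gamma> x u a + \<Gamma> x u b) w"
        by (simp add: g_simps[OF x])
    qed
    show "\<Gamma> x u (r *\<^sub>R a) = r *\<^sub>R \<Gamma> x u a" for r a
    proof (rule g_eqI[OF x])
      fix w
      have "2 * g x (\<Gamma> x u (r *\<^sub>R a)) w = r * (2 * g x (\<Gamma> x u a) w)"
        unfolding koszul[OF x]
        by (simp add: linear_scale[OF l1] linear_scale[OF l2] linear_scale[OF l3] algebra_simps)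
      then show "g x (\<Gamma> x u (r *\<^sub>R a)) w = g x (r *\<^sub>R \<Gamma> x u a) w"
        by (simp add: g_simps[OF x])
    qed
  qed
  have "(\<lambda>u. \<Gamma> x u v) = \<Gamma> x v" using christoffel_sym[OF x] by blast
  then show "linear (\<lambda>u. \<Gamma> x u v)" using l by simp
qed

text \<open>The definition by unique existence says nothing about dependence on the point. The
  Koszul formula makes the lowered field smooth, and \<open>raise_index\<close> returns a smooth
  field that must coincide with it.\<close>

lemma smooth_christoffel: "smooth_on S (\<lambda>x. \<Gamma> x u v)"
proof -
  have "smooth_on S (\<lambda>x. g x (\<Gamma> x u v) w)" for w
  proof (rule smooth_on_cong[OF S])
    show "smooth_on S (\<lambda>x. 1 / 2 * (\<partial> (\<lambda>y. g y v w) x u + \<partial> (\<lambda>y. g y u w) x v - \<partial> (\<lambda>y. g y u v) x w))"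
      by (intro smooth_on_mult smooth_on_const smooth_on_diff smooth_on_add smooth_on_dir_deriv smooth_g S)
    show "1 / 2 * (\<partial> (\<lambda>y. g y v w) x u + \<partial> (\<lambda>y. g y u w) x v - \<partial> (\<lambda>y. g y u v) x w) = g x (\<Gamma> x u v) w"
      if "x \<in> S" for x using koszul[OF that, of u v w] by simp
  qed
  then obtain \<xi> where \<xi>: "smooth_on S \<xi>" "\<And>x w. x \<in> S \<Longrightarrow> g x (\<xi> x) w = g x (\<Gamma> x u v) w"
    using raise_index[where L = "\<lambda>x. g x (\<Gamma> x u v)", OF linear_g(1)] by blast
  show ?thesis by (rule smooth_on_cong[OF S _ \<xi>(1)]) (use \<xi>(2) in \<open>auto intro: g_eqI\<close>)
qed

lemma dg:
  assumes x: "x \<in> S"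
  shows "\<partial> (\<lambda>y. g y v w) x u = g x (\<Gamma> x u v) w + g x v (\<Gamma> x u w)"
  using koszul[OF x, of u v w] koszul[OF x, of u w v] sym_g[OF x, of v "\<Gamma> x u w"]
    dg_sym[OF x, of v w] by simp

lemma nabla_const: "nabla g (\<lambda>_. u) W x = \<partial> W x u + \<Gamma> x u (W x)"
  by (simp add: nabla_def)

lemma metric_compatible:
  assumes x: "x \<in> S" and W: "W differentiable (at x)" and Z: "Z differentiable (at x)"
  shows "\<partial> (\<lambda>y. g y (W y) (Z y)) x u
    = g x (nabla g (\<lambda>_. u) W x) (Z x) + g x (W x) (nabla g (\<lambda>_. u) Z x)"
proof -
  note Z' = dir_deriv_linear_apply[OF S x linear_g(1) differentiable_g[OF x] Z]
  have "\<partial> (\<lambda>y. g y (W y) (Z y)) x u = \<partial> (\<lambda>y. g y (W x) (Z y)) x u + g x (\<partial> W x u) (Z x)"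
  proof (rule dir_deriv_linear_apply(2)[OF S x, where F = "\<lambda>y v. g y v (Z y)"])
    show "linear (\<lambda>v. g y v (Z y))" if "y \<in> S" for y using linear_g(2)[OF that] .
    show "(\<lambda>y. g y v (Z y)) differentiable at x" for v by (rule Z'(1))
  qed (rule W)
  then show ?thesis
    by (simp add: Z'(2) dg[OF x] nabla_const g_simps[OF x])
qed

lemma smooth_nabla:
  assumes "open V" "V \<subseteq> S" "smooth_on V W"
  shows "smooth_on V (nabla g (\<lambda>_. u) W)"
proof -
  have "smooth_on V (\<lambda>x. \<partial> W x u + \<Gamma> x u (W x))"
    by (intro smooth_on_add assms smooth_on_dir_deriv
        smooth_on_linear_apply[OF assms(1) linear_christoffel(1) smooth_on_subset[OF smooth_christoffel assms(2)]])
      (use assms in auto)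
  moreover have "nabla g (\<lambda>_. u) W = (\<lambda>x. \<partial> W x u + \<Gamma> x u (W x))" by (auto simp: nabla_const)
  ultimately show ?thesis by simp
qed

lemma linear_nabla:
  assumes x: "x \<in> S" and W: "W differentiable (at x)"
  shows "linear (\<lambda>u. nabla g (\<lambda>_. u) W x)"
  unfolding nabla_const
  by (intro linear_compose_add linear_dir_deriv[OF W, unfolded eta_contract_eq] linear_christoffel(2)[OF x])

section \<open>Curvature on constant fields and its tensoriality\<close>

lemma curvature_const:
  assumes x: "x \<in> S"
  shows "curvature g (\<lambda>_. u) (\<lambda>_. v) (\<lambda>_. w) x = \<partial> (\<lambda>y. \<Gamma> y v w) x u + \<Gamma> x u (\<Gamma> x v w)
      - (\<partial> (\<lambda>y. \<Gamma> y u w) x v + \<Gamma> x v (\<Gamma> x u w))"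
proof -
  have "nabla g (\<lambda>_. v) (\<lambda>_. w) = (\<lambda>y. \<Gamma> y v w)" for v w by (auto simp: nabla_const)
  then show ?thesis
    by (simp add: curvature_def nabla_def lie_bracket_def linear_0[OF linear_christoffel(2)[OF x]])
qed

text \<open>Signs are all the multilinearity required, because J maps the frame to itself up to
  sign.\<close>

lemma riemann_minus:
  assumes x: "x \<in> S"
  shows "riemann g x (- u) v w z = - riemann g x u v w z" "riemann g x u (- v) w z = - riemann g x u v w z"
    "riemann g x u v (- w) z = - riemann g x u v w z" "riemann g x u v w (- z) = - riemann g x u v w z"
proof -
  have d: "(\<lambda>y. \<Gamma> y v w) differentiable (at x)" for v w
    by (rule smooth_on_differentiable[OF smooth_christoffel x])
  have l1: "linear (\<lambda>v. \<partial> (\<lambda>y. \<Gamma> y v w) x h)" for w h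
    by (rule linear_dir_deriv_parameter[OF S x linear_christoffel(2) d])
  have l2: "linear (\<lambda>v. \<partial> (\<lambda>y. \<Gamma> y u v) x h)" for u h
    by (rule linear_dir_deriv_parameter[OF S x linear_christoffel(1) d])
  note n = linear_neg[OF l1] linear_neg[OF l2] linear_neg[OF linear_dir_deriv[OF d]]
    linear_neg[OF linear_christoffel(1)[OF x]] linear_neg[OF linear_christoffel(2)[OF x]]
  show "riemann g x (- u) v w z = - riemann g x u v w z" "riemann g x u (- v) w z = - riemann g x u v w z"
    "riemann g x u v (- w) z = - riemann g x u v w z" "riemann g x u v w (- z) = - riemann g x u v w z"
    by (simp_all add: riemann_def curvature_const[OF x] n g_simps[OF x])
qed

text \<open>\<open>riemann\<close> is defined through constant fields whereas frame fields vary. The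
  first derivatives of \<open>W\<close> occur symmetrically in \<open>u\<close> and
  \<open>v\<close>, and its second derivatives commute, so only the value of \<open>W\<close>
  remains.\<close>

lemma curvature_commutator:
  assumes V: "open V" "V \<subseteq> S" "x \<in> V" and W: "smooth_on V W"
  shows "nabla g (\<lambda>_. u) (nabla g (\<lambda>_. v) W) x - nabla g (\<lambda>_. v) (nabla g (\<lambda>_. u) W) x
    = curvature g (\<lambda>_. u) (\<lambda>_. v) (\<lambda>_. W x) x"
proof -
  have x: "x \<in> S" using V by auto
  have W': "W differentiable (at x)" using W V(3) by (rule smooth_on_differentiable)
  have \<Gamma>d: "(\<lambda>y. \<Gamma> y v w) differentiable (at x)" for v w
    by (rule smooth_on_differentiable[OF smooth_christoffel x])
  note ap = dir_deriv_linear_apply[OF S x linear_christoffel(1) \<Gamma>d W']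
  have d2W: "(\<lambda>y. \<partial> W y v) differentiable (at x)" for v
    by (rule smooth_on_differentiable[OF smooth_on_dir_deriv[OF W] V(3)])
  have nn: "nabla g (\<lambda>_. u) (nabla g (\<lambda>_. v) W) x = \<partial> (\<lambda>y. \<partial> W y v) x u + \<partial> (\<lambda>y. \<Gamma> y v (W x)) x u
      + \<Gamma> x v (\<partial> W x u) + \<Gamma> x u (\<partial> W x v) + \<Gamma> x u (\<Gamma> x v (W x))" for u v
  proof -
    have "nabla g (\<lambda>_. v) W = (\<lambda>y. \<partial> W y v + \<Gamma> y v (W y))" by (auto simp: nabla_const)
    then show ?thesis
      by (simp add: nabla_const dir_deriv_add[OF d2W ap(1)] ap(2) linear_add[OF linear_christoffel(1)[OF x]])
  qed
  show ?thesis
    unfolding nn curvature_const[OF x] using dir_deriv_commute[OF V(1,3) W, of u v] by simp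
qed

end

section \<open>Almost Kaehler structures in a chart\<close>

text \<open>\<open>J_alt\<close> is the alternating property of \<Omega> after substituting its
  expression by g and J; skewness and orthogonality of J are derived from it.\<close>

locale ak_chart = metric_chart S g for S :: "(real ^ 4) set" and g :: "4 local_bilin" +
  fixes J :: "4 local_endo"
  assumes linear_J: "\<And>x. x \<in> S \<Longrightarrow> linear (J x)"
    and smooth_J: "\<And>v. smooth_on S (\<lambda>x. J x v)"
    and J_J: "\<And>x v. x \<in> S \<Longrightarrow> J x (J x v) = - v"
    and J_alt: "\<And>x v. x \<in> S \<Longrightarrow> g x (J x v) v = 0"
    and closed_\<Omega>: "\<And>x u v w. x \<in> S \<Longrightarrow> ext_deriv (\<lambda>y u v. g y (J y u) v) x u v w = 0"
    and gray: "\<And>x u v w z. x \<in> S \<Longrightarrow>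
      riemann g x u v w z = riemann g x (J x u) (J x v) (J x w) (J x z)"
begin

lemma J_simps:
  assumes "x \<in> S"
  shows "J x (a + b) = J x a + J x b" "J x (a - b) = J x a - J x b" "J x (- a) = - J x a"
    "J x (r *\<^sub>R a) = r *\<^sub>R J x a" "J x 0 = 0"
  using linear_J[OF assms] by (simp_all add: linear_add linear_diff linear_neg linear_scale linear_0)

lemma J_skew: "x \<in> S \<Longrightarrow> g x (J x u) v = - g x u (J x v)"
  using J_alt[of x "u + v"] J_alt[of x u] J_alt[of x v] sym_g[of x "J x v" u]
  by (simp add: J_simps g_simps)

lemma J_orth: "x \<in> S \<Longrightarrow> g x (J x u) (J x v) = g x u v"
  by (simp add: J_skew J_J g_simps)

lemma differentiable_J: "x \<in> S \<Longrightarrow> (\<lambda>y. J y v) differentiable (at x)"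
  by (rule smooth_on_differentiable[OF smooth_J])

lemma smooth_J_apply: "open V \<Longrightarrow> V \<subseteq> S \<Longrightarrow> smooth_on V W \<Longrightarrow> smooth_on V (\<lambda>x. J x (W x))"
  by (rule smooth_on_linear_apply[OF _ linear_J smooth_on_subset[OF smooth_J]]) auto

lemma nabla_J:
  assumes x: "x \<in> S" and W: "W differentiable (at x)"
  shows "nabla g (\<lambda>_. u) (\<lambda>y. J y (W y)) x = nabla_endo g J x u (W x) + J x (nabla g (\<lambda>_. u) W x)"
  using dir_deriv_linear_apply(2)[OF S x linear_J differentiable_J[OF x] W, of u]
  by (simp add: nabla_endo_def nabla_const J_simps[OF x])

lemma nabla_endo_eq:
  "nabla_endo g J x u w = \<partial> (\<lambda>y. J y w) x u + \<Gamma> x u (J x w) - J x (\<Gamma> x u w)"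
  by (simp add: nabla_endo_def nabla_const)

lemma linear_nabla_endo:
  assumes x: "x \<in> S"
  shows "linear (\<lambda>u. nabla_endo g J x u w)" "linear (nabla_endo g J x u)"
proof -
  show "linear (\<lambda>u. nabla_endo g J x u w)"
    unfolding nabla_endo_eq
    using linear_dir_deriv[OF differentiable_J[OF x]] linear_christoffel[OF x]
    by (intro linearI) (simp_all add: linear_add linear_scale J_simps[OF x] algebra_simps
        linear_add[OF linear_christoffel(2)[OF x]] linear_scale[OF linear_christoffel(2)[OF x]])
  note l = linear_dir_deriv_parameter[OF S x linear_J differentiable_J[OF x]]
  show "linear (nabla_endo g J x u)"
    unfolding nabla_endo_eq[abs_def]
    using linear_christoffel(1)[OF x]
    by (intro linearI) (simp_all add: linear_add[OF l] linear_scale[OF l] linear_add linear_scale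
        J_simps[OF x] algebra_simps)
qed

lemma smooth_nabla_endo: "smooth_on S (\<lambda>x. nabla_endo g J x u w)"
  unfolding nabla_endo_eq
  by (intro smooth_on_add smooth_on_diff smooth_on_dir_deriv smooth_J S smooth_christoffel
      smooth_on_linear_apply[OF S linear_christoffel(1) smooth_christoffel]
      smooth_on_linear_apply[OF S linear_J smooth_J])

text \<open>This is the covariant derivative of J^2 = -1.\<close>

lemma nabla_endo_anticommute:
  assumes x: "x \<in> S"
  shows "nabla_endo g J x u (J x w) = - J x (nabla_endo g J x u w)"
proof -
  have "\<partial> (\<lambda>y. J y (J y w)) x = \<partial> (\<lambda>y. - w) x"
    by (rule dir_deriv_cong[OF S x]) (simp add: J_J)
  then have "\<partial> (\<lambda>y. J y (J x w)) x u = - J x (\<partial> (\<lambda>y. J y w) x u)"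
    using dir_deriv_linear_apply(2)[OF S x linear_J differentiable_J[OF x] differentiable_J[OF x], of w u]
    by (simp add: eq_neg_iff_add_eq_0)
  then show ?thesis
    by (simp add: nabla_endo_eq J_J[OF x] J_simps[OF x] linear_neg[OF linear_christoffel(1)[OF x]])
qed

lemma d\<Omega>:
  assumes x: "x \<in> S"
  shows "\<partial> (\<lambda>y. g y (J y v) w) x u = g x (nabla_endo g J x u v) w
    - g x (\<Gamma> x u v) (J x w) + g x (\<Gamma> x u w) (J x v)"
  using metric_compatible[OF x differentiable_J[OF x] differentiable_const, of v w u]
    sym_g[OF x, of "J x v" "\<Gamma> x u w"] J_skew[OF x, of "\<Gamma> x u v" w]
  by (simp add: nabla_endo_eq nabla_const g_simps[OF x])

lemma nabla_endo_skew:
  assumes x: "x \<in> S"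
  shows "g x (nabla_endo g J x u v) w = - g x (nabla_endo g J x u w) v"
proof -
  have "\<partial> (\<lambda>y. g y (J y v) w) x u = \<partial> (\<lambda>y. - g y (J y w) v) x u"
    by (rule fun_cong[OF dir_deriv_cong[OF S x]]) (metis J_skew sym_g)
  also have "\<dots> = - \<partial> (\<lambda>y. g y (J y w) v) x u"
    using smooth_on_differentiable[OF smooth_g_apply[OF S _ smooth_J smooth_on_const] x]
    by (intro dir_deriv_bounded_linear[OF bounded_linear_minus[OF bounded_linear_ident]]) auto
  finally show ?thesis
    by (simp add: d\<Omega>[OF x])
qed

text \<open>In the cyclic sum of \<open>d\<Omega>\<close> the Christoffel terms cancel by the
  symmetry of \<Gamma>.\<close>

lemma nabla_endo_cyclic:
  assumes x: "x \<in> S"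
  shows "g x (nabla_endo g J x u v) w + g x (nabla_endo g J x v w) u + g x (nabla_endo g J x w u) v = 0"
  using closed_\<Omega>[OF x, of u v w] christoffel_sym[OF x, of u v] christoffel_sym[OF x, of v w]
    christoffel_sym[OF x, of w u]
  by (simp add: ext_deriv_def d\<Omega>[OF x])

end

section \<open>Unitary frames and the components of the derivative of J\<close>

lemma open_positive_set:
  fixes f :: "'e::euclidean_space \<Rightarrow> real"
  assumes "open S" "smooth_on S f"
  shows "open {x \<in> S. f x > 0}"
proof -
  have "{x \<in> S. f x > 0} = S \<inter> f -` {0<..}" by auto
  then show ?thesis using continuous_open_preimage[OF smooth_on_continuous[OF assms(2)] assms(1), of "{0<..}"] by simp
qed

locale ak_frame = ak_chart +
  fixes V :: "(real ^ 4) set" and e1 e3 :: "real ^ 4 \<Rightarrow> real ^ 4"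
  assumes V: "open V" "V \<subseteq> S" and smooth_e1: "smooth_on V e1" and smooth_e3: "smooth_on V e3"
    and unit: "\<And>x. x \<in> V \<Longrightarrow> g x (e1 x) (e1 x) = 1" "\<And>x. x \<in> V \<Longrightarrow> g x (e3 x) (e3 x) = 1"
    and orthogonal: "\<And>x. x \<in> V \<Longrightarrow> g x (e1 x) (e3 x) = 0" "\<And>x. x \<in> V \<Longrightarrow> g x (J x (e1 x)) (e3 x) = 0"
begin

definition "e2 x = J x (e1 x)"
definition "e4 x = J x (e3 x)"

lemma V_S: "x \<in> V \<Longrightarrow> x \<in> S" using V by auto

lemma smooth_e: "smooth_on V e1" "smooth_on V e2" "smooth_on V e3" "smooth_on V e4"
  unfolding e2_def[abs_def] e4_def[abs_def] by (intro smooth_J_apply V smooth_e1 smooth_e3)+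

lemma differentiable_e:
  assumes "x \<in> V"
  shows "e1 differentiable (at x)" "e2 differentiable (at x)" "e3 differentiable (at x)" "e4 differentiable (at x)"
  using smooth_e assms by (auto intro: smooth_on_differentiable)

lemma J_e:
  assumes "x \<in> V"
  shows "J x (e1 x) = e2 x" "J x (e2 x) = - e1 x" "J x (e3 x) = e4 x" "J x (e4 x) = - e3 x"
  using V_S[OF assms] by (simp_all add: e2_def e4_def J_J)

lemma orthonormal:
  assumes "x \<in> V"
  shows "g x (e1 x) (e1 x) = 1" "g x (e1 x) (e2 x) = 0" "g x (e1 x) (e3 x) = 0" "g x (e1 x) (e4 x) = 0"
    "g x (e2 x) (e1 x) = 0" "g x (e2 x) (e2 x) = 1" "g x (e2 x) (e3 x) = 0" "g x (e2 x) (e4 x) = 0"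
    "g x (e3 x) (e1 x) = 0" "g x (e3 x) (e2 x) = 0" "g x (e3 x) (e3 x) = 1" "g x (e3 x) (e4 x) = 0"
    "g x (e4 x) (e1 x) = 0" "g x (e4 x) (e2 x) = 0" "g x (e4 x) (e3 x) = 0" "g x (e4 x) (e4 x) = 1"
proof -
  note x = V_S[OF assms]
  show 1: "g x (e1 x) (e1 x) = 1" "g x (e2 x) (e1 x) = 0" "g x (e2 x) (e2 x) = 1" "g x (e1 x) (e3 x) = 0"
    "g x (e2 x) (e3 x) = 0" "g x (e3 x) (e3 x) = 1" "g x (e4 x) (e3 x) = 0" "g x (e4 x) (e4 x) = 1"
    "g x (e2 x) (e4 x) = 0"
    using unit[OF assms] orthogonal[OF assms] by (simp_all add: e2_def e4_def J_alt[OF x] J_orth[OF x])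
  show 2: "g x (e1 x) (e4 x) = 0"
    using J_skew[OF x, of "e1 x" "e3 x"] 1 by (simp add: e2_def e4_def)
  show "g x (e1 x) (e2 x) = 0" "g x (e3 x) (e1 x) = 0" "g x (e3 x) (e2 x) = 0" "g x (e3 x) (e4 x) = 0"
    "g x (e4 x) (e1 x) = 0" "g x (e4 x) (e2 x) = 0"
    using 1 2 sym_g[OF x] by metis+
qed

lemma frame_expand:
  assumes "x \<in> V"
  shows "u = g x u (e1 x) *\<^sub>R e1 x + g x u (e2 x) *\<^sub>R e2 x + g x u (e3 x) *\<^sub>R e3 x + g x u (e4 x) *\<^sub>R e4 x"
proof -
  note x = V_S[OF assms]
  define f where "f a = a $ 1 *\<^sub>R e1 x + a $ 2 *\<^sub>R e2 x + a $ 3 *\<^sub>R e3 x + a $ 4 *\<^sub>R e4 x" for a :: "real ^ 4"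
  have l: "linear f" by (intro linearI) (simp_all add: f_def algebra_simps)
  have c: "g x (f a) (e1 x) = a $ 1" "g x (f a) (e2 x) = a $ 2" "g x (f a) (e3 x) = a $ 3" "g x (f a) (e4 x) = a $ 4" for a
    by (simp_all add: f_def g_simps[OF x] orthonormal[OF assms])
  have "inj f"
    unfolding linear_injective_0[OF l]
  proof (intro allI impI)
    fix a assume "f a = 0"
    then have "a $ 1 = 0" "a $ 2 = 0" "a $ 3 = 0" "a $ 4 = 0"
      using c[of a] by (simp_all add: g_simps[OF x])
    then show "a = 0" by (simp add: vec_eq_iff forall_4)
  qed
  then obtain a where "u = f a" using linear_injective_imp_surjective[OF l] by (metis surjD)
  then show ?thesis using c[of a] by (simp add: f_def)
qed

lemma g_expand:
  assumes "x \<in> V"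
  shows "g x u v = g x u (e1 x) * g x v (e1 x) + g x u (e2 x) * g x v (e2 x)
    + g x u (e3 x) * g x v (e3 x) + g x u (e4 x) * g x v (e4 x)"
  using arg_cong[OF frame_expand[OF assms, of v], of "g x u"]
  by (simp only: g_simps[OF V_S[OF assms]] mult.commute)

text \<open>These two real 1-forms later combine to \<nu> = (-Q + \<i> P) / 2.\<close>

definition "P x u = g x (nabla_endo g J x u (e1 x)) (e3 x)"
definition "Q x u = g x (nabla_endo g J x u (e1 x)) (e4 x)"

text \<open>The derivative of J is skew and anticommutes with J; in dimension four such
  endomorphisms form a plane, so two entries fix all sixteen.\<close>

lemma nabla_endo_table:
  assumes "x \<in> V"
  defines "T \<equiv> \<lambda>u a b. g x (nabla_endo g J x u (a x)) (b x)"
  shows "T u e1 e1 = 0" "T u e1 e2 = 0" "T u e1 e3 = P x u" "T u e1 e4 = Q x u"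
    "T u e2 e1 = 0" "T u e2 e2 = 0" "T u e2 e3 = Q x u" "T u e2 e4 = - P x u"
    "T u e3 e1 = - P x u" "T u e3 e2 = - Q x u" "T u e3 e3 = 0" "T u e3 e4 = 0"
    "T u e4 e1 = - Q x u" "T u e4 e2 = P x u" "T u e4 e3 = 0" "T u e4 e4 = 0"
proof -
  note x = V_S[OF assms(1)]
  have skew: "g x (nabla_endo g J x u a) b = - g x (nabla_endo g J x u b) a" for a b
    by (rule nabla_endo_skew[OF x])
  have J: "g x (nabla_endo g J x u (J x a)) b = g x (nabla_endo g J x u a) (J x b)" for a b
    by (simp add: nabla_endo_anticommute[OF x] g_simps[OF x] J_skew[OF x])
  have diag: "g x (nabla_endo g J x u a) a = 0" for a using skew[of a a] by simp
  have diag2: "g x (nabla_endo g J x u a) (J x a) = 0" for a using J[of a a] skew[of "J x a" a] by simp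
  show "T u e1 e1 = 0" "T u e1 e2 = 0" "T u e1 e3 = P x u" "T u e1 e4 = Q x u"
    "T u e2 e1 = 0" "T u e2 e2 = 0" "T u e2 e3 = Q x u" "T u e2 e4 = - P x u"
    "T u e3 e1 = - P x u" "T u e3 e2 = - Q x u" "T u e3 e3 = 0" "T u e3 e4 = 0"
    "T u e4 e1 = - Q x u" "T u e4 e2 = P x u" "T u e4 e3 = 0" "T u e4 e4 = 0"
    unfolding T_def P_def Q_def e2_def e4_def
    using skew[of "e3 x" "e1 x"] skew[of "e3 x" "J x (e1 x)"] skew[of "J x (e3 x)" "e1 x"]
      skew[of "J x (e3 x)" "J x (e1 x)"]
    by (simp_all add: diag diag2 J J_J[OF x] g_simps[OF x])
qed

text \<open>The coefficients depend on \<open>w\<close> and \<open>z\<close> but not on the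
  direction \<open>u\<close>: every component is a fixed combination of the same two
  1-forms.\<close>

lemma nabla_endo_expand:
  assumes "x \<in> V"
  obtains p q where "\<And>u. g x (nabla_endo g J x u w) z = p * P x u + q * Q x u"
proof -
  note x = V_S[OF assms]
  have "g x (nabla_endo g J x u w) z =
      (g x w (e1 x) * g x z (e3 x) - g x w (e3 x) * g x z (e1 x)
        - (g x w (e2 x) * g x z (e4 x) - g x w (e4 x) * g x z (e2 x))) * P x u
      + (g x w (e1 x) * g x z (e4 x) - g x w (e4 x) * g x z (e1 x)
        + (g x w (e2 x) * g x z (e3 x) - g x w (e3 x) * g x z (e2 x))) * Q x u" for u
    using arg_cong[OF frame_expand[OF assms, of w], of "\<lambda>w. g x (nabla_endo g J x u w) z"]
      g_expand[OF assms, of "nabla_endo g J x u (e1 x)" z] g_expand[OF assms, of "nabla_endo g J x u (e2 x)" z]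
      g_expand[OF assms, of "nabla_endo g J x u (e3 x)" z] g_expand[OF assms, of "nabla_endo g J x u (e4 x)" z]
    by (simp add: linear_add[OF linear_nabla_endo(2)[OF x]] linear_scale[OF linear_nabla_endo(2)[OF x]]
        g_simps[OF x] nabla_endo_table[OF assms] algebra_simps)
  then show ?thesis using that by blast
qed

lemma linear_PQ:
  assumes "x \<in> V"
  shows "linear (P x)" "linear (Q x)"
  unfolding P_def[abs_def] Q_def[abs_def]
  using linear_nabla_endo(1)[OF V_S[OF assms]]
  by (auto intro!: linearI simp: linear_add[OF linear_nabla_endo(1)[OF V_S[OF assms]]]
      linear_scale[OF linear_nabla_endo(1)[OF V_S[OF assms]]] g_simps[OF V_S[OF assms]])

text \<open>Closedness of the fundamental form says that \<open>P\<close> and \<open>Q\<close> form a \<open>(0,1)\<close>-form.\<close>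

lemma PQ_type:
  assumes "x \<in> V"
  shows "P x (e2 x) = Q x (e1 x)" "Q x (e2 x) = - P x (e1 x)"
    "P x (e4 x) = Q x (e3 x)" "Q x (e4 x) = - P x (e3 x)"
  using nabla_endo_cyclic[OF V_S[OF assms], of "e1 x" "e2 x" "e3 x"]
    nabla_endo_cyclic[OF V_S[OF assms], of "e1 x" "e2 x" "e4 x"]
    nabla_endo_cyclic[OF V_S[OF assms], of "e3 x" "e4 x" "e1 x"]
    nabla_endo_cyclic[OF V_S[OF assms], of "e3 x" "e4 x" "e2 x"]
  by (simp_all add: nabla_endo_table[OF assms])

lemma nabla_endo_eq_0_iff:
  assumes "x \<in> V"
  shows "(\<forall>w. nabla_endo g J x u w = 0) \<longleftrightarrow> P x u = 0 \<and> Q x u = 0"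
proof
  assume "\<forall>w. nabla_endo g J x u w = 0"
  then show "P x u = 0 \<and> Q x u = 0" by (simp add: P_def Q_def g_simps[OF V_S[OF assms]])
next
  assume 0: "P x u = 0 \<and> Q x u = 0"
  show "\<forall>w. nabla_endo g J x u w = 0"
  proof
    show "nabla_endo g J x u w = 0" for w
    proof (rule g_eqI[OF V_S[OF assms]])
      fix z
      obtain p q where "\<And>u. g x (nabla_endo g J x u w) z = p * P x u + q * Q x u"
        by (rule nabla_endo_expand[OF assms]) blast
      then show "g x (nabla_endo g J x u w) z = g x 0 z" by (simp add: 0 g_simps[OF V_S[OF assms]])
    qed
  qed
qed

text \<open>The given component is p P + q Q. Its vanishing on e3 and e4 gives, by
  \<open>PQ_type\<close>, two linear equations for P (e3) and Q (e3) with determinant p^2 + q^2,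
  which is non-zero because the value r on e1 is.\<close>

lemma adapted:
  assumes "x \<in> V" and t: "\<And>u. g x (nabla_endo g J x u w) z = r * g x (e1 x) u" and r: "r \<noteq> 0"
  shows "P x (e3 x) = 0" "Q x (e3 x) = 0" "P x (e1 x) \<noteq> 0 \<or> Q x (e1 x) \<noteq> 0"
proof -
  obtain p q where pq: "\<And>u. g x (nabla_endo g J x u w) z = p * P x u + q * Q x u"
    by (rule nabla_endo_expand[OF assms(1)]) blast
  have a: "p * P x (e3 x) + q * Q x (e3 x) = 0" "p * Q x (e3 x) - q * P x (e3 x) = 0"
    "p * P x (e1 x) + q * Q x (e1 x) = r"
    using t[of "e3 x"] t[of "e4 x"] t[of "e1 x"] pq[of "e3 x"] pq[of "e4 x"] pq[of "e1 x"]
    by (simp_all add: orthonormal[OF assms(1)] PQ_type[OF assms(1)])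
  then show "P x (e1 x) \<noteq> 0 \<or> Q x (e1 x) \<noteq> 0" using r by auto
  have "p\<^sup>2 + q\<^sup>2 \<noteq> 0" using a(3) r by (auto simp: sum_power2_eq_zero_iff)
  moreover have "(p\<^sup>2 + q\<^sup>2) * P x (e3 x) = 0" "(p\<^sup>2 + q\<^sup>2) * Q x (e3 x) = 0"
    using a by algebra+
  ultimately show "P x (e3 x) = 0" "Q x (e3 x) = 0" by auto
qed

end

context ak_chart
begin

text \<open>The metric dual of a single component of \<nabla>J is smooth and non-zero near the
  point. Normalised it is e1, and its length is the factor \<open>r\<close>; then e3 comes from a
  constant vector by Gram-Schmidt.\<close>

lemma adapted_frame_exists:
  assumes x0: "x0 \<in> S" and nz: "nabla_endo g J x0 v w \<noteq> 0"
  obtains V e1 e3 where "ak_frame S g J V e1 e3" "x0 \<in> V"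
    "\<And>x. x \<in> V \<Longrightarrow> \<exists>w z r. r \<noteq> 0 \<and> (\<forall>u. g x (nabla_endo g J x u w) z = r * g x (e1 x) u)"
proof -
  \<comment> \<open>Testing against the non-zero value itself makes the component at
    \<open>v\<close> equal to \<open>g x0 z z > 0\<close>.\<close>
  define z where "z = nabla_endo g J x0 v w"
  have "linear (\<lambda>u. g x (nabla_endo g J x u w) z)" if "x \<in> S" for x
    using linear_compose[OF linear_nabla_endo(1)[OF that] linear_g(2)[OF that]] by (simp add: o_def)
  moreover have "smooth_on S (\<lambda>x. g x (nabla_endo g J x u w) z)" for u
    by (intro smooth_g_apply S smooth_nabla_endo smooth_on_const) auto
  ultimately obtain \<xi> where \<xi>: "smooth_on S \<xi>" "\<And>x u. x \<in> S \<Longrightarrow> g x (\<xi> x) u = g x (nabla_endo g J x u w) z"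
    using raise_index[where L = "\<lambda>x u. g x (nabla_endo g J x u w) z"] by blast
  define V0 where "V0 = {x \<in> S. g x (\<xi> x) (\<xi> x) > 0}"
  have V0: "open V0" "V0 \<subseteq> S"
    unfolding V0_def by (auto intro!: open_positive_set smooth_g_apply S \<xi>)
  have "\<xi> x0 \<noteq> 0"
  proof
    assume "\<xi> x0 = 0"
    then have "g x0 z z = 0" using \<xi>(2)[OF x0, of v] by (simp add: z_def g_simps[OF x0])
    then show False using pos_g[OF x0, of z] nz by (simp add: z_def)
  qed
  then have x0V0: "x0 \<in> V0" using x0 pos_g[OF x0] by (simp add: V0_def)
  define e1 where "e1 x = (g x (\<xi> x) (\<xi> x) powr (-1/2)) *\<^sub>R \<xi> x" for x
  have e1s: "smooth_on V0 e1"
    unfolding e1_def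
    by (intro smooth_on_scaleR smooth_on_powr V0 smooth_g_apply smooth_on_subset[OF \<xi>(1)])
      (auto simp: V0_def)
  have pw: "t powr (-1/2) * (t powr (-1/2) * t) = 1" if "t > 0" for t :: real
  proof -
    have "t powr (-1/2) * t powr (-1/2) = t powr (-1)" by (simp flip: powr_add)
    then show ?thesis using that by (simp add: powr_minus flip: mult.assoc)
  qed
  have e1u: "g x (e1 x) (e1 x) = 1" if "x \<in> V0" for x
    using that V0(2) pw[of "g x (\<xi> x) (\<xi> x)"] by (auto simp: e1_def V0_def g_simps)
  \<comment> \<open>A constant vector off the plane of e1 and J e1 at \<open>x0\<close>; its
    projection \<open>q\<close> then stays non-zero nearby.\<close>
  obtain v' where v': "v' \<notin> span {e1 x0, J x0 (e1 x0)}"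
  proof -
    have "dim (span {e1 x0, J x0 (e1 x0)}) \<le> card {e1 x0, J x0 (e1 x0)}"
      by (simp add: dim_le_card')
    also have "\<dots> \<le> 2" by (simp add: card_insert_if)
    finally have "dim (span {e1 x0, J x0 (e1 x0)}) \<noteq> dim (UNIV :: (real ^ 4) set)" by (simp add: dim_UNIV)
    then show ?thesis using that by (metis UNIV_eq_I)
  qed
  define q where "q x = v' - g x v' (e1 x) *\<^sub>R e1 x - g x v' (J x (e1 x)) *\<^sub>R J x (e1 x)" for x
  have qs: "smooth_on V0 q"
    unfolding q_def
    by (intro smooth_on_diff smooth_on_scaleR smooth_on_const V0 smooth_g_apply smooth_J_apply e1s)
  define V where "V = {x \<in> V0. g x (q x) (q x) > 0}"
  have V: "open V" "V \<subseteq> V0" "V \<subseteq> S"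
    using V0 unfolding V_def by (auto intro!: open_positive_set smooth_g_apply V0 qs)
  have "q x0 \<noteq> 0"
  proof
    assume "q x0 = 0"
    then have "v' = g x0 v' (e1 x0) *\<^sub>R e1 x0 + g x0 v' (J x0 (e1 x0)) *\<^sub>R J x0 (e1 x0)"
      by (simp add: q_def algebra_simps)
    also have "\<dots> \<in> span {e1 x0, J x0 (e1 x0)}"
      by (intro span_add span_scale span_base) auto
    finally show False using v' by simp
  qed
  then have x0V: "x0 \<in> V" using x0V0 x0 pos_g[OF x0] by (simp add: V_def)
  define e3 where "e3 x = (g x (q x) (q x) powr (-1/2)) *\<^sub>R q x" for x
  have "smooth_on V e3"
    unfolding e3_def
    by (intro smooth_on_scaleR smooth_on_powr V smooth_g_apply smooth_on_subset[OF qs])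
      (auto simp: V_def)
  moreover have "g x (e3 x) (e3 x) = 1" if "x \<in> V" for x
    using that V(3) pw[of "g x (q x) (q x)"] by (auto simp: e3_def V_def g_simps)
  moreover have "g x (e1 x) (e3 x) = 0" "g x (J x (e1 x)) (e3 x) = 0" if "x \<in> V" for x
  proof -
    have x: "x \<in> S" and u: "g x (e1 x) (e1 x) = 1" using that V e1u by auto
    have "g x (e1 x) (J x (e1 x)) = 0" using J_alt[OF x] sym_g[OF x] by metis
    then have "g x (e1 x) (q x) = 0" "g x (J x (e1 x)) (q x) = 0"
      using u J_alt[OF x] sym_g[OF x, of v'] by (simp_all add: q_def g_simps[OF x] J_orth[OF x])
    then show "g x (e1 x) (e3 x) = 0" "g x (J x (e1 x)) (e3 x) = 0"
      by (simp_all add: e3_def g_simps[OF x])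
  qed
  ultimately have "ak_frame S g J V e1 e3"
    using V e1u smooth_on_subset[OF e1s V(2)] by unfold_locales auto
  moreover have "\<exists>w z r. r \<noteq> 0 \<and> (\<forall>u. g x (nabla_endo g J x u w) z = r * g x (e1 x) u)" if "x \<in> V" for x
  proof (intro exI conjI allI)
    have x: "x \<in> S" and p: "g x (\<xi> x) (\<xi> x) > 0" using that V by (auto simp: V_def V0_def)
    show "g x (\<xi> x) (\<xi> x) powr (1/2) \<noteq> 0" using p by simp
    show "g x (nabla_endo g J x u w) z = g x (\<xi> x) (\<xi> x) powr (1/2) * g x (e1 x) u" for u
      using p \<xi>(2)[OF x, of u] by (simp add: e1_def g_simps[OF x] powr_minus flip: mult.assoc)
  qed
  ultimately show ?thesis using that x0V by blast
qed

end

section \<open>Connection and curvature forms of an adapted frame\<close>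

locale ak_adapted = ak_frame +
  assumes adapted3: "\<And>x. x \<in> V \<Longrightarrow> P x (e3 x) = 0" "\<And>x. x \<in> V \<Longrightarrow> Q x (e3 x) = 0"
    and adapted1: "\<And>x. x \<in> V \<Longrightarrow> P x (e1 x) \<noteq> 0 \<or> Q x (e1 x) \<noteq> 0"
begin

definition "\<theta> a x u = complex_of_real (g x u (a x))"
definition "\<omega> a b x u = complex_of_real (g x (nabla g (\<lambda>_. u) a x) (b x))"
definition "R a b x u v = complex_of_real (riemann g x u v (a x) (b x))"

definition "\<alpha>1 x u = \<theta> e1 x u + \<i> * \<theta> e2 x u"
definition "\<alpha>2 x u = \<theta> e3 x u + \<i> * \<theta> e4 x u"
definition "\<omega>\<^sub>1 x u = - 1 * \<omega> e1 e2 x u"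
definition "\<omega>\<^sub>2 x u = - 1 * \<omega> e3 e4 x u"
text \<open>If J were parallel, \<omega>24 = \<omega>13 and \<omega>23 = -\<omega>14 would hold, and
  for I the same with opposite signs. So \<nu> is the obstruction for J and \<mu> the one for
  I.\<close>

definition "\<mu> x u = 1 / 2 * (\<omega> e1 e3 x u + \<omega> e2 e4 x u + \<i> * (\<omega> e2 e3 x u - \<omega> e1 e4 x u))"
definition "\<nu> x u = 1 / 2 * (\<omega> e1 e3 x u - \<omega> e2 e4 x u + \<i> * (\<omega> e2 e3 x u + \<omega> e1 e4 x u))"
definition "c x = \<nu> x (e1 x)"

lemma cnj_real: "cnj (\<theta> a x u) = \<theta> a x u" "cnj (\<omega> a b x u) = \<omega> a b x u"
  by (simp_all add: \<theta>_def \<omega>_def)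

lemma form1_\<theta>: "smooth_on V a \<Longrightarrow> form1 V (\<theta> a)"
  unfolding form1_def \<theta>_def[abs_def] using V
  by (auto intro!: smooth_on_of_real smooth_g_apply smooth_on_const linearI
      simp: g_simps[OF V_S] scaleR_conv_of_real[where 'a = complex])

lemma form1_\<omega>:
  assumes "smooth_on V a" "smooth_on V b"
  shows "form1 V (\<omega> a b)"
  unfolding form1_def \<omega>_def[abs_def]
proof (intro conjI ballI allI)
  show "smooth_on V (\<lambda>x. complex_of_real (g x (nabla g (\<lambda>_. v) a x) (b x)))" for v
    by (intro smooth_on_of_real smooth_g_apply smooth_nabla V assms)
  fix x assume x: "x \<in> V"
  note l = linear_nabla[OF V_S[OF x] smooth_on_differentiable[OF assms(1) x]]
  show "linear (\<lambda>u. complex_of_real (g x (nabla g (\<lambda>_. u) a x) (b x)))"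
    by (intro linearI) (simp_all add: linear_add[OF l] linear_scale[OF l] g_simps[OF V_S[OF x]]
        scaleR_conv_of_real[where 'a = complex])
qed

lemmas form1_frame = form1_\<theta>[OF smooth_e(1)] form1_\<theta>[OF smooth_e(2)] form1_\<theta>[OF smooth_e(3)] form1_\<theta>[OF smooth_e(4)]
  form1_\<omega>[OF smooth_e(1,2)] form1_\<omega>[OF smooth_e(1,3)] form1_\<omega>[OF smooth_e(1,4)]
  form1_\<omega>[OF smooth_e(2,3)] form1_\<omega>[OF smooth_e(2,4)] form1_\<omega>[OF smooth_e(3,4)]

lemma form1_coframe: "form1 V \<alpha>1" "form1 V \<alpha>2" "form1 V \<omega>\<^sub>1" "form1 V \<omega>\<^sub>2" "form1 V \<mu>" "form1 V \<nu>"
  unfolding \<alpha>1_def[abs_def] \<alpha>2_def[abs_def] \<omega>\<^sub>1_def[abs_def] \<omega>\<^sub>2_def[abs_def] \<mu>_def[abs_def] \<nu>_def[abs_def]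
  by (intro form1_cmult form1_add form1_diff V form1_frame)+

lemma \<omega>_skew:
  assumes x: "x \<in> V" and ab: "smooth_on V a" "smooth_on V b" "\<And>y. y \<in> V \<Longrightarrow> g y (a y) (b y) = k"
  shows "\<omega> b a x u = - \<omega> a b x u"
proof -
  have "\<partial> (\<lambda>y. g y (a y) (b y)) x = \<partial> (\<lambda>y. k) x" by (rule dir_deriv_cong[OF V(1) x ab(3)])
  then have "g x (nabla g (\<lambda>_. u) a x) (b x) + g x (a x) (nabla g (\<lambda>_. u) b x) = 0"
    using metric_compatible[OF V_S[OF x] smooth_on_differentiable[OF ab(1) x] smooth_on_differentiable[OF ab(2) x], of u]
    by simp
  then have "g x (nabla g (\<lambda>_. u) b x) (a x) = - g x (nabla g (\<lambda>_. u) a x) (b x)"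
    using sym_g[OF V_S[OF x]] by (metis eq_neg_iff_add_eq_0 add.commute)
  then show ?thesis by (simp add: \<omega>_def)
qed

lemma \<omega>_table:
  assumes x: "x \<in> V"
  shows "\<omega> e1 e1 x u = 0" "\<omega> e2 e2 x u = 0" "\<omega> e3 e3 x u = 0" "\<omega> e4 e4 x u = 0"
    "\<omega> e2 e1 x u = - \<omega> e1 e2 x u" "\<omega> e3 e1 x u = - \<omega> e1 e3 x u" "\<omega> e4 e1 x u = - \<omega> e1 e4 x u"
    "\<omega> e3 e2 x u = - \<omega> e2 e3 x u" "\<omega> e4 e2 x u = - \<omega> e2 e4 x u" "\<omega> e4 e3 x u = - \<omega> e3 e4 x u"
proof -
  have z: "p = 0" if "p = - p" for p :: complex using that by (simp add: complex_eq_iff)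
  show "\<omega> e1 e1 x u = 0" "\<omega> e2 e2 x u = 0" "\<omega> e3 e3 x u = 0" "\<omega> e4 e4 x u = 0"
    by (rule z, rule \<omega>_skew[OF x smooth_e(1,1) orthonormal(1)] \<omega>_skew[OF x smooth_e(2,2) orthonormal(6)]
        \<omega>_skew[OF x smooth_e(3,3) orthonormal(11)] \<omega>_skew[OF x smooth_e(4,4) orthonormal(16)], assumption)+
  show "\<omega> e2 e1 x u = - \<omega> e1 e2 x u" "\<omega> e3 e1 x u = - \<omega> e1 e3 x u" "\<omega> e4 e1 x u = - \<omega> e1 e4 x u"
    "\<omega> e3 e2 x u = - \<omega> e2 e3 x u" "\<omega> e4 e2 x u = - \<omega> e2 e4 x u" "\<omega> e4 e3 x u = - \<omega> e3 e4 x u"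
    by (rule \<omega>_skew[OF x smooth_e(1,2) orthonormal(2)] \<omega>_skew[OF x smooth_e(1,3) orthonormal(3)]
        \<omega>_skew[OF x smooth_e(1,4) orthonormal(4)] \<omega>_skew[OF x smooth_e(2,3) orthonormal(7)]
        \<omega>_skew[OF x smooth_e(2,4) orthonormal(8)] \<omega>_skew[OF x smooth_e(3,4) orthonormal(12)], assumption)+
qed

text \<open>First structure equation: by symmetry of \<Gamma> the derivatives of the constant
  arguments cancel.\<close>

lemma d1_\<theta>:
  assumes x: "x \<in> V" and a: "smooth_on V a"
  shows "d1 (\<theta> a) x u v = wedge (\<omega> a e1 x) (\<theta> e1 x) u v + wedge (\<omega> a e2 x) (\<theta> e2 x) u v
    + wedge (\<omega> a e3 x) (\<theta> e3 x) u v + wedge (\<omega> a e4 x) (\<theta> e4 x) u v"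
proof -
  note S = V_S[OF x]
  have d: "\<partial> (\<lambda>y. \<theta> a y v) x u
      = complex_of_real (g x (\<Gamma> x u v) (a x) + g x (nabla g (\<lambda>_. u) a x) v)" for u v
  proof -
    have ad: "a differentiable (at x)" using a x by (rule smooth_on_differentiable)
    have "(\<lambda>y. g y v (a y)) differentiable (at x)"
      using smooth_on_differentiable[OF smooth_g_apply[OF V smooth_on_const a] x] .
    then have "\<partial> (\<lambda>y. \<theta> a y v) x u = complex_of_real (\<partial> (\<lambda>y. g y v (a y)) x u)"
      unfolding \<theta>_def by (rule dir_deriv_of_real)
    then show ?thesis
      using metric_compatible[OF S differentiable_const ad, of v u]
      by (simp add: nabla_const[of u "\<lambda>_. v"] sym_g[OF S, of v])
  qed
  show ?thesis
    unfolding d1_def d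
    by (simp add: christoffel_sym[OF S, of v u] g_expand[OF x, of "nabla g (\<lambda>_. u) a x" v]
        g_expand[OF x, of "nabla g (\<lambda>_. v) a x" u] wedge_def \<omega>_def \<theta>_def algebra_simps)
qed

text \<open>Second structure equation: the product rule leaves the commutator of covariant
  derivatives and quadratic terms, which are expanded in the frame.\<close>

lemma d1_\<omega>:
  assumes x: "x \<in> V" and ab: "smooth_on V a" "smooth_on V b"
  shows "d1 (\<omega> a b) x u v = R a b x u v
    - (wedge (\<omega> a e1 x) (\<omega> b e1 x) u v + wedge (\<omega> a e2 x) (\<omega> b e2 x) u v
      + wedge (\<omega> a e3 x) (\<omega> b e3 x) u v + wedge (\<omega> a e4 x) (\<omega> b e4 x) u v)"
proof -
  note S = V_S[OF x]
  have d: "\<partial> (\<lambda>y. \<omega> a b y v) x u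
      = complex_of_real (g x (nabla g (\<lambda>_. u) (nabla g (\<lambda>_. v) a) x) (b x)
        + g x (nabla g (\<lambda>_. v) a x) (nabla g (\<lambda>_. u) b x))" for u v
  proof -
    have n: "smooth_on V (nabla g (\<lambda>_. v) a)" by (intro smooth_nabla V ab)
    have "(\<lambda>y. g y (nabla g (\<lambda>_. v) a y) (b y)) differentiable (at x)"
      using smooth_on_differentiable[OF smooth_g_apply[OF V n ab(2)] x] .
    then have "\<partial> (\<lambda>y. \<omega> a b y v) x u = complex_of_real (\<partial> (\<lambda>y. g y (nabla g (\<lambda>_. v) a y) (b y)) x u)"
      unfolding \<omega>_def by (rule dir_deriv_of_real)
    then show ?thesis
      using metric_compatible[OF S n[THEN smooth_on_differentiable, OF x] ab(2)[THEN smooth_on_differentiable, OF x], of u]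
      by simp
  qed
  have "R a b x u v = complex_of_real (g x (nabla g (\<lambda>_. u) (nabla g (\<lambda>_. v) a) x) (b x)
      - g x (nabla g (\<lambda>_. v) (nabla g (\<lambda>_. u) a) x) (b x))"
    by (simp add: R_def riemann_def curvature_commutator[OF V x ab(1), symmetric] g_simps[OF S])
  then show ?thesis
    unfolding d1_def d
    by (simp add: g_expand[OF x, of "nabla g (\<lambda>_. v) a x" "nabla g (\<lambda>_. u) b x"]
        g_expand[OF x, of "nabla g (\<lambda>_. u) a x" "nabla g (\<lambda>_. v) b x"] wedge_def \<omega>_def algebra_simps)
qed

text \<open>By \<open>\<omega>_skew\<close> the structure equations for (a, b) and (b, a) have
  opposite left sides and opposite quadratic terms, hence opposite curvatures.\<close>

lemma R_skew:
  assumes x: "x \<in> V" and ab: "smooth_on V a" "smooth_on V b" "\<And>y. y \<in> V \<Longrightarrow> g y (a y) (b y) = k"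
  shows "R b a x u v = - R a b x u v"
proof -
  have "d1 (\<omega> b a) x = d1 (\<lambda>y u. - 1 * \<omega> a b y u) x"
    by (rule d1_cong[OF V(1) x]) (simp add: \<omega>_skew[OF _ ab])
  then have "d1 (\<omega> b a) x u v = - d1 (\<omega> a b) x u v"
    by (simp only: d1_cmult[OF V(1) x form1_\<omega>[OF ab(1,2)]]) simp
  then show ?thesis
    unfolding d1_\<omega>[OF x ab(1,2)] d1_\<omega>[OF x ab(2,1)]
    by (simp add: wedge_def eq_neg_iff_add_eq_0 algebra_simps)
qed

lemma R_J:
  assumes x: "x \<in> V"
  shows "R a b x u v = complex_of_real (riemann g x (J x u) (J x v) (J x (a x)) (J x (b x)))"
  using gray[OF V_S[OF x]] by (simp add: R_def)

text \<open>The Gray condition turns R13 (u, v) into R24 (J u, J v) and R23 (u, v) into -R14 (J u, J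
  v). So R12, R34, R13 + R24 and R23 - R14 are J-invariant, while R13 - R24 and R23 + R14 change
  sign.\<close>

lemma R_table:
  assumes x: "x \<in> V"
  defines "E1 \<equiv> e1 x" and "E2 \<equiv> e2 x" and "E3 \<equiv> e3 x" and "E4 \<equiv> e4 x"
  shows "R e1 e2 x E2 E4 = R e1 e2 x E1 E3" "R e1 e2 x E2 E3 = - R e1 e2 x E1 E4"
    "R e3 e4 x E2 E4 = R e3 e4 x E1 E3" "R e3 e4 x E2 E3 = - R e3 e4 x E1 E4"
    "R e1 e3 x E1 E2 = R e2 e4 x E1 E2" "R e1 e3 x E3 E4 = R e2 e4 x E3 E4"
    "R e2 e3 x E1 E2 = - R e1 e4 x E1 E2" "R e2 e3 x E3 E4 = - R e1 e4 x E3 E4"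
    "R e2 e4 x E2 E4 = R e1 e3 x E1 E3" "R e2 e4 x E1 E3 = R e1 e3 x E2 E4"
    "R e2 e4 x E2 E3 = - R e1 e3 x E1 E4" "R e2 e4 x E1 E4 = - R e1 e3 x E2 E3"
    "R e2 e3 x E2 E4 = - R e1 e4 x E1 E3" "R e2 e3 x E1 E3 = - R e1 e4 x E2 E4"
    "R e2 e3 x E2 E3 = R e1 e4 x E1 E4" "R e2 e3 x E1 E4 = R e1 e4 x E2 E3"
proof -
  have swap: "riemann g x u v (e2 x) (e1 x) = - riemann g x u v (e1 x) (e2 x)"
    "riemann g x u v (e4 x) (e3 x) = - riemann g x u v (e3 x) (e4 x)" for u v
    using R_skew[OF x smooth_e(1,2) orthonormal(2), of u v] R_skew[OF x smooth_e(3,4) orthonormal(12), of u v]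
    by (simp_all add: R_def complex_eq_iff)
  have flip: "riemann g x v u w z = - riemann g x u v w z" for u v w z
    by (simp add: riemann_def curvature_const[OF V_S[OF x]] g_simps[OF V_S[OF x]])
  note s = R_def riemann_minus[OF V_S[OF x]] J_e[OF x] swap
  show "R e1 e2 x E2 E4 = R e1 e2 x E1 E3" "R e1 e2 x E2 E3 = - R e1 e2 x E1 E4"
    "R e3 e4 x E2 E4 = R e3 e4 x E1 E3" "R e3 e4 x E2 E3 = - R e3 e4 x E1 E4"
    "R e1 e3 x E1 E2 = R e2 e4 x E1 E2" "R e1 e3 x E3 E4 = R e2 e4 x E3 E4"
    "R e2 e3 x E1 E2 = - R e1 e4 x E1 E2" "R e2 e3 x E3 E4 = - R e1 e4 x E3 E4"
    "R e2 e4 x E2 E4 = R e1 e3 x E1 E3" "R e2 e4 x E1 E3 = R e1 e3 x E2 E4"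
    "R e2 e4 x E2 E3 = - R e1 e3 x E1 E4" "R e2 e4 x E1 E4 = - R e1 e3 x E2 E3"
    "R e2 e3 x E2 E4 = - R e1 e4 x E1 E3" "R e2 e3 x E1 E3 = - R e1 e4 x E2 E4"
    "R e2 e3 x E2 E3 = R e1 e4 x E1 E4" "R e2 e3 x E1 E4 = R e1 e4 x E2 E3"
    unfolding E1_def E2_def E3_def E4_def
    by (subst R_J[OF x]; simp add: s flip[of "e1 x" "e2 x"] flip[of "e3 x" "e4 x"])+
qed

lemma PQ_expand:
  assumes x: "x \<in> V"
  shows "P x u = g x u (e1 x) * P x (e1 x) + g x u (e2 x) * Q x (e1 x)"
    "Q x u = g x u (e1 x) * Q x (e1 x) - g x u (e2 x) * P x (e1 x)"
  using arg_cong[OF frame_expand[OF x, of u], of "P x"] arg_cong[OF frame_expand[OF x, of u], of "Q x"]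
  by (simp_all add: linear_add[OF linear_PQ(1)[OF x]] linear_scale[OF linear_PQ(1)[OF x]]
      linear_add[OF linear_PQ(2)[OF x]] linear_scale[OF linear_PQ(2)[OF x]] PQ_type[OF x] adapted3[OF x])

text \<open>Differentiating e2 = J e1 expresses \<omega>23 + \<omega>14 and \<omega>24 - \<omega>13
  by the derivative of J.\<close>

lemma \<nu>_PQ:
  assumes x: "x \<in> V"
  shows "\<nu> x u = 1 / 2 * (- complex_of_real (Q x u) + \<i> * complex_of_real (P x u))"
proof -
  note S = V_S[OF x]
  have "nabla g (\<lambda>_. u) e2 x = nabla_endo g J x u (e1 x) + J x (nabla g (\<lambda>_. u) e1 x)"
    using nabla_J[OF S differentiable_e(1)[OF x], of u] by (simp add: e2_def[abs_def])
  then have "g x (nabla g (\<lambda>_. u) e2 x) (e3 x) = P x u - g x (nabla g (\<lambda>_. u) e1 x) (e4 x)"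
    "g x (nabla g (\<lambda>_. u) e2 x) (e4 x) = Q x u + g x (nabla g (\<lambda>_. u) e1 x) (e3 x)"
    by (simp_all add: g_simps[OF S] J_skew[OF S, of "nabla g (\<lambda>_. u) e1 x"] J_e[OF x] P_def Q_def)
  then show ?thesis by (simp add: \<nu>_def \<omega>_def complex_eq_iff)
qed

lemma \<nu>_eq: "x \<in> V \<Longrightarrow> \<nu> x u = c x * cnj (\<alpha>1 x u)"
  unfolding c_def using PQ_expand[of x u]
  by (simp add: \<nu>_PQ \<alpha>1_def \<theta>_def complex_eq_iff algebra_simps)

lemma c_nonzero: "x \<in> V \<Longrightarrow> c x \<noteq> 0"
  using adapted1[of x] by (auto simp: c_def \<nu>_PQ complex_eq_iff)

lemma smooth_c: "smooth_on V c"
  unfolding c_def[abs_def] by (intro form1_apply V form1_coframe smooth_e)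

lemma \<alpha>_e:
  assumes x: "x \<in> V"
  shows "\<alpha>1 x (e1 x) = 1" "\<alpha>1 x (e2 x) = \<i>" "\<alpha>1 x (e3 x) = 0" "\<alpha>1 x (e4 x) = 0"
    "\<alpha>2 x (e1 x) = 0" "\<alpha>2 x (e2 x) = 0" "\<alpha>2 x (e3 x) = 1" "\<alpha>2 x (e4 x) = \<i>"
  by (simp_all add: \<alpha>1_def \<alpha>2_def \<theta>_def orthonormal[OF x])

text \<open>The last term of d\<alpha>2 disappears precisely because \<nu> is a multiple of
  ~\<alpha>1, which is what adapting the frame achieves.\<close>

lemma d1_coframe:
  assumes x: "x \<in> V"
  shows "d1 \<alpha>1 x u v = \<i> * wedge (\<omega>\<^sub>1 x) (\<alpha>1 x) u v + wedge (\<mu> x) (\<alpha>2 x) u v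
      + wedge (\<nu> x) (\<lambda>u. cnj (\<alpha>2 x u)) u v"
    "d1 \<alpha>2 x u v = \<i> * wedge (\<omega>\<^sub>2 x) (\<alpha>2 x) u v - wedge (\<lambda>u. cnj (\<mu> x u)) (\<alpha>1 x) u v
      - wedge (\<nu> x) (\<lambda>u. cnj (\<alpha>1 x u)) u v"
proof -
  have 1: "d1 \<alpha>1 x u v = d1 (\<theta> e1) x u v + \<i> * d1 (\<theta> e2) x u v"
    unfolding \<alpha>1_def[abs_def]
    by (simp add: d1_add[OF V(1) x form1_frame(1) form1_cmult[OF V(1) form1_frame(2)]] d1_cmult[OF V(1) x form1_frame(2)])
  have 2: "d1 \<alpha>2 x u v = d1 (\<theta> e3) x u v + \<i> * d1 (\<theta> e4) x u v"
    unfolding \<alpha>2_def[abs_def]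
    by (simp add: d1_add[OF V(1) x form1_frame(3) form1_cmult[OF V(1) form1_frame(4)]] d1_cmult[OF V(1) x form1_frame(4)])
  note s = d1_\<theta>[OF x smooth_e(1)] d1_\<theta>[OF x smooth_e(2)] d1_\<theta>[OF x smooth_e(3)] d1_\<theta>[OF x smooth_e(4)]
    \<omega>_table[OF x] wedge_def \<alpha>1_def \<alpha>2_def \<omega>\<^sub>1_def \<omega>\<^sub>2_def \<mu>_def \<nu>_def cnj_real
  show "d1 \<alpha>1 x u v = \<i> * wedge (\<omega>\<^sub>1 x) (\<alpha>1 x) u v + wedge (\<mu> x) (\<alpha>2 x) u v
      + wedge (\<nu> x) (\<lambda>u. cnj (\<alpha>2 x u)) u v"
    unfolding 1 by (simp add: s field_simps)
  show "d1 \<alpha>2 x u v = \<i> * wedge (\<omega>\<^sub>2 x) (\<alpha>2 x) u v - wedge (\<lambda>u. cnj (\<mu> x u)) (\<alpha>1 x) u v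
      - wedge (\<nu> x) (\<lambda>u. cnj (\<alpha>1 x u)) u v"
    unfolding 2 by (simp add: s field_simps)
qed

lemma d1_connection:
  assumes x: "x \<in> V"
  shows "\<i> * d1 \<omega>\<^sub>1 x u v + wedge (\<mu> x) (\<lambda>u. cnj (\<mu> x u)) u v + wedge (\<nu> x) (\<lambda>u. cnj (\<nu> x u)) u v
      = - \<i> * R e1 e2 x u v"
    "\<i> * d1 \<omega>\<^sub>2 x u v - wedge (\<mu> x) (\<lambda>u. cnj (\<mu> x u)) u v + wedge (\<nu> x) (\<lambda>u. cnj (\<nu> x u)) u v
      = - \<i> * R e3 e4 x u v"
    "d1 \<mu> x u v - \<i> * wedge (\<lambda>u. \<omega>\<^sub>1 x u - \<omega>\<^sub>2 x u) (\<mu> x) u v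
      = 1 / 2 * (R e1 e3 x u v + R e2 e4 x u v + \<i> * (R e2 e3 x u v - R e1 e4 x u v))"
    "d1 \<nu> x u v - \<i> * wedge (\<lambda>u. \<omega>\<^sub>1 x u + \<omega>\<^sub>2 x u) (\<nu> x) u v
      = 1 / 2 * (R e1 e3 x u v - R e2 e4 x u v + \<i> * (R e2 e3 x u v + R e1 e4 x u v))"
proof -
  note f = form1_frame(5-)
  have 1: "d1 \<omega>\<^sub>1 x u v = - d1 (\<omega> e1 e2) x u v" "d1 \<omega>\<^sub>2 x u v = - d1 (\<omega> e3 e4) x u v"
    unfolding \<omega>\<^sub>1_def[abs_def] \<omega>\<^sub>2_def[abs_def] by (simp_all only: d1_cmult[OF V(1) x f(1)] d1_cmult[OF V(1) x f(6)]) simp_all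
  have a: "form1 V (\<lambda>x u. \<omega> e1 e3 x u + \<omega> e2 e4 x u)" "form1 V (\<lambda>x u. \<omega> e1 e3 x u - \<omega> e2 e4 x u)"
    "form1 V (\<lambda>x u. \<omega> e2 e3 x u - \<omega> e1 e4 x u)" "form1 V (\<lambda>x u. \<omega> e2 e3 x u + \<omega> e1 e4 x u)"
    by (intro form1_add form1_diff V f)+
  note b = form1_cmult[OF V(1) a(3), of \<i>] form1_cmult[OF V(1) a(4), of \<i>]
  note ops = d1_add[OF V(1) x f(2,5)] d1_diff[OF V(1) x f(2,5)] d1_add[OF V(1) x f(4,3)] d1_diff[OF V(1) x f(4,3)]
    d1_cmult[OF V(1) x a(3)] d1_cmult[OF V(1) x a(4)] d1_add[OF V(1) x a(1) b(1)] d1_add[OF V(1) x a(2) b(2)]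
    d1_cmult[OF V(1) x form1_add[OF V(1) a(1) b(1)]] d1_cmult[OF V(1) x form1_add[OF V(1) a(2) b(2)]]
  have 2: "d1 \<mu> x u v = 1 / 2 * (d1 (\<omega> e1 e3) x u v + d1 (\<omega> e2 e4) x u v
      + \<i> * (d1 (\<omega> e2 e3) x u v - d1 (\<omega> e1 e4) x u v))"
    unfolding \<mu>_def[abs_def] ops ..
  have 3: "d1 \<nu> x u v = 1 / 2 * (d1 (\<omega> e1 e3) x u v - d1 (\<omega> e2 e4) x u v
      + \<i> * (d1 (\<omega> e2 e3) x u v + d1 (\<omega> e1 e4) x u v))"
    unfolding \<nu>_def[abs_def] ops ..
  note s = 1 2 3 d1_\<omega>[OF x smooth_e(1,2)] d1_\<omega>[OF x smooth_e(1,3)] d1_\<omega>[OF x smooth_e(1,4)]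
    d1_\<omega>[OF x smooth_e(2,3)] d1_\<omega>[OF x smooth_e(2,4)] d1_\<omega>[OF x smooth_e(3,4)]
    \<omega>_table[OF x] wedge_def \<omega>\<^sub>1_def \<omega>\<^sub>2_def \<mu>_def \<nu>_def cnj_real
  show "\<i> * d1 \<omega>\<^sub>1 x u v + wedge (\<mu> x) (\<lambda>u. cnj (\<mu> x u)) u v + wedge (\<nu> x) (\<lambda>u. cnj (\<nu> x u)) u v
      = - \<i> * R e1 e2 x u v"
    "\<i> * d1 \<omega>\<^sub>2 x u v - wedge (\<mu> x) (\<lambda>u. cnj (\<mu> x u)) u v + wedge (\<nu> x) (\<lambda>u. cnj (\<nu> x u)) u v
      = - \<i> * R e3 e4 x u v"
    "d1 \<mu> x u v - \<i> * wedge (\<lambda>u. \<omega>\<^sub>1 x u - \<omega>\<^sub>2 x u) (\<mu> x) u v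
      = 1 / 2 * (R e1 e3 x u v + R e2 e4 x u v + \<i> * (R e2 e3 x u v - R e1 e4 x u v))"
    "d1 \<nu> x u v - \<i> * wedge (\<lambda>u. \<omega>\<^sub>1 x u + \<omega>\<^sub>2 x u) (\<nu> x) u v
      = 1 / 2 * (R e1 e3 x u v - R e2 e4 x u v + \<i> * (R e2 e3 x u v + R e1 e4 x u v))"
    by (simp_all add: s field_simps)
qed

end

text \<open>\<open>d1_connection\<close> identifies the four curvature forms with combinations of R,
  whose types are read off from \<open>R_table\<close>.\<close>

sublocale ak_adapted \<subseteq> G: gray_frame V e1 e2 e3 e4 \<alpha>1 \<alpha>2 \<omega>\<^sub>1 \<omega>\<^sub>2 \<mu> c
proof
  fix x u v
  show "cnj (\<omega>\<^sub>1 x u) = \<omega>\<^sub>1 x u" "cnj (\<omega>\<^sub>2 x u) = \<omega>\<^sub>2 x u"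
    by (simp_all add: \<omega>\<^sub>1_def \<omega>\<^sub>2_def cnj_real)
  assume x: "x \<in> V"
  note \<nu>' = \<nu>_eq[OF x, symmetric]
  show "u = Re (\<alpha>1 x u) *\<^sub>R e1 x + Im (\<alpha>1 x u) *\<^sub>R e2 x + Re (\<alpha>2 x u) *\<^sub>R e3 x + Im (\<alpha>2 x u) *\<^sub>R e4 x"
    using frame_expand[OF x, of u] by (simp add: \<alpha>1_def \<alpha>2_def \<theta>_def)
  show "d1 \<alpha>1 x u v = \<i> * wedge (\<omega>\<^sub>1 x) (\<alpha>1 x) u v + wedge (\<mu> x) (\<alpha>2 x) u v
      + c x * wedge (\<lambda>u. cnj (\<alpha>1 x u)) (\<lambda>u. cnj (\<alpha>2 x u)) u v"
    by (simp add: d1_coframe[OF x] \<nu>_eq[OF x] wedge_def algebra_simps)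
  show "d1 \<alpha>2 x u v = \<i> * wedge (\<omega>\<^sub>2 x) (\<alpha>2 x) u v - wedge (\<lambda>u. cnj (\<mu> x u)) (\<alpha>1 x) u v"
    by (simp add: d1_coframe[OF x] \<nu>_eq[OF x] wedge_def algebra_simps)
  have d\<nu>: "d1 (\<lambda>y u. c y * cnj (\<alpha>1 y u)) x = d1 \<nu> x"
    by (rule d1_cong[OF V(1) x]) (simp add: \<nu>_eq)
  show "J_anti (e1 x) (e2 x) (e3 x) (e4 x) (\<lambda>u v. d1 (\<lambda>y u. c y * cnj (\<alpha>1 y u)) x u v
      - \<i> * wedge (\<lambda>u. \<omega>\<^sub>1 x u + \<omega>\<^sub>2 x u) (\<lambda>u. c x * cnj (\<alpha>1 x u)) u v)"
    unfolding d\<nu> \<nu>' d1_connection[OF x] J_anti_def by (simp add: R_table[OF x] algebra_simps)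
  have w: "c x * cnj (c x) * wedge (\<lambda>u. cnj (\<alpha>1 x u)) (\<alpha>1 x) u v
      = wedge (\<nu> x) (\<lambda>u. cnj (\<nu> x u)) u v" for u v
    by (simp add: \<nu>_eq[OF x] wedge_def algebra_simps)
  show "J_inv (e1 x) (e2 x) (e3 x) (e4 x) (\<lambda>u v. \<i> * d1 \<omega>\<^sub>1 x u v + wedge (\<mu> x) (\<lambda>u. cnj (\<mu> x u)) u v
      + c x * cnj (c x) * wedge (\<lambda>u. cnj (\<alpha>1 x u)) (\<alpha>1 x) u v)"
    unfolding w d1_connection[OF x] J_inv_def by (simp add: R_table[OF x])
  show "J_inv (e1 x) (e2 x) (e3 x) (e4 x) (\<lambda>u v. \<i> * d1 \<omega>\<^sub>2 x u v - wedge (\<mu> x) (\<lambda>u. cnj (\<mu> x u)) u v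
      + c x * cnj (c x) * wedge (\<lambda>u. cnj (\<alpha>1 x u)) (\<alpha>1 x) u v)"
    unfolding w d1_connection[OF x] J_inv_def by (simp add: R_table[OF x])
  show "J_inv (e1 x) (e2 x) (e3 x) (e4 x)
      (\<lambda>u v. d1 \<mu> x u v - \<i> * wedge (\<lambda>u. \<omega>\<^sub>1 x u - \<omega>\<^sub>2 x u) (\<mu> x) u v)"
    unfolding d1_connection[OF x] J_inv_def by (simp add: R_table[OF x] algebra_simps)
qed (use c_nonzero in \<open>auto intro: V smooth_e form1_coframe smooth_c \<alpha>_e\<close>)

section \<open>The opposite structure\<close>

text \<open>The value of \<open>opposite\<close> in a single chart.\<close>

definition opp :: "'n::finite local_bilin \<Rightarrow> 'n local_endo \<Rightarrow> 'n local_endo" where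
  "opp g J x = (THE B. linear B \<and> (\<forall>v. B (B v) = - v) \<and> (\<forall>u v. g x (B u) (B v) = g x u v) \<and>
     (\<forall>v \<in> kaehler_nullity g J x. B v = J x v) \<and>
     (\<forall>v \<in> g_complement g x (kaehler_nullity g J x). B v = - J x v))"

context ak_adapted
begin

text \<open>By \<open>PQ_expand\<close>, P and Q of u are linear in the e1 and e2 components of u,
  with determinant -(P (e1)^2 + Q (e1)^2), non-zero in an adapted frame.\<close>

lemma kaehler_nullity_eq:
  assumes x: "x \<in> V"
  shows "kaehler_nullity g J x = {u. g x u (e1 x) = 0 \<and> g x u (e2 x) = 0}"
proof -
  have "P x u = 0 \<and> Q x u = 0 \<longleftrightarrow> g x u (e1 x) = 0 \<and> g x u (e2 x) = 0" for u
  proof -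
    let ?p = "P x (e1 x)" and ?q = "Q x (e1 x)" and ?a = "g x u (e1 x)" and ?b = "g x u (e2 x)"
    note pq = PQ_expand[OF x, of u]
    have "?p\<^sup>2 + ?q\<^sup>2 \<noteq> 0" using adapted1[OF x] by (auto simp: sum_power2_eq_zero_iff)
    moreover have "(?p\<^sup>2 + ?q\<^sup>2) * ?a = ?p * P x u + ?q * Q x u" "(?p\<^sup>2 + ?q\<^sup>2) * ?b = ?q * P x u - ?p * Q x u"
      unfolding pq by (simp_all add: power2_eq_square algebra_simps)
    ultimately show ?thesis using pq by auto
  qed
  then show ?thesis by (auto simp: kaehler_nullity_def nabla_endo_eq_0_iff[OF x])
qed

lemma g_complement_eq:
  assumes x: "x \<in> V"
  shows "g_complement g x (kaehler_nullity g J x) = {u. g x u (e3 x) = 0 \<and> g x u (e4 x) = 0}"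
proof (intro set_eqI iffI)
  note S = V_S[OF x]
  fix u
  show "u \<in> {u. g x u (e3 x) = 0 \<and> g x u (e4 x) = 0}" if "u \<in> g_complement g x (kaehler_nullity g J x)"
    using that sym_g[OF S, of u] by (auto simp: g_complement_def kaehler_nullity_eq[OF x] orthonormal[OF x])
  show "u \<in> g_complement g x (kaehler_nullity g J x)" if "u \<in> {u. g x u (e3 x) = 0 \<and> g x u (e4 x) = 0}"
    using that g_expand[OF x, of _ u] by (simp add: g_complement_def kaehler_nullity_eq[OF x])
qed

lemma nullity_decomposition:
  assumes x: "x \<in> V"
  obtains a b where "u = a + b" "a \<in> kaehler_nullity g J x" "b \<in> g_complement g x (kaehler_nullity g J x)"
proof
  show "u = (g x u (e3 x) *\<^sub>R e3 x + g x u (e4 x) *\<^sub>R e4 x) + (g x u (e1 x) *\<^sub>R e1 x + g x u (e2 x) *\<^sub>R e2 x)"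
    using frame_expand[OF x, of u] by (simp add: algebra_simps)
  show "g x u (e3 x) *\<^sub>R e3 x + g x u (e4 x) *\<^sub>R e4 x \<in> kaehler_nullity g J x"
    unfolding kaehler_nullity_eq[OF x] by (simp add: g_simps[OF V_S[OF x]] orthonormal[OF x])
  show "g x u (e1 x) *\<^sub>R e1 x + g x u (e2 x) *\<^sub>R e2 x \<in> g_complement g x (kaehler_nullity g J x)"
    unfolding g_complement_eq[OF x] by (simp add: g_simps[OF V_S[OF x]] orthonormal[OF x])
qed

text \<open>On the plane of e1 and e2, J u is the negative of the bracket, so adding twice the
  bracket reverses J there.\<close>

definition "I x u = J x u + 2 *\<^sub>R (g x u (e2 x) *\<^sub>R e1 x - g x u (e1 x) *\<^sub>R e2 x)"

lemma linear_I: "x \<in> V \<Longrightarrow> linear (I x)"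
  by (intro linearI) (simp_all add: I_def J_simps[OF V_S] g_simps[OF V_S] algebra_simps)

lemma smooth_I: "smooth_on V (\<lambda>x. I x u)"
  unfolding I_def
  by (intro smooth_on_add smooth_on_scaleR smooth_on_diff smooth_on_const V smooth_J_apply smooth_g_apply smooth_e)

lemma I_e:
  assumes x: "x \<in> V"
  shows "I x (e1 x) = - e2 x" "I x (e2 x) = e1 x" "I x (e3 x) = e4 x" "I x (e4 x) = - e3 x"
  by (simp_all add: I_def J_e[OF x] orthonormal[OF x] scaleR_2)

lemma g_I:
  assumes x: "x \<in> V"
  shows "g x (I x u) (e1 x) = g x u (e2 x)" "g x (I x u) (e2 x) = - g x u (e1 x)"
    "g x (I x u) (e3 x) = - g x u (e4 x)" "g x (I x u) (e4 x) = g x u (e3 x)"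
  by (simp_all add: I_def g_simps[OF V_S[OF x]] orthonormal[OF x] J_skew[OF V_S[OF x], of u] J_e[OF x])

lemma I_I:
  assumes x: "x \<in> V"
  shows "I x (I x u) = - u"
proof (rule g_eqI[OF V_S[OF x]])
  show "g x (I x (I x u)) w = g x (- u) w" for w
    by (simp add: g_expand[OF x, of "I x (I x u)" w] g_expand[OF x, of u w] g_I[OF x] g_simps[OF V_S[OF x]])
qed

lemma I_orth: "x \<in> V \<Longrightarrow> g x (I x u) (I x v) = g x u v"
  using g_expand[of x u v] by (simp add: g_expand[of x "I x u" "I x v"] g_I)

lemma I_nullity:
  assumes x: "x \<in> V"
  shows "v \<in> kaehler_nullity g J x \<Longrightarrow> I x v = J x v"
    "v \<in> g_complement g x (kaehler_nullity g J x) \<Longrightarrow> I x v = - J x v"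
proof -
  show "v \<in> kaehler_nullity g J x \<Longrightarrow> I x v = J x v"
    by (simp add: kaehler_nullity_eq[OF x] I_def)
  assume "v \<in> g_complement g x (kaehler_nullity g J x)"
  then have v: "v = g x v (e1 x) *\<^sub>R e1 x + g x v (e2 x) *\<^sub>R e2 x"
    using frame_expand[OF x, of v] by (simp add: g_complement_eq[OF x])
  show "I x v = - J x v"
    by (subst (1 2) v)
      (simp add: linear_add[OF linear_I[OF x]] linear_scale[OF linear_I[OF x]] J_simps[OF V_S[OF x]] I_e[OF x] J_e[OF x])
qed

text \<open>Nullity and complement together span the space, so the prescribed values leave one
  candidate, and \<open>I\<close> has the required properties.\<close>

lemma opp_eq:
  assumes x: "x \<in> V"
  shows "opp g J x = I x"
  unfolding opp_def
proof (rule the_equality)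
  show "linear (I x) \<and> (\<forall>v. I x (I x v) = - v) \<and> (\<forall>u v. g x (I x u) (I x v) = g x u v) \<and>
     (\<forall>v \<in> kaehler_nullity g J x. I x v = J x v) \<and>
     (\<forall>v \<in> g_complement g x (kaehler_nullity g J x). I x v = - J x v)"
    using x by (simp add: linear_I I_I I_orth I_nullity)
  fix B
  assume B: "linear B \<and> (\<forall>v. B (B v) = - v) \<and> (\<forall>u v. g x (B u) (B v) = g x u v) \<and>
     (\<forall>v \<in> kaehler_nullity g J x. B v = J x v) \<and>
     (\<forall>v \<in> g_complement g x (kaehler_nullity g J x). B v = - J x v)"
  show "B = I x"
  proof
    fix u
    obtain a b where "u = a + b" "a \<in> kaehler_nullity g J x" "b \<in> g_complement g x (kaehler_nullity g J x)"
      by (rule nullity_decomposition[OF x])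
    then show "B u = I x u"
      using B by (simp add: linear_add[OF linear_I[OF x]] linear_add I_nullity[OF x])
  qed
qed

lemma opp_closed:
  assumes x: "x \<in> V"
  shows "ext_deriv (\<lambda>y u v. g y (opp g J y u) v) x u1 u2 u3 = 0"
proof (rule G.opposite_form_closed[OF x])
  show "g y (opp g J y u) v = Im (\<alpha>1 y u * cnj (\<alpha>1 y v)) - Im (\<alpha>2 y u * cnj (\<alpha>2 y v))"
    if "y \<in> V" for y u v
    by (simp add: opp_eq[OF that] g_expand[OF that, of "I y u" v] g_I[OF that] \<alpha>1_def \<alpha>2_def \<theta>_def algebra_simps)
qed

lemma opp_nijenhuis:
  assumes x: "x \<in> V"
  shows "nijenhuis (opp g J) x u v = 0"
proof (rule G.opposite_integrable[OF x])
  show "linear (opp g J y)" if "y \<in> V" for y using linear_I[OF that] by (simp add: opp_eq[OF that])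
  show "smooth_on V (\<lambda>y. opp g J y v)" for v
    by (rule smooth_on_cong[OF V(1) _ smooth_I]) (simp add: opp_eq)
qed (simp_all add: opp_eq \<alpha>1_def \<alpha>2_def \<theta>_def g_I complex_eq_iff)

end

text \<open>The frame no longer appears in the conclusions, which makes them comparable between
  charts.\<close>

theorem (in ak_chart) opposite_local:
  assumes x0: "x0 \<in> S" and nz: "nabla_endo g J x0 v w \<noteq> 0"
  obtains V where "open V" "V \<subseteq> S" "x0 \<in> V" "\<And>u. smooth_on V (\<lambda>x. opp g J x u)"
    "linear (opp g J x0)" "\<And>u. opp g J x0 (opp g J x0 u) = - u"
    "\<And>u v. g x0 (opp g J x0 u) (opp g J x0 v) = g x0 u v"
    "\<And>u. u \<in> kaehler_nullity g J x0 \<Longrightarrow> opp g J x0 u = J x0 u"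
    "\<And>u. u \<in> g_complement g x0 (kaehler_nullity g J x0) \<Longrightarrow> opp g J x0 u = - J x0 u"
    "\<And>u. \<exists>a b. u = a + b \<and> a \<in> kaehler_nullity g J x0 \<and> b \<in> g_complement g x0 (kaehler_nullity g J x0)"
    "\<And>u v. nijenhuis (opp g J) x0 u v = 0"
    "\<And>u1 u2 u3. ext_deriv (\<lambda>y u v. g y (opp g J y u) v) x0 u1 u2 u3 = 0"
proof -
  obtain V e1 e3 where "ak_frame S g J V e1 e3" and x0V: "x0 \<in> V"
    and ad: "\<And>x. x \<in> V \<Longrightarrow> \<exists>w z r. r \<noteq> 0 \<and> (\<forall>u. g x (nabla_endo g J x u w) z = r * g x (e1 x) u)"
    by (rule adapted_frame_exists[OF x0 nz]) blast
  then interpret F: ak_frame S g J V e1 e3 by simp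
  interpret F: ak_adapted S g J V e1 e3
  proof
    fix x assume x: "x \<in> V"
    obtain w z r where "r \<noteq> 0" "\<And>u. g x (nabla_endo g J x u w) z = r * g x (e1 x) u"
      using ad[OF x] by blast
    then show "F.P x (e3 x) = 0" "F.Q x (e3 x) = 0" "F.P x (e1 x) \<noteq> 0 \<or> F.Q x (e1 x) \<noteq> 0"
      using F.adapted[OF x] by blast+
  qed
  show ?thesis
  proof (rule that[OF F.V x0V])
    show "smooth_on V (\<lambda>x. opp g J x u)" for u
      by (rule smooth_on_cong[OF F.V(1) _ F.smooth_I]) (simp add: F.opp_eq)
    show "\<exists>a b. u = a + b \<and> a \<in> kaehler_nullity g J x0 \<and> b \<in> g_complement g x0 (kaehler_nullity g J x0)" for u
      by (rule F.nullity_decomposition[OF x0V, of u]) blast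
  qed (simp_all add: F.opp_eq[OF x0V] F.linear_I[OF x0V] F.I_I[OF x0V] F.I_orth[OF x0V] F.I_nullity[OF x0V]
      F.opp_nijenhuis[OF x0V] F.opp_closed[OF x0V])
qed

section \<open>Coordinate changes\<close>

lemma dir_deriv_pullback:
  fixes F :: "'n::euclidean_space \<Rightarrow> 'h::euclidean_space \<Rightarrow> 'f::real_normed_vector"
    and U :: "'e::euclidean_space set"
  assumes U: "open U" "x \<in> U" and \<phi>: "\<phi> differentiable (at x)" "\<And>y. y \<in> U \<Longrightarrow> \<phi> y \<in> S"
    and F: "\<And>z. z \<in> S \<Longrightarrow> linear (F z)" "\<And>v. (\<lambda>z. F z v) differentiable (at (\<phi> x))"
    and X: "X differentiable (at x)"
  shows "(\<lambda>y. F (\<phi> y) (X y)) differentiable (at x)"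
    and "\<partial> (\<lambda>y. F (\<phi> y) (X y)) x u = \<partial> (\<lambda>z. F z (X x)) (\<phi> x) (\<partial> \<phi> x u) + F (\<phi> x) (\<partial> X x u)"
proof -
  have d: "(\<lambda>y. F (\<phi> y) v) differentiable (at x)" for v
    using differentiable_chain_at[OF \<phi>(1) F(2)[of v]] by (simp add: o_def)
  show "(\<lambda>y. F (\<phi> y) (X y)) differentiable (at x)"
    by (rule dir_deriv_linear_apply(1)[OF U, where F = "\<lambda>y. F (\<phi> y)"]) (intro F(1) \<phi>(2) d X | assumption)+
  have "\<partial> (\<lambda>y. F (\<phi> y) (X y)) x u = \<partial> (\<lambda>y. F (\<phi> y) (X x)) x u + F (\<phi> x) (\<partial> X x u)"
    by (rule dir_deriv_linear_apply(2)[OF U, where F = "\<lambda>y. F (\<phi> y)"]) (intro F(1) \<phi>(2) d X | assumption)+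
  then show "\<partial> (\<lambda>y. F (\<phi> y) (X y)) x u = \<partial> (\<lambda>z. F z (X x)) (\<phi> x) (\<partial> \<phi> x u) + F (\<phi> x) (\<partial> X x u)"
    by (simp add: dir_deriv_chain[OF \<phi>(1) F(2)])
qed

locale coordinate_change = M: metric_chart S g + M': metric_chart S' g'
  for S :: "(real ^ 'n::finite) set" and g S' and g' :: "'n local_bilin" +
  fixes U :: "(real ^ 'n) set" and \<phi> :: "real ^ 'n \<Rightarrow> real ^ 'n"
  assumes U: "open U" "U \<subseteq> S" and \<phi>: "smooth_on U \<phi>" "\<And>x. x \<in> U \<Longrightarrow> \<phi> x \<in> S'"
    and surj_\<phi>: "\<And>x. x \<in> U \<Longrightarrow> surj (\<partial> \<phi> x)"
    and isometry: "\<And>x u v. x \<in> U \<Longrightarrow> g x u v = g' (\<phi> x) (\<partial> \<phi> x u) (\<partial> \<phi> x v)"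
begin

lemma differentiable_\<phi>: "x \<in> U \<Longrightarrow> \<phi> differentiable (at x)"
  by (rule smooth_on_differentiable[OF \<phi>(1)])

lemma linear_d\<phi>: "x \<in> U \<Longrightarrow> linear (\<partial> \<phi> x)"
  by (rule linear_dir_deriv[OF differentiable_\<phi>])

lemma differentiable_d\<phi>: "x \<in> U \<Longrightarrow> (\<lambda>y. \<partial> \<phi> y v) differentiable (at x)"
  by (rule smooth_on_differentiable[OF smooth_on_dir_deriv[OF \<phi>(1)]])

lemma inj_d\<phi>: "x \<in> U \<Longrightarrow> \<partial> \<phi> x u = 0 \<Longrightarrow> u = 0"
  using linear_surjective_imp_injective[OF linear_d\<phi> surj_\<phi>, of x] linear_injective_0[OF linear_d\<phi>] by blast

text \<open>The difference of the two sides is symmetric in its arguments and, by compatibility of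
  both connections with the metric, skew in the last one and a test vector; so it vanishes.\<close>

lemma christoffel_transform:
  assumes x: "x \<in> U"
  shows "\<partial> \<phi> x (christoffel g x u v) =
    christoffel g' (\<phi> x) (\<partial> \<phi> x u) (\<partial> \<phi> x v) + \<partial> (\<lambda>y. \<partial> \<phi> y v) x u"
proof -
  note xS = subsetD[OF U(2) x] and xS' = \<phi>(2)[OF x]
  let ?P = "\<partial> \<phi> x" and ?H = "\<lambda>u v. \<partial> (\<lambda>y. \<partial> \<phi> y v) x u"
  define \<Delta> where "\<Delta> u v = ?P (christoffel g x u v) - christoffel g' (\<phi> x) (?P u) (?P v) - ?H u v" for u v
  have sym: "\<Delta> u v = \<Delta> v u" for u v
    using M.christoffel_sym[OF xS, of u v] M'.christoffel_sym[OF xS', of "?P u" "?P v"]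
      dir_deriv_commute[OF U(1) x \<phi>(1), of v u] by (simp add: \<Delta>_def)
  have skew: "g' (\<phi> x) (\<Delta> u v) (?P w) + g' (\<phi> x) (?P v) (\<Delta> u w) = 0" for u v w
  proof -
    note A = dir_deriv_pullback[OF U(1) x differentiable_\<phi>[OF x] \<phi>(2) M'.linear_g(1) M'.differentiable_g[OF xS']
        differentiable_d\<phi>[OF x]]
    have "\<partial> (\<lambda>y. g y v w) x u = \<partial> (\<lambda>y. g' (\<phi> y) (\<partial> \<phi> y v) (\<partial> \<phi> y w)) x u"
      by (rule fun_cong[OF dir_deriv_cong[OF U(1) x isometry]])
    also have "\<dots> = \<partial> (\<lambda>y. g' (\<phi> y) (?P v) (\<partial> \<phi> y w)) x u + g' (\<phi> x) (?H u v) (?P w)"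
    proof (rule dir_deriv_linear_apply(2)[OF U(1) x, where F = "\<lambda>y a. g' (\<phi> y) a (\<partial> \<phi> y w)"])
      show "linear (\<lambda>a. g' (\<phi> y) a (\<partial> \<phi> y w))" if "y \<in> U" for y by (rule M'.linear_g(2)[OF \<phi>(2)[OF that]])
      show "(\<lambda>y. g' (\<phi> y) a (\<partial> \<phi> y w)) differentiable at x" for a by (rule A(1))
    qed (rule differentiable_d\<phi>[OF x])
    also have "\<dots> = \<partial> (\<lambda>z. g' z (?P v) (?P w)) (\<phi> x) (?P u) + g' (\<phi> x) (?P v) (?H u w)
        + g' (\<phi> x) (?H u v) (?P w)"
      by (simp add: A(2))
    finally show ?thesis
      by (simp add: M.dg[OF xS] M'.dg[OF xS'] isometry[OF x] \<Delta>_def M'.g_simps[OF xS'])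
  qed
  have "g' (\<phi> x) (\<Delta> u v) (?P w) = 0" for u v w
    using skew[of u v w] skew[of w u v] skew[of v w u] sym[of u v] sym[of v w] sym[of w u]
      M'.sym_g[OF xS', of "?P v"] M'.sym_g[OF xS', of "?P u"] M'.sym_g[OF xS', of "?P w"] by simp
  then have "\<Delta> u v = 0"
    using surj_\<phi>[OF x] by (intro M'.g_eqI[OF xS']) (metis M'.g_simps(9)[OF xS'] surjD)
  then show ?thesis by (simp add: \<Delta>_def algebra_simps)
qed

text \<open>The second derivatives of \<phi> produced by the product rule cancel those in
  \<open>christoffel_transform\<close>.\<close>

lemma nabla_endo_transform:
  assumes J: "\<And>x. x \<in> S \<Longrightarrow> linear (J x)" "\<And>v. smooth_on S (\<lambda>x. J x v)"
    and J': "\<And>x. x \<in> S' \<Longrightarrow> linear (J' x)" "\<And>v. smooth_on S' (\<lambda>x. J' x v)"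
    and JJ': "\<And>x v. x \<in> U \<Longrightarrow> \<partial> \<phi> x (J x v) = J' (\<phi> x) (\<partial> \<phi> x v)"
    and x: "x \<in> U"
  shows "\<partial> \<phi> x (nabla_endo g J x u w) = nabla_endo g' J' (\<phi> x) (\<partial> \<phi> x u) (\<partial> \<phi> x w)"
proof -
  note xS = subsetD[OF U(2) x] and xS' = \<phi>(2)[OF x]
  have dJ: "(\<lambda>y. J y w) differentiable (at x)" by (rule smooth_on_differentiable[OF J(2) xS])
  have "\<partial> (\<lambda>y. \<partial> \<phi> y (J y w)) x u = \<partial> (\<lambda>y. J' (\<phi> y) (\<partial> \<phi> y w)) x u"
    by (rule fun_cong[OF dir_deriv_cong[OF U(1) x JJ']])
  moreover have "\<partial> (\<lambda>y. \<partial> \<phi> y (J y w)) x u = \<partial> (\<lambda>y. \<partial> \<phi> y (J x w)) x u + \<partial> \<phi> x (\<partial> (\<lambda>y. J y w) x u)"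
    by (rule dir_deriv_linear_apply(2)[OF U(1) x linear_d\<phi> differentiable_d\<phi>[OF x] dJ])
  moreover have "\<partial> (\<lambda>y. J' (\<phi> y) (\<partial> \<phi> y w)) x u =
      \<partial> (\<lambda>z. J' z (\<partial> \<phi> x w)) (\<phi> x) (\<partial> \<phi> x u) + J' (\<phi> x) (\<partial> (\<lambda>y. \<partial> \<phi> y w) x u)"
    by (rule dir_deriv_pullback(2)[OF U(1) x differentiable_\<phi>[OF x] \<phi>(2) J'(1)
        smooth_on_differentiable[OF J'(2) xS'] differentiable_d\<phi>[OF x]])
  ultimately show ?thesis
    by (simp add: nabla_endo_def M.nabla_const M'.nabla_const linear_diff[OF linear_d\<phi>[OF x]]
        linear_add[OF linear_d\<phi>[OF x]] christoffel_transform[OF x] JJ'[OF x] linear_add[OF J'(1)[OF xS']]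
        algebra_simps)
qed

end

lemma opposite_eq_opp: "opposite g J c = opp (g c) (J c)"
  by (rule ext) (simp add: opposite_def opp_def)

section \<open>Charts of an atlas and their transition maps\<close>

context
  fixes X :: "'a topology" and A :: "('a, 'n::finite) chart set"
  assumes atlas: "smooth_atlas X A"
begin

lemma chart_subset: "c \<in> A \<Longrightarrow> fst c \<subseteq> topspace X"
  using atlas by (auto simp: smooth_atlas_def)

lemma coords_topspace: "c \<in> A \<Longrightarrow> coords c (topspace X) = snd c ` fst c"
  using chart_subset by (auto simp: coords_def Int_absorb2)

lemma inj_chart: "c \<in> A \<Longrightarrow> inj_on (snd c) (fst c)"
  using atlas homeomorphic_imp_injective_map[of "subtopology X (fst c)" _ "snd c"] chart_subset[of c]
  unfolding smooth_atlas_def by (auto simp: Int_absorb1)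

lemma open_coords:
  assumes c: "c \<in> A" and T: "openin X T"
  shows "open (coords c T)"
proof -
  have h: "homeomorphic_map (subtopology X (fst c)) (top_of_set (snd c ` fst c)) (snd c)"
    and o: "open (snd c ` fst c)" using atlas c by (auto simp: smooth_atlas_def)
  have "openin (subtopology X (fst c)) (fst c \<inter> T)" using T by (auto simp: openin_subtopology)
  then have "openin (top_of_set (snd c ` fst c)) (snd c ` (fst c \<inter> T))"
    using homeomorphic_imp_open_map[OF h] by (simp add: open_map_def)
  then show ?thesis using openin_open_trans[OF _ o] by (simp add: coords_def)
qed

lemma openin_chart_preimage:
  assumes c: "c \<in> A" and W: "open W"
  shows "openin X {p \<in> fst c. snd c p \<in> W}"
proof -
  have h: "homeomorphic_map (subtopology X (fst c)) (top_of_set (snd c ` fst c)) (snd c)"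
    and o: "openin X (fst c)" using atlas c by (auto simp: smooth_atlas_def)
  have "openin (top_of_set (snd c ` fst c)) (snd c ` fst c \<inter> W)" using W by auto
  from openin_continuous_map_preimage[OF homeomorphic_imp_continuous_map[OF h] this]
  have "openin (subtopology X (fst c)) {p \<in> topspace (subtopology X (fst c)). snd c p \<in> snd c ` fst c \<inter> W}" .
  moreover have "{p \<in> topspace (subtopology X (fst c)). snd c p \<in> snd c ` fst c \<inter> W} = {p \<in> fst c. snd c p \<in> W}"
    using chart_subset[OF c] by auto
  ultimately show ?thesis using openin_trans_full[OF _ o] by simp
qed

lemma transition_apply:
  assumes "c \<in> A" "p \<in> fst c"
  shows "transition c d (snd c p) = snd d p"
  by (simp add: transition_def inv_into_f_f[OF inj_chart[OF assms(1)] assms(2)])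

lemma smooth_transition: "c \<in> A \<Longrightarrow> d \<in> A \<Longrightarrow> smooth_on (coords c (fst d)) (transition c d)"
  using atlas by (auto simp: smooth_atlas_def)

lemma openin_chart: "c \<in> A \<Longrightarrow> openin X (fst c)"
  using atlas by (auto simp: smooth_atlas_def)

text \<open>The chain rule for the composition with the reverse transition, which is the identity
  near the point, yields a right inverse of the differential.\<close>

lemma surj_transition:
  assumes cd: "c \<in> A" "d \<in> A" and x: "x \<in> coords c (fst d)"
  shows "surj (\<partial> (transition c d) x)"
proof -
  obtain p where p: "p \<in> fst c" "p \<in> fst d" "x = snd c p" using x by (auto simp: coords_def)
  let ?z = "snd d p"
  have z: "?z \<in> coords d (fst c)" and zx: "transition d c ?z = x"
    using p transition_apply[OF cd(2), of p c] by (auto simp: coords_def)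
  have id: "transition c d (transition d c y) = y" if "y \<in> coords d (fst c)" for y
    using that transition_apply[OF cd(1), of _ d] transition_apply[OF cd(2), of _ c] by (auto simp: coords_def)
  have "\<partial> (\<lambda>y. transition c d (transition d c y)) ?z = \<partial> (\<lambda>y. y) ?z"
    by (rule dir_deriv_cong[OF open_coords[OF cd(2) openin_chart[OF cd(1)]] z id])
  then have "\<partial> (transition c d) x (\<partial> (transition d c) ?z w) = w" for w
    using dir_deriv_chain[of "transition d c" ?z "transition c d" w] x z zx
      smooth_on_differentiable[OF smooth_transition[OF cd]]
      smooth_on_differentiable[OF smooth_transition[OF cd(2,1)]] by simp
  then show ?thesis by (metis surjI)
qed

end

section \<open>Passage from charts to the manifold\<close>

theorem proposition2:
  fixes X :: "'a topology"
    and A :: "('a, 4) chart set"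
    and g \<Omega> :: "('a, 4) bilin_field"
    and J :: "('a, 4) endo_field"
  assumes "strictly_almost_kaehler X A g J \<Omega>"
    and "third_gray_condition X A g J"
  shows "kaehler_on X A (non_kaehler_locus A g J) g (opposite g J)"
proof -
  let ?M = "topspace X"
  define U where "U = non_kaehler_locus A g J"
  have ak: "smooth_manifold X A" "riemannian_metric_on A ?M g" "almost_complex_on A ?M J"
    "symplectic_form_on A ?M \<Omega>"
    and \<Omega>: "\<And>c x u v. c \<in> A \<Longrightarrow> x \<in> coords c ?M \<Longrightarrow> \<Omega> c x u v = g c x (J c x u) v"
    using assms(1) by (auto simp: strictly_almost_kaehler_def almost_kaehler_def)
  have atlas: "smooth_atlas X A" using ak(1) by (simp add: smooth_manifold_def)
  have chart: "ak_chart (coords c ?M) (g c) (J c)" if c: "c \<in> A" for c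
  proof (intro ak_chart.intro metric_chart.intro ak_chart_axioms.intro)
    show o: "open (coords c ?M)" by (rule open_coords[OF atlas c]) simp
    fix x u v w z
    show "smooth_on (coords c ?M) (\<lambda>x. g c x u v)" "smooth_on (coords c ?M) (\<lambda>x. J c x v)"
      using ak c by (auto simp: riemannian_metric_on_def bilin_field_on_def almost_complex_on_def endo_field_on_def)
    assume x: "x \<in> coords c ?M"
    show "bilinear (g c x)" "g c x u v = g c x v u" "v \<noteq> 0 \<Longrightarrow> g c x v v > 0"
      using ak c x by (auto simp: riemannian_metric_on_def bilin_field_on_def)
    show "linear (J c x)" "J c x (J c x v) = - v"
      using ak c x by (auto simp: almost_complex_on_def endo_field_on_def)
    have "\<Omega> c x v v = 0" using ak(4) c x unfolding symplectic_form_on_def by blast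
    then show "g c x (J c x v) v = 0" by (simp add: \<Omega>[OF c x])
    show "riemann (g c) x u v w z = riemann (g c) x (J c x u) (J c x v) (J c x w) (J c x z)"
      using assms(2) c x unfolding third_gray_condition_def by blast
    have "\<partial> (\<lambda>y. g c y (J c y a) b) x = \<partial> (\<lambda>y. \<Omega> c y a b) x" for a b
      by (rule dir_deriv_cong[OF o x]) (simp add: \<Omega>[OF c])
    then show "ext_deriv (\<lambda>y u v. g c y (J c y u) v) x u v w = 0"
      using ak(4) c x by (simp add: ext_deriv_def symplectic_form_on_def closed_form_on_def)
  qed
  have change: "coordinate_change (coords c ?M) (g c) (coords d ?M) (g d) (coords c (fst d)) (transition c d)"
    if c: "c \<in> A" and d: "d \<in> A" for c d
  proof -
    interpret C: ak_chart "coords c ?M" "g c" "J c" by (rule chart[OF c])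
    interpret D: ak_chart "coords d ?M" "g d" "J d" by (rule chart[OF d])
    show ?thesis
    proof unfold_locales
      show "open (coords c (fst d))" by (rule open_coords[OF atlas c openin_chart[OF atlas d]])
      show "coords c (fst d) \<subseteq> coords c ?M" using chart_subset[OF atlas c] by (auto simp: coords_def)
      show "smooth_on (coords c (fst d)) (transition c d)" by (rule smooth_transition[OF atlas c d])
      fix x assume x: "x \<in> coords c (fst d)"
      show "transition c d x \<in> coords d ?M"
        using x transition_apply[OF atlas c, of _ d] chart_subset[OF atlas d] by (auto simp: coords_def)
      show "surj (\<partial> (transition c d) x)" by (rule surj_transition[OF atlas c d x])
      have "x \<in> coords c (fst d \<inter> ?M)" using x chart_subset[OF atlas d] by (auto simp: coords_def)
      then show "g c x u v = g d (transition c d x) (\<partial> (transition c d) x u) (\<partial> (transition c d) x v)" for u v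
        using ak(2) c d by (auto simp: riemannian_metric_on_def bilin_field_on_def)
    qed
  qed
  have J_transform: "\<partial> (transition c d) x (J c x v) = J d (transition c d x) (\<partial> (transition c d) x v)"
    if "c \<in> A" "d \<in> A" "x \<in> coords c (fst d)" for c d x v
  proof -
    have "x \<in> coords c (fst d \<inter> ?M)" using that chart_subset[OF atlas that(2)] by (auto simp: coords_def)
    then show ?thesis using ak(3) that by (auto simp: almost_complex_on_def endo_field_on_def)
  qed
  have nabla_transform: "\<partial> (transition c d) x (nabla_endo (g c) (J c) x u w) =
      nabla_endo (g d) (J d) (transition c d x) (\<partial> (transition c d) x u) (\<partial> (transition c d) x w)"
    if cd: "c \<in> A" "d \<in> A" and x: "x \<in> coords c (fst d)" for c d x u w
    by (rule coordinate_change.nabla_endo_transform[OF change[OF cd] ak_chart.linear_J[OF chart[OF cd(1)]]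
          ak_chart.smooth_J[OF chart[OF cd(1)]] ak_chart.linear_J[OF chart[OF cd(2)]]
          ak_chart.smooth_J[OF chart[OF cd(2)]] J_transform[OF cd] x])
  have UM: "U \<subseteq> ?M"
    using chart_subset[OF atlas] by (auto simp: U_def non_kaehler_locus_def)
  have coords_U: "coords c U \<subseteq> coords c ?M" for c using UM by (auto simp: coords_def)
  \<comment> \<open>A point lies in U because of some chart; injectivity of the differential carries
    the non-zero value over to every other chart.\<close>
  have nz: "\<exists>v w. nabla_endo (g c) (J c) x v w \<noteq> 0" if c: "c \<in> A" and x: "x \<in> coords c U" for c x
  proof -
    obtain p where p: "p \<in> fst c" "p \<in> U" "x = snd c p" using x by (auto simp: coords_def)
    then obtain d v w where d: "d \<in> A" "p \<in> fst d" "nabla_endo (g d) (J d) (snd d p) v w \<noteq> 0"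
      by (auto simp: U_def non_kaehler_locus_def)
    have y: "snd d p \<in> coords d (fst c)" using p d by (auto simp: coords_def)
    have "nabla_endo (g c) (J c) x (\<partial> (transition d c) (snd d p) v) (\<partial> (transition d c) (snd d p) w) \<noteq> 0"
      using nabla_transform[OF d(1) c y, of v w] transition_apply[OF atlas d(1,2), of c] p d(3)
        coordinate_change.inj_d\<phi>[OF change[OF d(1) c] y, of "nabla_endo (g d) (J d) (snd d p) v w"]
      by auto
    then show ?thesis by blast
  qed
  have U_open: "openin X U"
  proof -
    define W where "W c = (\<Union>v w. {x \<in> coords c ?M. nabla_endo (g c) (J c) x v w \<noteq> 0})" for c
    have "open (W c)" if c: "c \<in> A" for c
    proof -
      interpret C: ak_chart "coords c ?M" "g c" "J c" by (rule chart[OF c])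
      have "open {x \<in> coords c ?M. nabla_endo (g c) (J c) x v w \<noteq> 0}" for v w
      proof -
        have "{x \<in> coords c ?M. nabla_endo (g c) (J c) x v w \<noteq> 0}
            = coords c ?M \<inter> (\<lambda>x. nabla_endo (g c) (J c) x v w) -` (- {0})" by auto
        then show ?thesis
          using continuous_open_preimage[OF smooth_on_continuous[OF C.smooth_nabla_endo] C.S
              open_Compl[OF closed_singleton]] by simp
      qed
      then show ?thesis unfolding W_def by blast
    qed
    then have "openin X {p \<in> fst c. snd c p \<in> W c}" if "c \<in> A" for c
      using openin_chart_preimage[OF atlas that] that by blast
    then have "openin X (\<Union>c\<in>A. {p \<in> fst c. snd c p \<in> W c})" by (intro openin_Union) auto
    moreover have "U = (\<Union>c\<in>A. {p \<in> fst c. snd c p \<in> W c})"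
      by (auto simp: U_def non_kaehler_locus_def W_def coords_topspace[OF atlas])
    ultimately show ?thesis by simp
  qed
  have on_chart: "\<exists>V. open V \<and> x \<in> V \<and> (\<forall>u. smooth_on V (\<lambda>x. opposite g J c x u))"
    "linear (opposite g J c x)" "\<And>u. opposite g J c x (opposite g J c x u) = - u"
    "\<And>u v. g c x (opposite g J c x u) (opposite g J c x v) = g c x u v"
    "\<And>u. u \<in> kaehler_nullity (g c) (J c) x \<Longrightarrow> opposite g J c x u = J c x u"
    "\<And>u. u \<in> g_complement (g c) x (kaehler_nullity (g c) (J c) x) \<Longrightarrow> opposite g J c x u = - J c x u"
    "\<And>u. \<exists>a b. u = a + b \<and> a \<in> kaehler_nullity (g c) (J c) x
      \<and> b \<in> g_complement (g c) x (kaehler_nullity (g c) (J c) x)"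
    "\<And>u v. nijenhuis (opposite g J c) x u v = 0"
    "\<And>u1 u2 u3. ext_deriv (fundamental_form g (opposite g J) c) x u1 u2 u3 = 0"
    if c: "c \<in> A" and x: "x \<in> coords c U" for c x
  proof -
    obtain v w where vw: "nabla_endo (g c) (J c) x v w \<noteq> 0" using nz[OF c x] by blast
    have ff: "fundamental_form g (opposite g J) c = (\<lambda>y u v. g c y (opp (g c) (J c) y u) v)"
      by (intro ext) (simp add: fundamental_form_def opposite_eq_opp)
    show "\<exists>V. open V \<and> x \<in> V \<and> (\<forall>u. smooth_on V (\<lambda>x. opposite g J c x u))"
      "linear (opposite g J c x)" "\<And>u. opposite g J c x (opposite g J c x u) = - u"
      "\<And>u v. g c x (opposite g J c x u) (opposite g J c x v) = g c x u v"
      "\<And>u. u \<in> kaehler_nullity (g c) (J c) x \<Longrightarrow> opposite g J c x u = J c x u"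
      "\<And>u. u \<in> g_complement (g c) x (kaehler_nullity (g c) (J c) x) \<Longrightarrow> opposite g J c x u = - J c x u"
      "\<And>u. \<exists>a b. u = a + b \<and> a \<in> kaehler_nullity (g c) (J c) x
        \<and> b \<in> g_complement (g c) x (kaehler_nullity (g c) (J c) x)"
      "\<And>u v. nijenhuis (opposite g J c) x u v = 0"
      "\<And>u1 u2 u3. ext_deriv (fundamental_form g (opposite g J) c) x u1 u2 u3 = 0"
      unfolding opposite_eq_opp ff
      by (rule ak_chart.opposite_local[OF chart[OF c] subsetD[OF coords_U x] vw]; blast)+
  qed
  \<comment> \<open>The differential of the transition is an isometry that respects \<nabla>J, so it
    preserves nullity and complement; on each of them the opposite structure is J or -J, which is
    compatible with transitions.\<close>
  have transform: "\<partial> (transition c d) x (opposite g J c x v) =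
      opposite g J d (transition c d x) (\<partial> (transition c d) x v)"
    if cd: "c \<in> A" "d \<in> A" and x: "x \<in> coords c (fst d \<inter> U)" for c d x v
  proof -
    interpret T: coordinate_change "coords c ?M" "g c" "coords d ?M" "g d" "coords c (fst d)" "transition c d"
      by (rule change[OF cd])
    let ?P = "\<partial> (transition c d) x" and ?z = "transition c d x"
    let ?D = "kaehler_nullity (g c) (J c) x" and ?D' = "kaehler_nullity (g d) (J d) ?z"
    have xd: "x \<in> coords c (fst d)" and xU: "x \<in> coords c U" using x by (auto simp: coords_def)
    have zU: "?z \<in> coords d U"
      using x transition_apply[OF atlas cd(1), of _ d] by (auto simp: coords_def)
    have lin: "linear ?P" by (rule T.linear_d\<phi>[OF xd])
    have D: "?P a \<in> ?D' \<longleftrightarrow> a \<in> ?D" for a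
    proof -
      \<comment> \<open>By surjectivity it is enough to test on vectors in the image of the
        differential.\<close>
      have "(\<forall>w. nabla_endo (g d) (J d) ?z (?P a) w = 0) \<longleftrightarrow> (\<forall>w. nabla_endo (g d) (J d) ?z (?P a) (?P w) = 0)"
        using T.surj_\<phi>[OF xd] by (metis surjD)
      also have "\<dots> \<longleftrightarrow> (\<forall>w. nabla_endo (g c) (J c) x a w = 0)"
        unfolding nabla_transform[OF cd xd, symmetric] using T.inj_d\<phi>[OF xd] linear_0[OF lin] by metis
      finally show ?thesis by (simp add: kaehler_nullity_def)
    qed
    obtain a b where v: "v = a + b" and a: "a \<in> ?D" and b: "b \<in> g_complement (g c) x ?D"
      using on_chart(7)[OF cd(1) xU, of v] by blast
    have "?P b \<in> g_complement (g d) ?z ?D'"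
      unfolding g_complement_def
    proof (intro CollectI ballI)
      fix v' assume v': "v' \<in> ?D'"
      obtain v'' where "v' = ?P v''" using T.surj_\<phi>[OF xd] by (metis surjD)
      then show "g d ?z v' (?P b) = 0"
        using v' D b T.isometry[OF xd, of v'' b] by (auto simp: g_complement_def)
    qed
    then show ?thesis
      using a b D[of a] J_transform[OF cd xd]
      by (simp add: v linear_add[OF lin] linear_diff[OF lin] linear_add[OF on_chart(2)[OF cd(1) xU]]
          linear_add[OF on_chart(2)[OF cd(2) zU]] on_chart(5,6)[OF cd(1) xU] on_chart(5,6)[OF cd(2) zU])
  qed
  have "almost_complex_on A U (opposite g J)"
    unfolding almost_complex_on_def endo_field_on_def
  proof (intro conjI ballI allI)
    fix c v assume c: "c \<in> A"
    show "smooth_on (coords c U) (\<lambda>x. opposite g J c x v)"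
      using on_chart(1)[OF c] by (intro smooth_on_local) blast
  qed (use on_chart transform in auto)
  moreover have "riemannian_metric_on A U g"
    unfolding riemannian_metric_on_def bilin_field_on_def
  proof (intro conjI ballI allI impI)
    fix c x u v assume c: "c \<in> A"
    show "smooth_on (coords c U) (\<lambda>x. g c x u v)"
      using ak(2) c
      by (intro smooth_on_subset[OF _ coords_U]) (auto simp: riemannian_metric_on_def bilin_field_on_def)
    fix d assume d: "d \<in> A" and x: "x \<in> coords c (fst d \<inter> U)"
    have "x \<in> coords c (fst d \<inter> ?M)" using x UM by (auto simp: coords_def)
    then show "g c x u v = g d (transition c d x) (\<partial> (transition c d) x u) (\<partial> (transition c d) x v)"
      using ak(2) c d by (auto simp: riemannian_metric_on_def bilin_field_on_def)
  next
    fix c x u v assume c: "c \<in> A" and "x \<in> coords c U"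
    then have x: "x \<in> coords c ?M" using coords_U by blast
    interpret C: ak_chart "coords c ?M" "g c" "J c" by (rule chart[OF c])
    show "bilinear (g c x)" "g c x u v = g c x v u" "v \<noteq> 0 \<Longrightarrow> g c x v v > 0"
      using C.bilinear_g[OF x] C.sym_g[OF x] C.pos_g[OF x] by auto
  qed
  ultimately show ?thesis
    using U_open on_chart(4,8,9)
    by (auto simp: kaehler_on_def integrable_acs_on_def closed_form_on_def U_def[symmetric])
qed

end
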